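(* Let $Q$ be one of the quadratic spline quasi-interpolants $S_2$, $W_2^*$ on $\Omega$. (i) There exists a constant $D_2>0$, with $D_2\le 183$ for $Q=S_2$ and $D_2\le\frac{195}{2}$ for $Q=W_2^*$, such that, for every $f\in C^2(\Omega)$, every $|\alpha|=2$ and every triangular cell $T$ of $\mathcal T_{mn}$, $$\|D^\alpha f-D^\alpha Qf\|_{\mathrm{int}(T)}\le\left[1+D_2\left(\frac h\delta\right)^2\right]\omega(D^2f,h/2).$$ (ii) There exists a constant $D_3>0$, with $D_3\le\frac{269}{8}$ for $Q=S_2$ and $D_3\le\frac{65}{4}$ for $Q=W_2^*$, such that, for every $f\in C^3(\Omega)$, every $|\alpha|=2$ and every triangular cell $T$ of $\mathcal T_{mn}$, $$\|D^\alpha f-D^\alpha Qf\|_{\mathrm{int}(T)}\le\left[1+D_3\left(\frac h\delta\right)^2\right]h\,\|D^3f\|.$$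
   Context: Partition. Let $m,n\ge 1$ be integers, $\Omega=[a,b]\times[c,d]$, $a=x_0<x_1<\dots<x_m=b$ and $c=y_0<y_1<\dots<y_n=d$, with the conventions $x_{-1}=x_0$, $x_{m+1}=x_m$, $y_{-1}=y_0$, $y_{n+1}=y_n$. Put $h_i=x_i-x_{i-1}$, $k_j=y_j-y_{j-1}$ (so $h_0=h_{m+1}=k_0=k_{n+1}=0$), $s_i=\frac12(x_{i-1}+x_i)$, $t_j=\frac12(y_{j-1}+y_j)$ for $0\le i\le m+1$, $0\le j\le n+1$. Put $M_{i,j}=(s_i,t_j)$ for these indices and $A_{i,j}=(x_i,y_j)$ for $-1\le i\le m+1$, $-1\le j\le n+1$. The criss-cross triangulation $\mathcal T_{mn}$ of $\Omega$ is obtained by drawing both diagonals in each subrectangle $\Omega_{ij}=[x_{i-1},x_i]\times[y_{j-1},y_j]$, $1\le i\le m$, $1\le j\le n$; its triangles are the triangular cells. B-splines. Choose extended knots $u_{-2}<u_{-1}<u_0<\dots<u_m<u_{m+1}<u_{m+2}$ with $u_i=x_i$ for $0\le i\le m$, and $v_{-2}<v_{-1}<v_0<\dots<v_n<v_{n+1}<v_{n+2}$ with $v_j=y_j$ for $0\le j\le n$. For $0\le i\le m+1$, $0\le j\le n+1$, the classical B-spline $\overline B_{ij}$ is the unique $C^1$ function on $\mathbb R^2$ that is a polynomial of total degree at most 2 on each triangle of the criss-cross triangulation (both diagonals in each subrectangle) of the grid $\{u_p\}\times\{v_q\}$, vanishes outside the octagon with vertices $(u_{i-2},v_{j-1}),(u_{i-2},v_j),(u_{i-1},v_{j+1}),(u_i,v_{j+1}),(u_{i+1},v_j),(u_{i+1},v_{j-1}),(u_i,v_{j-2}),(u_{i-1},v_{j-2})$,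 and is normalized by $\overline B_{ij}(u_i,v_j)=\frac{u_{i+1}-u_i}{u_{i+1}-u_{i-1}}\cdot\frac{v_{j+1}-v_j}{v_{j+1}-v_{j-1}}$. Let $\bar h_0=u_0-u_{-1}$, $\bar h_{m+1}=u_{m+1}-u_m$, $\bar k_0=v_0-v_{-1}$, $\bar k_{n+1}=v_{n+1}-v_n$. Define $\alpha_{00}=\frac{\bar h_0+h_1}{h_1}$, $\alpha_{m+1,m+1}=\frac{h_m+\bar h_{m+1}}{h_m}$, $\alpha_{ii}=1$ for $1\le i\le m$, $\alpha_{1,0}=-\frac{\bar h_0}{h_1}$, $\alpha_{m,m+1}=-\frac{\bar h_{m+1}}{h_m}$, all other $\alpha_{ip}=0$; and define $\beta_{jq}$ in the same way with $n,k,\bar k$ in place of $m,h,\bar h$. The B-spline $B_{ij}$ is the restriction to $\Omega$ of $\sum_{p=0}^{m+1}\sum_{q=0}^{n+1}\alpha_{ip}\beta_{jq}\overline B_{pq}$. The functions $B_{ij}$ are nonnegative, have supports in $\Omega$, and sum to 1. Quasi-interpolants. For $2\le i\le m$ put $\sigma_i=\frac{h_i}{h_{i-1}+h_i}$, $\sigma_i'=1-\sigma_i$; for $2\le j\le n$ put $\tau_j=\frac{k_j}{k_{j-1}+k_j}$, $\tau_j'=1-\tau_j$; and $\sigma_1=\sigma'_{m+1}=\tau_1=\tau'_{n+1}=1$, $\sigma_1'=\sigma_{m+1}=\tau_1'=\tau_{n+1}=0$. For $1\le i\le m$, $1\le j\le n$, $$a_i=-\frac{\sigma_i^2\sigma_{i+1}'}{\sigma_i+\sigma_{i+1}'},\quad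 c_i=-\frac{\sigma_i(\sigma_{i+1}')^2}{\sigma_i+\sigma_{i+1}'},\quad \bar a_j=-\frac{\tau_j^2\tau_{j+1}'}{\tau_j+\tau_{j+1}'},\quad \bar c_j=-\frac{\tau_j(\tau_{j+1}')^2}{\tau_j+\tau_{j+1}'},$$ and $a_0=c_0=a_{m+1}=c_{m+1}=\bar a_0=\bar c_0=\bar a_{n+1}=\bar c_{n+1}=0$; $b_{ij}=1-(a_i+c_i+\bar a_j+\bar c_j)$. Then $S_2f=\sum_{i=0}^{m+1}\sum_{j=0}^{n+1}\mu_{ij}(f)B_{ij}$ with $\mu_{ij}(f)=b_{ij}f(M_{i,j})+a_if(M_{i-1,j})+c_if(M_{i+1,j})+\bar a_jf(M_{i,j-1})+\bar c_jf(M_{i,j+1})$ (terms with zero coefficient are omitted), and $W_2^*f=\sum_{i=0}^{m+1}\sum_{j=0}^{n+1}\mu^*_{ij}(f)B_{ij}$ with $\mu^*_{ij}(f)=2f(M_{i,j})-\frac14[f(A_{i-1,j-1})+f(A_{i-1,j})+f(A_{i,j-1})+f(A_{i,j})]$. Notation. $h=\max\{h_i,k_j: 1\le i\le m,\,1\le j\le n\}$, $\delta=\min\{h_i,k_j: 1\le i\le m,\,1\le j\le n\}$; $\|\cdot\|_\Omega$ and $\|\cdot\|_{\mathrm{int}(T)}$ are the supremum norms over $\Omega$ and over the interior of $T$; for $\psi\in C(\Omega)$, $\omega(\psi,t)=\max\{|\psi(M)-\psi(P)|: M,P\in\Omega,\ \|MP\|\le t\}$, where $\|MP\|$ is the Euclidean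 distance; for a multi-index $\alpha=(\alpha_1,\alpha_2)$ of nonnegative integers, $D^\alpha=\frac{\partial^{|\alpha|}}{\partial x^{\alpha_1}\partial y^{\alpha_2}}$ with $|\alpha|=\alpha_1+\alpha_2$; $\omega(D^sf,t)=\max\{\omega(D^\alpha f,t):|\alpha|=s\}$; $\|D^3f\|=\max\{\|D^\alpha f\|_\Omega:|\alpha|=3\}$. *)

theory Defs
  imports "HOL-Analysis.Analysis" "HOL-Library.Extended_Real"
begin

text \<open>Partial derivatives are taken within a set \<open>S\<close>: along the boundary of a closed rectangle
  they are one-sided, and in its interior they are the usual ones.\<close>

definition pderiv_x :: "(real \<times> real) set \<Rightarrow> (real \<times> real \<Rightarrow> real) \<Rightarrow> real \<times> real \<Rightarrow> real" where
  "pderiv_x S f = (\<lambda>(x, y). vector_derivative (\<lambda>t. f (t, y)) (at x within {t. (t, y) \<in> S}))"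

definition pderiv_y :: "(real \<times> real) set \<Rightarrow> (real \<times> real \<Rightarrow> real) \<Rightarrow> real \<times> real \<Rightarrow> real" where
  "pderiv_y S f = (\<lambda>(x, y). vector_derivative (\<lambda>t. f (x, t)) (at y within {t. (x, t) \<in> S}))"

definition multi_deriv ::
  "(real \<times> real) set \<Rightarrow> nat \<times> nat \<Rightarrow> (real \<times> real \<Rightarrow> real) \<Rightarrow> real \<times> real \<Rightarrow> real" where
  "multi_deriv S \<alpha> f = (pderiv_x S ^^ fst \<alpha>) ((pderiv_y S ^^ snd \<alpha>) f)"

definition multi_indices :: "nat \<Rightarrow> (nat \<times> nat) set" where
  "multi_indices s = {\<alpha>. fst \<alpha> + snd \<alpha> = s}"

primrec C_k_on :: "nat \<Rightarrow> (real \<times> real) set \<Rightarrow> (real \<times> real \<Rightarrow> real) \<Rightarrow> bool" where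
  "C_k_on 0 S f \<longleftrightarrow> continuous_on S f"
| "C_k_on (Suc k) S f \<longleftrightarrow>
     continuous_on S f \<and>
     (\<forall>(x, y)\<in>S. (\<lambda>t. f (t, y)) differentiable (at x within {t. (t, y) \<in> S}) \<and>
                 (\<lambda>t. f (x, t)) differentiable (at y within {t. (x, t) \<in> S})) \<and>
     C_k_on k S (pderiv_x S f) \<and> C_k_on k S (pderiv_y S f)"

text \<open>Suprema are formed in the extended reals, so that an inequality between them
  also asserts boundedness.\<close>

definition sup_norm :: "(real \<times> real) set \<Rightarrow> (real \<times> real \<Rightarrow> real) \<Rightarrow> ereal" where
  "sup_norm S g = (SUP p\<in>S. ereal \<bar>g p\<bar>)"

definition modulus :: "(real \<times> real) set \<Rightarrow> (real \<times> real \<Rightarrow> real) \<Rightarrow> real \<Rightarrow> ereal" where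
  "modulus S \<psi> t = (SUP (M, P)\<in>{(M, P). M \<in> S \<and> P \<in> S \<and> dist M P \<le> t}. ereal \<bar>\<psi> M - \<psi> P\<bar>)"

definition modulus_D :: "(real \<times> real) set \<Rightarrow> nat \<Rightarrow> (real \<times> real \<Rightarrow> real) \<Rightarrow> real \<Rightarrow> ereal" where
  "modulus_D S s f t = Max ((\<lambda>\<alpha>. modulus S (multi_deriv S \<alpha> f) t) ` multi_indices s)"

definition sup_norm_D :: "(real \<times> real) set \<Rightarrow> nat \<Rightarrow> (real \<times> real \<Rightarrow> real) \<Rightarrow> ereal" where
  "sup_norm_D S s f = Max ((\<lambda>\<alpha>. sup_norm S (multi_deriv S \<alpha> f)) ` multi_indices s)"

definition partition_of :: "real \<Rightarrow> real \<Rightarrow> int \<Rightarrow> (int \<Rightarrow> real) \<Rightarrow> bool" where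
  "partition_of a b m x \<longleftrightarrow>
     1 \<le> m \<and> x 0 = a \<and> x m = b \<and> (\<forall>i\<in>{1..m}. x (i - 1) < x i) \<and>
     x (- 1) = x 0 \<and> x (m + 1) = x m"

definition extended_knots :: "int \<Rightarrow> (int \<Rightarrow> real) \<Rightarrow> (int \<Rightarrow> real) \<Rightarrow> bool" where
  "extended_knots m x u \<longleftrightarrow>
     (\<forall>i\<in>{- 1..m + 2}. u (i - 1) < u i) \<and> (\<forall>i\<in>{0..m}. u i = x i)"

definition step :: "(int \<Rightarrow> real) \<Rightarrow> int \<Rightarrow> real" where
  "step x i = x i - x (i - 1)"

definition midpt :: "(int \<Rightarrow> real) \<Rightarrow> int \<Rightarrow> real" where
  "midpt x i = (x (i - 1) + x i) / 2"

definition mesh_max :: "int \<Rightarrow> int \<Rightarrow> (int \<Rightarrow> real) \<Rightarrow> (int \<Rightarrow> real) \<Rightarrow> real" where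
  "mesh_max m n x y = Max (step x ` {1..m} \<union> step y ` {1..n})"

definition mesh_min :: "int \<Rightarrow> int \<Rightarrow> (int \<Rightarrow> real) \<Rightarrow> (int \<Rightarrow> real) \<Rightarrow> real" where
  "mesh_min m n x y = Min (step x ` {1..m} \<union> step y ` {1..n})"

text \<open>The two diagonals cut a rectangle into four triangles, each spanned by the centre and
  one side.\<close>

definition rect_triangles :: "real \<Rightarrow> real \<Rightarrow> real \<Rightarrow> real \<Rightarrow> (real \<times> real) set set" where
  "rect_triangles x0 x1 y0 y1 =
     (let z = ((x0 + x1) / 2, (y0 + y1) / 2) in
      {convex hull {z, (x0, y0), (x1, y0)}, convex hull {z, (x1, y0), (x1, y1)},
       convex hull {z, (x1, y1), (x0, y1)}, convex hull {z, (x0, y1), (x0, y0)}})"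

definition criss_cross ::
  "int set \<Rightarrow> int set \<Rightarrow> (int \<Rightarrow> real) \<Rightarrow> (int \<Rightarrow> real) \<Rightarrow> (real \<times> real) set set" where
  "criss_cross I J x y = (\<Union>i\<in>I. \<Union>j\<in>J. rect_triangles (x (i - 1)) (x i) (y (j - 1)) (y j))"

definition quadratic_on :: "(real \<times> real) set \<Rightarrow> (real \<times> real \<Rightarrow> real) \<Rightarrow> bool" where
  "quadratic_on T g \<longleftrightarrow>
     (\<exists>c0 c1 c2 c3 c4 c5. \<forall>(x, y)\<in>T. g (x, y) = c0 + c1 * x + c2 * y + c3 * x\<^sup>2 + c4 * x * y + c5 * y\<^sup>2)"

definition octagon :: "(int \<Rightarrow> real) \<Rightarrow> (int \<Rightarrow> real) \<Rightarrow> int \<Rightarrow> int \<Rightarrow> (real \<times> real) set" where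
  "octagon u v i j = convex hull
     {(u (i - 2), v (j - 1)), (u (i - 2), v j), (u (i - 1), v (j + 1)), (u i, v (j + 1)),
      (u (i + 1), v j), (u (i + 1), v (j - 1)), (u i, v (j - 2)), (u (i - 1), v (j - 2))}"

definition is_classical_bspline ::
  "int \<Rightarrow> int \<Rightarrow> (int \<Rightarrow> real) \<Rightarrow> (int \<Rightarrow> real) \<Rightarrow> int \<Rightarrow> int \<Rightarrow> (real \<times> real \<Rightarrow> real) \<Rightarrow> bool" where
  "is_classical_bspline m n u v i j g \<longleftrightarrow>
     C_k_on 1 UNIV g \<and>
     (\<forall>T\<in>criss_cross {- 1..m + 2} {- 1..n + 2} u v. quadratic_on T g) \<and>
     (\<forall>p. p \<notin> octagon u v i j \<longrightarrow> g p = 0) \<and>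
     g (u i, v j) = (u (i + 1) - u i) / (u (i + 1) - u (i - 1)) *
                    ((v (j + 1) - v j) / (v (j + 1) - v (j - 1)))"

definition classical_bspline ::
  "int \<Rightarrow> int \<Rightarrow> (int \<Rightarrow> real) \<Rightarrow> (int \<Rightarrow> real) \<Rightarrow> int \<Rightarrow> int \<Rightarrow> real \<times> real \<Rightarrow> real" where
  "classical_bspline m n u v i j = (THE g. is_classical_bspline m n u v i j g)"

text \<open>The same coefficients serve both directions: \<open>\<beta>\<close> is \<open>bcoeff n y v\<close>.\<close>

definition bcoeff :: "int \<Rightarrow> (int \<Rightarrow> real) \<Rightarrow> (int \<Rightarrow> real) \<Rightarrow> int \<Rightarrow> int \<Rightarrow> real" where
  "bcoeff m x u i p =
     (if i = 0 \<and> p = 0 then (step u 0 + step x 1) / step x 1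
      else if i = m + 1 \<and> p = m + 1 then (step x m + step u (m + 1)) / step x m
      else if 1 \<le> i \<and> i \<le> m \<and> p = i then 1
      else if i = 1 \<and> p = 0 then - step u 0 / step x 1
      else if i = m \<and> p = m + 1 then - step u (m + 1) / step x m
      else 0)"

text \<open>The restriction to \<open>\<Omega>\<close> is not built in: these functions are only evaluated, and only
  differentiated, within \<open>\<Omega>\<close>.\<close>

definition bspline ::
  "int \<Rightarrow> int \<Rightarrow> (int \<Rightarrow> real) \<Rightarrow> (int \<Rightarrow> real) \<Rightarrow> (int \<Rightarrow> real) \<Rightarrow> (int \<Rightarrow> real) \<Rightarrow>
    int \<Rightarrow> int \<Rightarrow> real \<times> real \<Rightarrow> real" where
  "bspline m n x y u v i j P =
     (\<Sum>p=0..m + 1. \<Sum>q=0..n + 1. bcoeff m x u i p * bcoeff n y v j q * classical_bspline m n u v p q P)"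

definition sigma :: "int \<Rightarrow> (int \<Rightarrow> real) \<Rightarrow> int \<Rightarrow> real" where
  "sigma m x i = (if i = 1 then 1 else if i = m + 1 then 0 else step x i / (step x (i - 1) + step x i))"

definition sigma' :: "int \<Rightarrow> (int \<Rightarrow> real) \<Rightarrow> int \<Rightarrow> real" where
  "sigma' m x i = 1 - sigma m x i"

definition a_coeff :: "int \<Rightarrow> (int \<Rightarrow> real) \<Rightarrow> int \<Rightarrow> real" where
  "a_coeff m x i =
     (if 1 \<le> i \<and> i \<le> m
      then - ((sigma m x i)\<^sup>2 * sigma' m x (i + 1)) / (sigma m x i + sigma' m x (i + 1)) else 0)"

definition c_coeff :: "int \<Rightarrow> (int \<Rightarrow> real) \<Rightarrow> int \<Rightarrow> real" where
  "c_coeff m x i =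
     (if 1 \<le> i \<and> i \<le> m
      then - (sigma m x i * (sigma' m x (i + 1))\<^sup>2) / (sigma m x i + sigma' m x (i + 1)) else 0)"

definition b_coeff :: "int \<Rightarrow> int \<Rightarrow> (int \<Rightarrow> real) \<Rightarrow> (int \<Rightarrow> real) \<Rightarrow> int \<Rightarrow> int \<Rightarrow> real" where
  "b_coeff m n x y i j = 1 - (a_coeff m x i + c_coeff m x i + a_coeff n y j + c_coeff n y j)"

text \<open>Where a midpoint index below leaves \<open>{0..m+1}\<close> or \<open>{0..n+1}\<close>, its coefficient is zero.\<close>

definition mu ::
  "int \<Rightarrow> int \<Rightarrow> (int \<Rightarrow> real) \<Rightarrow> (int \<Rightarrow> real) \<Rightarrow> int \<Rightarrow> int \<Rightarrow> (real \<times> real \<Rightarrow> real) \<Rightarrow> real" where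
  "mu m n x y i j f =
     b_coeff m n x y i j * f (midpt x i, midpt y j) +
     a_coeff m x i * f (midpt x (i - 1), midpt y j) +
     c_coeff m x i * f (midpt x (i + 1), midpt y j) +
     a_coeff n y j * f (midpt x i, midpt y (j - 1)) +
     c_coeff n y j * f (midpt x i, midpt y (j + 1))"

definition mu_star ::
  "(int \<Rightarrow> real) \<Rightarrow> (int \<Rightarrow> real) \<Rightarrow> int \<Rightarrow> int \<Rightarrow> (real \<times> real \<Rightarrow> real) \<Rightarrow> real" where
  "mu_star x y i j f =
     2 * f (midpt x i, midpt y j) -
     1 / 4 * (f (x (i - 1), y (j - 1)) + f (x (i - 1), y j) + f (x i, y (j - 1)) + f (x i, y j))"

definition S2 ::
  "int \<Rightarrow> int \<Rightarrow> (int \<Rightarrow> real) \<Rightarrow> (int \<Rightarrow> real) \<Rightarrow> (int \<Rightarrow> real) \<Rightarrow> (int \<Rightarrow> real) \<Rightarrow>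
    (real \<times> real \<Rightarrow> real) \<Rightarrow> real \<times> real \<Rightarrow> real" where
  "S2 m n x y u v f P =
     (\<Sum>i=0..m + 1. \<Sum>j=0..n + 1. mu m n x y i j f * bspline m n x y u v i j P)"

definition W2_star ::
  "int \<Rightarrow> int \<Rightarrow> (int \<Rightarrow> real) \<Rightarrow> (int \<Rightarrow> real) \<Rightarrow> (int \<Rightarrow> real) \<Rightarrow> (int \<Rightarrow> real) \<Rightarrow>
    (real \<times> real \<Rightarrow> real) \<Rightarrow> real \<times> real \<Rightarrow> real" where
  "W2_star m n x y u v f P =
     (\<Sum>i=0..m + 1. \<Sum>j=0..n + 1. mu_star x y i j f * bspline m n x y u v i j P)"

end

theory Submission
  imports Defs
begin

text \<open>A \<open>C\<^sup>1\<close> quadratic spline on a criss-cross grid is determined by its values and gradients at the grid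
  points, subject to the trapezoidal rule along every edge. The values and derivatives of a tensor
  product of univariate quadratic B-splines satisfy these constraints, so \<open>B\<^sub>i\<^sub>j\<close> is, cell by cell, the
  interpolant of such a product; this gives existence, uniqueness and explicit coefficients.

  The second derivatives of \<open>Q f\<close> on a triangle are then combinations of nine coefficients \<open>\<mu>\<^sub>i\<^sub>j(f)\<close>, exact
  on quadratic polynomials. Comparing \<open>f\<close> with its Taylor polynomial at the centre of the cell, the
  coefficients next to the centre have a small error \<open>E\<^sub>1\<close>, the four corner ones a larger error \<open>E\<^sub>2\<close>, and
  the corner ones have small weights: the total is at most \<open>(12 E\<^sub>1 + 4 E\<^sub>2) / \<delta>\<^sup>2\<close>.\<close>

subsection \<open>Uniqueness of the classical B-spline\<close>

text \<open>The B-spline is given by a definite description, so nothing can be computed before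
  existence and uniqueness are settled. The tensor product of univariate quadratic B-splines has
  total degree four; interpolating it on each cell lowers the degree to two and stays linear in each
  factor. Hence gluing at knots, reproduction of 1, \<open>x\<close>, \<open>x^2\<close> and the
  passage to repeated end knots are univariate computations. A cell has twelve corner data and four
  edge relations, which leaves eight degrees of freedom: the six quadratic monomials and one glued
  square \<open>z |z|\<close> across each diagonal. The reproducing coefficients are products of
  knots, and both quasi-interpolants are built to match them, so only Taylor remainders and
  oscillations of second derivatives survive. The two error levels come from two kinds of
  neighbours: along an axis the sum of the increments stays within \<open>h\<close>, at a corner
  only each increment does. Lengths are counted in units of \<open>h / 2\<close> with roots rounded
  up; this crude count already gives 62, 58/3 and 15.\<close>

definition gradient_at :: "(real \<times> real \<Rightarrow> real) \<Rightarrow> real \<times> real \<Rightarrow> real \<times> real \<Rightarrow> real" where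
  "gradient_at g P v = pderiv_x UNIV g P * fst v + pderiv_y UNIV g P * snd v"

text \<open>Separate differentiability says nothing about oblique directions such as the diagonals;
  continuity of the \<open>y\<close> partial derivative joins the two into a total
  derivative.\<close>

lemma C1_has_derivative:
  assumes "C_k_on 1 UNIV g"
  shows "(g has_derivative gradient_at g P) (at P)"
proof -
  obtain x y where P: "P = (x, y)" by (cases P)
  have dx: "((\<lambda>t. g (t, b)) has_vector_derivative pderiv_x UNIV g (a, b)) (at a)"
   and dy: "((\<lambda>t. g (a, t)) has_vector_derivative pderiv_y UNIV g (a, b)) (at b)" for a b
    using assms by (auto simp: pderiv_x_def pderiv_y_def vector_derivative_works[symmetric] numeral_eq_Suc)
  have cy: "continuous_on UNIV (pderiv_y UNIV g)"
    using assms by (auto simp: numeral_eq_Suc)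
  have "((\<lambda>(x, y). g (x, y)) has_derivative
      (\<lambda>(tx, ty). pderiv_x UNIV g (x, y) * tx + blinfun_scaleR_left (pderiv_y UNIV g (x, y)) ty))
      (at (x, y) within UNIV \<times> UNIV)"
  proof (rule has_derivative_partialsI)
    show "((\<lambda>x. g (x, y)) has_derivative (\<lambda>tx. pderiv_x UNIV g (x, y) * tx)) (at x within UNIV)"
      using dx[of y x] by (simp add: has_vector_derivative_def mult.commute)
    show "((\<lambda>y. g (x, y)) has_derivative blinfun_scaleR_left (pderiv_y UNIV g (x, y)))
        (at y within UNIV)" for x y
      using dy[of x y] by (simp add: has_vector_derivative_def)
    show "continuous (at (x, y) within UNIV \<times> UNIV) (\<lambda>(x, y). blinfun_scaleR_left (pderiv_y UNIV g (x, y)))"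
      using cy by (auto simp: case_prod_beta' continuous_on_eq_continuous_at intro!: continuous_intros)
  qed auto
  moreover have "gradient_at g P = (\<lambda>(tx, ty). pderiv_x UNIV g (x, y) * tx + blinfun_scaleR_left
      (pderiv_y UNIV g (x, y)) ty)"
    by (auto simp: fun_eq_iff gradient_at_def P)
  ultimately show ?thesis by (simp add: P)
qed

lemma quadratic_along_segment:
  assumes "quadratic_on T g" "convex T" "P \<in> T" "Q \<in> T"
  obtains A B C where "\<And>t. t \<in> {0..1} \<Longrightarrow> g (P + t *\<^sub>R (Q - P)) = A + B * t + C * t\<^sup>2"
proof -
  obtain x y x' y' where [simp]: "P = (x, y)" "Q = (x', y')" by (cases P, cases Q)
  obtain c0 c1 c2 c3 c4 c5 where q: "\<And>x y. (x, y) \<in> T \<Longrightarrow>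
     g (x, y) = c0 + c1 * x + c2 * y + c3 * x\<^sup>2 + c4 * x * y + c5 * y\<^sup>2"
    using assms(1) unfolding quadratic_on_def by fast
  have T: "P + t *\<^sub>R (Q - P) \<in> T" if "t \<in> {0..1}" for t
    using convexD[OF assms(2-4), of "1 - t" t] that by (simp add: algebra_simps)
  show ?thesis
  proof
    fix t :: real assume t: "t \<in> {0..1}"
    show "g (P + t *\<^sub>R (Q - P)) = (c0 + c1 * x + c2 * y + c3 * x\<^sup>2 + c4 * x * y + c5 * y\<^sup>2)
       + (c1 * (x' - x) + c2 * (y' - y) + 2 * c3 * x * (x' - x) + c4 * (x * (y' - y) + y * (x' - x))
           + 2 * c5 * y * (y' - y)) * t
       + (c3 * (x' - x)\<^sup>2 + c4 * (x' - x) * (y' - y) + c5 * (y' - y)\<^sup>2) * t\<^sup>2"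
      using q[of "x + t * (x' - x)" "y + t * (y' - y)"] T[OF t]
      by (simp add: power2_eq_square algebra_simps)
  qed
qed

text \<open>The trapezoidal rule is exact for the linear derivative of a quadratic; it ties
  the values of a spline at two points of a triangle to its gradients there.\<close>

lemma trapezoid:
  assumes g: "C_k_on 1 UNIV g" and T: "quadratic_on T g" "convex T" "P \<in> T" "Q \<in> T"
  shows "g Q - g P = (gradient_at g P (Q - P) + gradient_at g Q (Q - P)) / 2"
proof -
  obtain A B C where q: "\<And>t. t \<in> {0..1} \<Longrightarrow> g (P + t *\<^sub>R (Q - P)) = A + B * t + C * t\<^sup>2"
    using quadratic_along_segment[OF T] by blast
  have D: "gradient_at g (P + t *\<^sub>R (Q - P)) (Q - P) = B + 2 * C * t" if t: "t \<in> {0..1}" for t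
  proof -
    have "((\<lambda>t. g (P + t *\<^sub>R (Q - P))) has_derivative
        (\<lambda>s. gradient_at g (P + t *\<^sub>R (Q - P)) (s *\<^sub>R (Q - P)))) (at t)"
      by (rule has_derivative_compose[OF _ C1_has_derivative[OF g]]) (auto intro!: derivative_eq_intros)
    then have "((\<lambda>t. g (P + t *\<^sub>R (Q - P))) has_vector_derivative
        gradient_at g (P + t *\<^sub>R (Q - P)) (Q - P)) (at t)"
      by (simp add: has_vector_derivative_def gradient_at_def algebra_simps)
    then have 1: "((\<lambda>t. g (P + t *\<^sub>R (Q - P))) has_vector_derivative
        gradient_at g (P + t *\<^sub>R (Q - P)) (Q - P)) (at t within cbox 0 1)"
      by (rule has_vector_derivative_at_within)
    have "((\<lambda>t. A + B * t + C * t\<^sup>2) has_real_derivative B + 2 * C * t) (at t within cbox 0 1)"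
      by (auto intro!: derivative_eq_intros)
    then have "((\<lambda>t. A + B * t + C * t\<^sup>2) has_vector_derivative B + 2 * C * t) (at t within cbox 0 1)"
      by (simp add: has_real_derivative_iff_has_vector_derivative)
    then have 2: "((\<lambda>t. g (P + t *\<^sub>R (Q - P))) has_vector_derivative B + 2 * C * t) (at t within cbox 0 1)"
      by (rule has_vector_derivative_transform[rotated 2]) (use t q in auto)
    \<comment> \<open>The quadratic formula holds only for \<open>t\<close> in the closed unit
      interval. At 0 and 1, the values used below, it gives one-sided derivatives, which are still
      unique there.\<close>
    show ?thesis
      by (rule vector_derivative_unique_within_closed_interval[OF _ _ 1 2]) (use t in auto)
  qed
  show ?thesis using D[of 0] D[of 1] q[of 0] q[of 1] by (simp add: field_simps)
qed

text \<open>With zero data at the vertices the trapezoidal rule reads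
  \<open>g X = gradient_at g X (X - P) / 2\<close> for each vertex \<open>P\<close>. Averaging with
  the barycentric weights of \<open>X\<close> makes the vectors \<open>X - P\<close> cancel.\<close>

lemma zero_on_triangle:
  assumes g: "C_k_on 1 UNIV g" and T: "quadratic_on T g" "T = convex hull {A, B, C}"
    and z: "\<And>P. P \<in> {A, B, C} \<Longrightarrow> g P = 0 \<and> pderiv_x UNIV g P = 0 \<and> pderiv_y UNIV g P = 0"
    and X: "X \<in> T"
  shows "g X = 0"
proof -
  have v: "g X = gradient_at g X (X - P) / 2" if "P \<in> {A, B, C}" for P
  proof -
    have "P \<in> T" unfolding T(2) by (rule hull_inc[OF that])
    from trapezoid[OF g T(1) _ this X] z[OF that] show ?thesis
      by (simp add: gradient_at_def T(2) convex_convex_hull)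
  qed
  obtain p q r where "p \<ge> 0" "q \<ge> 0" "r \<ge> 0" and 1: "p + q + r = 1" and Xe: "X = p *\<^sub>R A + q *\<^sub>R B + r *\<^sub>R C"
    using X unfolding T(2) convex_hull_3 by blast
  have "g X = (p + q + r) * g X" by (simp add: 1)
  also have "\<dots> = p * (gradient_at g X (X - A) / 2) + q * (gradient_at g X (X - B) / 2) + r * (gradient_at g X
      (X - C) / 2)"
    using v[of A] v[of B] v[of C] by (simp only: insert_iff simp_thms distrib_right)
  also have "\<dots> = gradient_at g X ((p + q + r) *\<^sub>R X - (p *\<^sub>R A + q *\<^sub>R B + r *\<^sub>R C)) / 2"
    by (simp add: gradient_at_def algebra_simps add_divide_distrib diff_divide_distrib)
  also have "\<dots> = 0" using Xe 1 by (simp add: gradient_at_def)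
  finally show ?thesis .
qed

lemma convex_box:
  fixes a b c d x y :: real
  assumes S: "convex S" and c: "(a, c) \<in> S" "(b, c) \<in> S" "(a, d) \<in> S" "(b, d) \<in> S"
    and x: "a \<le> x" "x \<le> b" and y: "c \<le> y" "y \<le> d"
  shows "(x, y) \<in> S"
proof -
  have seg: "(1 - r) *\<^sub>R P + r *\<^sub>R Q \<in> S" if "P \<in> S" "Q \<in> S" "0 \<le> r" "r \<le> 1" for P Q and r :: real
    using convexD[OF S that(1,2), of "1 - r" r] that by simp
  have e: "(1 - r) * z + r * z = z" for r z :: real by (simp add: algebra_simps)
  have ex: "\<exists>r\<ge>0. r \<le> 1 \<and> z = (1 - r) * p + r * q" if "p \<le> z" "z \<le> q" for p q z :: real
  proof (cases "p = q")
    case True then show ?thesis using that by (intro exI[of _ 0]) auto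
  next
    case False
    have "z = (1 - (z - p) / (q - p)) * p + (z - p) / (q - p) * q"
      using False by (simp add: divide_simps) (simp add: algebra_simps)
    then show ?thesis using that False
      by (intro exI[of _ "(z - p) / (q - p)"]) (auto simp: divide_simps)
  qed
  obtain r where r: "r \<ge> 0" "r \<le> 1" "x = (1 - r) * a + r * b" using ex[OF x] by auto
  obtain s where s: "s \<ge> 0" "s \<le> 1" "y = (1 - s) * c + s * d" using ex[OF y] by auto
  have "(x, c) \<in> S" "(x, d) \<in> S"
    using seg[OF c(1,2) r(1,2)] seg[OF c(3,4) r(1,2)] r(3) by (simp_all add: e)
  from seg[OF this s(1,2)] s(3) show ?thesis by (simp add: e)
qed

text \<open>In centred coordinates \<open>s\<close>, \<open>t\<close> the diagonals are
  \<open>t = s\<close> and \<open>t = -s\<close>; the signs of \<open>s - t\<close> and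
  \<open>s + t\<close> select the triangle, and the barycentric weight of the centre is
  \<open>1 - max |s| |t|\<close>.\<close>

lemma rect_cover:
  assumes x: "x0 < x1" "x0 \<le> p" "p \<le> x1" and y: "y0 < y1" "y0 \<le> q" "q \<le> y1"
  shows "\<exists>T\<in>rect_triangles x0 x1 y0 y1. (p, q) \<in> T"
proof -
  define s t where "s = (2 * p - x0 - x1) / (x1 - x0)" and "t = (2 * q - y0 - y1) / (y1 - y0)"
  have s: "-1 \<le> s" "s \<le> 1" and t: "-1 \<le> t" "t \<le> 1"
    using x y by (auto simp: s_def t_def field_simps)
  have p: "p = (x0 + x1) / 2 + s * (x1 - x0) / 2" and q: "q = (y0 + y1) / 2 + t * (y1 - y0) / 2"
    using x(1) y(1) by (auto simp: s_def t_def divide_simps)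
  let ?z = "((x0 + x1) / 2, (y0 + y1) / 2)"
  have 1: "(p, q) \<in> convex hull {?z, (x0, y0), (x1, y0)}" if "t \<le> s" "t \<le> -s"
    unfolding convex_hull_3 using that t
    by (intro CollectI exI[of _ "1 + t"] exI[of _ "(- t - s) / 2"] exI[of _ "(s - t) / 2"])
       (auto simp: p q field_simps)
  have 2: "(p, q) \<in> convex hull {?z, (x1, y0), (x1, y1)}" if "t \<le> s" "-s \<le> t"
    unfolding convex_hull_3 using that s
    by (intro CollectI exI[of _ "1 - s"] exI[of _ "(s - t) / 2"] exI[of _ "(s + t) / 2"])
       (auto simp: p q field_simps)
  have 3: "(p, q) \<in> convex hull {?z, (x1, y1), (x0, y1)}" if "s \<le> t" "-s \<le> t"
    unfolding convex_hull_3 using that t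
    by (intro CollectI exI[of _ "1 - t"] exI[of _ "(s + t) / 2"] exI[of _ "(t - s) / 2"])
       (auto simp: p q field_simps)
  have 4: "(p, q) \<in> convex hull {?z, (x0, y1), (x0, y0)}" if "s \<le> t" "t \<le> -s"
    unfolding convex_hull_3 using that s
    by (intro CollectI exI[of _ "1 + s"] exI[of _ "(t - s) / 2"] exI[of _ "(- s - t) / 2"])
       (auto simp: p q field_simps)
  show ?thesis unfolding rect_triangles_def Let_def using 1 2 3 4 by (cases "t \<le> s"; cases "t \<le> -s") auto
qed

text \<open>The trapezoidal rule from the corners to the centre \<open>Z\<close> is a homogeneous
  linear system for \<open>g Z\<close> and the two scaled partial derivatives with only the zero
  solution. So each triangle has zero data at all its vertices.\<close>

lemma zero_on_cell:
  assumes g: "C_k_on 1 UNIV g" and T: "\<And>T. T \<in> rect_triangles x0 x1 y0 y1 \<Longrightarrow> quadratic_on T g"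
    and x: "x0 < x1" and y: "y0 < y1"
    and z: "\<And>P. P \<in> {x0, x1} \<times> {y0, y1} \<Longrightarrow> g P = 0 \<and> pderiv_x UNIV g P = 0 \<and> pderiv_y UNIV g P = 0"
    and X: "X \<in> {x0..x1} \<times> {y0..y1}"
  shows "g X = 0"
proof -
  define Z where "Z = ((x0 + x1) / 2, (y0 + y1) / 2)"
  have tri: "quadratic_on (convex hull {Z, A, B}) g"
    if "(A, B) \<in> {((x0, y0), (x1, y0)), ((x1, y0), (x1, y1)), ((x1, y1), (x0, y1)), ((x0, y1),
        (x0, y0))}" for A B
    using that T unfolding rect_triangles_def Let_def Z_def by auto
  have tZ: "g Z = gradient_at g Z (Z - A) / 2"
    if AB: "(A, B) \<in> {((x0, y0), (x1, y0)), ((x1, y0), (x1, y1)), ((x1, y1), (x0, y1)), ((x0, y1),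
        (x0, y0))}" for A B
  proof -
    have "g A = 0 \<and> pderiv_x UNIV g A = 0 \<and> pderiv_y UNIV g A = 0" using AB z by auto
    moreover have "A \<in> convex hull {Z, A, B}" "Z \<in> convex hull {Z, A, B}" by (auto intro: hull_inc)
    ultimately show ?thesis
      using trapezoid[OF g tri[OF AB] convex_convex_hull, of A Z] by (simp add: gradient_at_def)
  qed
  have 1: "g Z = gradient_at g Z (Z - (x0, y0)) / 2" "g Z = gradient_at g Z (Z - (x1, y0)) / 2"
    "g Z = gradient_at g Z (Z - (x0, y1)) / 2" "g Z = gradient_at g Z (Z - (x1, y1)) / 2"
    by (rule tZ; auto)+
  define p q where "p = pderiv_x UNIV g Z * (x1 - x0) / 2" and "q = pderiv_y UNIV g Z * (y1 - y0) / 2"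
  have "g Z = (p + q) / 2" "g Z = (- p + q) / 2" "g Z = (p - q) / 2"
    subgoal by (subst 1(1)) (simp add: Z_def gradient_at_def p_def q_def field_simps)
    subgoal by (subst 1(2)) (simp add: Z_def gradient_at_def p_def q_def field_simps)
    subgoal by (subst 1(3)) (simp add: Z_def gradient_at_def p_def q_def field_simps)
    done
  then have "p = 0" "q = 0" by simp_all
  then have "pderiv_x UNIV g Z * (x1 - x0) = 0" "pderiv_y UNIV g Z * (y1 - y0) = 0"
    by (simp_all add: p_def q_def)
  then have Z0: "pderiv_x UNIV g Z = 0" "pderiv_y UNIV g Z = 0" using x y by auto
  then have Z1: "g Z = 0" using 1(1) by (simp add: gradient_at_def)
  obtain p q where Xe: "X = (p, q)" and "x0 \<le> p" "p \<le> x1" "y0 \<le> q" "q \<le> y1" using X by auto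
  then obtain S where S: "S \<in> rect_triangles x0 x1 y0 y1" "X \<in> S"
    using rect_cover[OF x _ _ y, of p q] by auto
  then obtain A B where AB: "(A, B) \<in> {((x0, y0), (x1, y0)), ((x1, y0), (x1, y1)), ((x1, y1), (x0, y1)),
      ((x0, y1), (x0, y0))}"
    "S = convex hull {Z, A, B}"
    unfolding rect_triangles_def Let_def Z_def by auto
  show ?thesis
    by (rule zero_on_triangle[OF g tri[OF AB(1)] refl _ S(2)[unfolded AB(2)]])
       (use AB(1) z Z0 Z1 in auto)
qed

text \<open>The gradient vanishes on the open set and, being continuous, on its closure. Thus a
  spline has zero data on the boundary of any box outside which it vanishes.\<close>

lemma pderiv_zero_closure:
  assumes g: "C_k_on 1 UNIV g" and U: "open U" and z: "\<And>P. P \<in> U \<Longrightarrow> g P = 0" and P: "P \<in> closure U"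
  shows "g P = 0 \<and> pderiv_x UNIV g P = 0 \<and> pderiv_y UNIV g P = 0"
proof -
  have c: "continuous_on UNIV g" "continuous_on UNIV (pderiv_x UNIV g)" "continuous_on UNIV (pderiv_y UNIV g)"
    using g by (auto simp: numeral_eq_Suc)
  have U0: "gradient_at g R v = 0" if "R \<in> U" for R v
  proof -
    have "((\<lambda>_. 0) has_derivative gradient_at g R) (at R)"
      by (rule has_derivative_transform_within_open[OF C1_has_derivative[OF g] U that]) (simp add: z)
    from has_derivative_unique[OF this has_derivative_const] show ?thesis by (cases v) (simp add: fun_eq_iff)
  qed
  have px: "pderiv_x UNIV g R = 0" if "R \<in> U" for R using U0[OF that, of "(1, 0)"] by
      (simp add: gradient_at_def)
  have py: "pderiv_y UNIV g R = 0" if "R \<in> U" for R using U0[OF that, of "(0, 1)"] by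
      (simp add: gradient_at_def)
  have "k P = 0" if "continuous_on UNIV k" "\<And>R. R \<in> U \<Longrightarrow> k R = 0" for k :: "real \<times> real \<Rightarrow> real"
    by (rule continuous_constant_on_closure[OF continuous_on_subset[OF that(1)] that(2) P]) auto
  with c z px py show ?thesis by blast
qed

lemma cell_edges:
  assumes g: "C_k_on 1 UNIV g" and T: "\<And>T. T \<in> rect_triangles x0 x1 y0 y1 \<Longrightarrow> quadratic_on T g"
  shows "y \<in> {y0, y1} \<Longrightarrow> g (x1, y) - g (x0, y) = (x1 - x0) / 2 * (pderiv_x UNIV g (x0, y) + pderiv_x UNIV g
      (x1, y))"
    and "x \<in> {x0, x1} \<Longrightarrow> g (x, y1) - g (x, y0) = (y1 - y0) / 2 * (pderiv_y UNIV g (x, y0) + pderiv_y UNIV g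
        (x, y1))"
proof -
  define Z where "Z = ((x0 + x1) / 2, (y0 + y1) / 2)"
  \<comment> \<open>The triangles list the sides in cyclic order, so a side directed along an axis
    may occur with its end points reversed.\<close>
  have *: "g B - g A = (gradient_at g A (B - A) + gradient_at g B (B - A)) / 2"
    if "convex hull {Z, A, B} \<in> rect_triangles x0 x1 y0 y1 \<or> convex hull {Z, B, A} \<in> rect_triangles x0 x1 y0
        y1" for A B
    using that trapezoid[OF g T convex_convex_hull, of "{Z, A, B}" A B] trapezoid[OF g T convex_convex_hull, of
        "{Z, B, A}" A B]
    by (auto simp: hull_inc)
  have tri: "convex hull {Z, (x0, y0), (x1, y0)} \<in> rect_triangles x0 x1 y0 y1"
    "convex hull {Z, (x1, y0), (x1, y1)} \<in> rect_triangles x0 x1 y0 y1"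
    "convex hull {Z, (x1, y1), (x0, y1)} \<in> rect_triangles x0 x1 y0 y1"
    "convex hull {Z, (x0, y1), (x0, y0)} \<in> rect_triangles x0 x1 y0 y1"
    by (auto simp: rect_triangles_def Let_def Z_def)
  show "g (x1, y) - g (x0, y) = (x1 - x0) / 2 * (pderiv_x UNIV g (x0, y) + pderiv_x UNIV g
      (x1, y))" if "y \<in> {y0, y1}"
    using that *[of "(x0, y)" "(x1, y)"] tri by (auto simp: gradient_at_def field_simps)
  show "g (x, y1) - g (x, y0) = (y1 - y0) / 2 * (pderiv_y UNIV g (x, y0) + pderiv_y UNIV g
      (x, y1))" if "x \<in> {x0, x1}"
    using that *[of "(x, y0)" "(x, y1)"] tri by (auto simp: gradient_at_def field_simps)
qed

text \<open>On each inner row and column two values and two tangential derivatives are unknown and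
  tied by three edge relations; one zero value makes all four vanish. Starting from the node
  \<open>(U2, V2)\<close> this clears its row, then the column \<open>U2\<close>, then the row
  \<open>V1\<close>.\<close>

lemma zero_spline:
  fixes U0 U1 U2 U3 V0 V1 V2 V3 :: real
  assumes g: "C_k_on 1 UNIV g"
    and U: "U0 < U1" "U1 < U2" "U2 < U3" and V: "V0 < V1" "V1 < V2" "V2 < V3"
    and T: "\<And>x0 x1 y0 y1 T. \<lbrakk>(x0, x1) \<in> {(U0, U1), (U1, U2), (U2, U3)}; (y0, y1) \<in> {(V0, V1), (V1, V2),
        (V2, V3)};
              T \<in> rect_triangles x0 x1 y0 y1\<rbrakk> \<Longrightarrow> quadratic_on T g"
    and out: "\<And>P. P \<notin> {U0..U3} \<times> {V0..V3} \<Longrightarrow> g P = 0"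
    and g0: "g (U2, V2) = 0"
  shows "g P = 0"
proof -
  let ?z = "\<lambda>P. g P = 0 \<and> pderiv_x UNIV g P = 0 \<and> pderiv_y UNIV g P = 0"
  have zo: "?z (a, b)" if "a \<le> U0 \<or> U3 \<le> a \<or> b \<le> V0 \<or> V3 \<le> b" for a b
  proof -
    have cl: "?z (a, b)" if "open S" "S \<inter> {U0..U3} \<times> {V0..V3} = {}" "(a, b) \<in> closure S" for S
      by (rule pderiv_zero_closure[OF g that(1) _ that(3)]) (use that(2) out in blast)
    from that show ?thesis
    proof (elim disjE)
      assume "a \<le> U0" then show ?thesis by (intro cl[of "{..<U0} \<times> UNIV"]) (auto simp: open_Times closure_Times)
    next
      assume "U3 \<le> a" then show ?thesis by (intro cl[of "{U3<..} \<times> UNIV"]) (auto simp: open_Times closure_Times)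
    next
      assume "b \<le> V0" then show ?thesis by (intro cl[of "UNIV \<times> {..<V0}"]) (auto simp: open_Times closure_Times)
    next
      assume "V3 \<le> b" then show ?thesis by (intro cl[of "UNIV \<times> {V3<..}"]) (auto simp: open_Times closure_Times)
    qed
  qed
  have ex: "g (x1, y) - g (x0, y) = (x1 - x0) / 2 * (pderiv_x UNIV g (x0, y) + pderiv_x UNIV g (x1, y))"
    if X: "(x0, x1) \<in> {(U0, U1), (U1, U2), (U2, U3)}" and Y: "y \<in> {V0, V1, V2, V3}" for x0 x1 y
  proof -
    obtain y0 y1 where y: "(y0, y1) \<in> {(V0, V1), (V1, V2), (V2, V3)}" "y \<in> {y0, y1}" using Y by auto
    show ?thesis by (rule cell_edges(1)[OF g T[OF X y(1)] y(2)])
  qed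
  have ey: "g (x, y1) - g (x, y0) = (y1 - y0) / 2 * (pderiv_y UNIV g (x, y0) + pderiv_y UNIV g (x, y1))"
    if X: "x \<in> {U0, U1, U2, U3}" and Y: "(y0, y1) \<in> {(V0, V1), (V1, V2), (V2, V3)}" for x y0 y1
  proof -
    obtain x0 x1 where x: "(x0, x1) \<in> {(U0, U1), (U1, U2), (U2, U3)}" "x \<in> {x0, x1}" using X by auto
    show ?thesis by (rule cell_edges(2)[OF g T[OF x(1) Y] x(2)])
  qed
  \<comment> \<open>The outer edge contributes the value with one sign and the middle edge with the
    other, so the positive edge lengths add up.\<close>
  have both: "f = 0 \<and> p = 0" if "f = h / 2 * p" "- f = h' / 2 * p" "h > 0" "h' > 0" for f p h h' :: real
  proof -
    have "(h + h') * p = 0" using that(1,2) by (simp add: algebra_simps)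
    then show ?thesis using that by simp
  qed
  have rowx: "?z (U1, y) \<and> pderiv_x UNIV g (U2, y) = 0" if "g (U2, y) = 0" "y \<in> {V1, V2}"
     "\<And>x. x \<in> {U1, U2} \<Longrightarrow> g (x, y) = 0 \<Longrightarrow> pderiv_y UNIV g (x, y) = 0" for y
  proof -
    have 1: "pderiv_x UNIV g (U2, y) = 0" using ex[of U2 U3 y] that zo[of U3 y] U by auto
    have 2: "g (U1, y) = (U1 - U0) / 2 * pderiv_x UNIV g (U1, y)"
      using ex[of U0 U1 y] that zo[of U0 y] U by auto
    have "- g (U1, y) = (U2 - U1) / 2 * pderiv_x UNIV g (U1, y)"
      using ex[of U1 U2 y] that 1 by auto
    from both[OF 2 this] 1 that(3)[of U1] show ?thesis using U by auto
  qed
  have qy2: "pderiv_y UNIV g (x, V2) = 0" if "x \<in> {U1, U2}" "g (x, V2) = 0" for x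
    using ey[of x V2 V3] that zo[of x V3] V by auto
  have qy1: "pderiv_y UNIV g (x, V1) = 0" if "x \<in> {U1, U2}" "g (x, V1) = 0" for x
    using ey[of x V0 V1] that zo[of x V0] V by auto
  have r2: "?z (U1, V2)" "?z (U2, V2)" using rowx[of V2] qy2 g0 by auto
  have 2: "g (U2, V1) = (V1 - V0) / 2 * pderiv_y UNIV g (U2, V1)"
    using ey[of U2 V0 V1] zo[of U2 V0] V by auto
  have "- g (U2, V1) = (V2 - V1) / 2 * pderiv_y UNIV g (U2, V1)"
    using ey[of U2 V1 V2] r2 by auto
  from both[OF 2 this] V have g21: "g (U2, V1) = 0" by auto
  have r1: "?z (U1, V1)" "?z (U2, V1)" using rowx[of V1] qy1 g21 by auto
  have z: "?z (x, y)" if "x \<in> {U0, U1, U2, U3}" "y \<in> {V0, V1, V2, V3}" for x y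
  proof (cases "x \<in> {U0, U3} \<or> y \<in> {V0, V3}")
    case True then show ?thesis by (intro zo) auto
  next
    case False then show ?thesis using that r1 r2 by auto
  qed
  show ?thesis
  proof (cases "P \<in> {U0..U3} \<times> {V0..V3}")
    case True
    have cover: "\<exists>z0 z1. (z0, z1) \<in> {(a, b), (b, c), (c, d)} \<and> z \<in> {z0..z1}" if "a \<le> z" "z
        \<le> d" for a b c d z :: real
    proof -
      have "z \<in> {a..b} \<or> z \<in> {b..c} \<or> z \<in> {c..d}" using that by auto
      then show ?thesis by blast
    qed
    obtain x0 x1 where x: "(x0, x1) \<in> {(U0, U1), (U1, U2), (U2, U3)}" "fst P \<in> {x0..x1}"
      using cover[of U0 "fst P" U3 U1 U2] True by (auto simp: mem_Times_iff)
    obtain y0 y1 where y: "(y0, y1) \<in> {(V0, V1), (V1, V2), (V2, V3)}" "snd P \<in> {y0..y1}"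
      using cover[of V0 "snd P" V3 V1 V2] True by (auto simp: mem_Times_iff)
    have lt: "x0 < x1" "y0 < y1" using x(1) y(1) U V by auto
    have sub: "{x0, x1} \<subseteq> {U0, U1, U2, U3}" "{y0, y1} \<subseteq> {V0, V1, V2, V3}" using x(1) y(1) by auto
    have "?z R" if "R \<in> {x0, x1} \<times> {y0, y1}" for R
    proof -
      have "fst R \<in> {U0, U1, U2, U3}" "snd R \<in> {V0, V1, V2, V3}"
        using subsetD[OF sub(1), of "fst R"] subsetD[OF sub(2), of "snd R"] that by
            (simp_all only: mem_Times_iff)
      from z[OF this] show ?thesis by simp
    qed
    moreover have "P \<in> {x0..x1} \<times> {y0..y1}" using x(2) y(2) by (simp add: mem_Times_iff)
    ultimately show ?thesis by (intro zero_on_cell[OF g T[OF x(1) y(1)] lt])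
  qed (rule out)
qed

lemma C1_diff:
  assumes f: "C_k_on 1 UNIV f" and g: "C_k_on 1 UNIV g"
  shows "C_k_on 1 UNIV (\<lambda>P. f P - g P)"
proof -
  have px: "pderiv_x UNIV (\<lambda>P. f P - g P) = (\<lambda>P. pderiv_x UNIV f P - pderiv_x UNIV g P)"
    using f g by (auto simp: pderiv_x_def fun_eq_iff numeral_eq_Suc intro!: vector_derivative_diff_at)
  have py: "pderiv_y UNIV (\<lambda>P. f P - g P) = (\<lambda>P. pderiv_y UNIV f P - pderiv_y UNIV g P)"
    using f g by (auto simp: pderiv_y_def fun_eq_iff numeral_eq_Suc intro!: vector_derivative_diff_at)
  show ?thesis using f g by (auto simp: px py numeral_eq_Suc intro!: continuous_on_diff differentiable_diff)
qed

lemma quadratic_on_diff: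
  assumes "quadratic_on T f" "quadratic_on T g"
  shows "quadratic_on T (\<lambda>P. f P - g P)"
proof -
  obtain c0 c1 c2 c3 c4 c5 where c: "\<And>x y. (x, y) \<in> T \<Longrightarrow>
     f (x, y) = c0 + c1 * x + c2 * y + c3 * x\<^sup>2 + c4 * x * y + c5 * y\<^sup>2"
    using assms(1) unfolding quadratic_on_def by fast
  obtain d0 d1 d2 d3 d4 d5 where d: "\<And>x y. (x, y) \<in> T \<Longrightarrow>
     g (x, y) = d0 + d1 * x + d2 * y + d3 * x\<^sup>2 + d4 * x * y + d5 * y\<^sup>2"
    using assms(2) unfolding quadratic_on_def by fast
  have "\<forall>(x, y)\<in>T. f (x, y) - g (x, y) = (c0 - d0) + (c1 - d1) * x + (c2 - d2) * y
      + (c3 - d3) * x\<^sup>2 + (c4 - d4) * x * y + (c5 - d5) * y\<^sup>2"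
    by (auto simp: c d algebra_simps)
  then show ?thesis unfolding quadratic_on_def by blast
qed

lemma octagon_subset_box:
  assumes "u (i - 2) \<le> u (i - 1)" "u (i - 1) \<le> u i" "u i \<le> u (i + 1)"
    and "v (j - 2) \<le> v (j - 1)" "v (j - 1) \<le> v j" "v j \<le> v (j + 1)"
  shows "octagon u v i j \<subseteq> {u (i - 2)..u (i + 1)} \<times> {v (j - 2)..v (j + 1)}"
  unfolding octagon_def
  by (rule hull_minimal) (use assms in \<open>auto intro!: convex_Times\<close>)

text \<open>The octagon lies in a block of three by three cells. The difference of two candidates
  vanishes off this block and, by the common normalisation, at its upper right inner node
  \<open>(u i, v j)\<close>, so \<open>zero_spline\<close> applies.\<close>

lemma classical_bspline_unique:
  assumes u: "\<And>i. i \<in> {- 1..m + 2} \<Longrightarrow> u (i - 1) < u i" and v: "\<And>j. j \<in> {- 1..n + 2} \<Longrightarrow> v (j - 1) < v j"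
    and ij: "i \<in> {0..m + 1}" "j \<in> {0..n + 1}"
    and f: "is_classical_bspline m n u v i j f" and g: "is_classical_bspline m n u v i j g"
  shows "f = g"
proof
  fix P
  have U: "u (i - 2) < u (i - 1)" "u (i - 1) < u i" "u i < u (i + 1)"
    using u[of "i - 1"] u[of i] u[of "i + 1"] ij by (auto simp: algebra_simps)
  have V: "v (j - 2) < v (j - 1)" "v (j - 1) < v j" "v j < v (j + 1)"
    using v[of "j - 1"] v[of j] v[of "j + 1"] ij by (auto simp: algebra_simps)
  have "f P - g P = 0"
  proof (rule zero_spline[OF _ U V])
    show "C_k_on 1 UNIV (\<lambda>P. f P - g P)"
      using f g by (intro C1_diff) (auto simp: is_classical_bspline_def)
  next
    fix x0 x1 y0 y1 T
    assume x: "(x0, x1) \<in> {(u (i - 2), u (i - 1)), (u (i - 1), u i), (u i, u (i + 1))}"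
      and y: "(y0, y1) \<in> {(v (j - 2), v (j - 1)), (v (j - 1), v j), (v j, v (j + 1))}"
      and T: "T \<in> rect_triangles x0 x1 y0 y1"
    have "\<exists>k\<in>{i - 1, i, i + 1}. x0 = u (k - 1) \<and> x1 = u k" using x by auto
    moreover have "\<exists>l\<in>{j - 1, j, j + 1}. y0 = v (l - 1) \<and> y1 = v l" using y by auto
    ultimately obtain k l where "k \<in> {i - 1, i, i + 1}" "l \<in> {j - 1, j, j + 1}"
       and e: "x0 = u (k - 1)" "x1 = u k" "y0 = v (l - 1)" "y1 = v l"
      by blast
    then have "k \<in> {- 1..m + 2}" "l \<in> {- 1..n + 2}" using ij by auto
    with T e have "T \<in> criss_cross {- 1..m + 2} {- 1..n + 2} u v" unfolding criss_cross_def by blast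
    then show "quadratic_on T (\<lambda>P. f P - g P)"
      using f g by (intro quadratic_on_diff) (auto simp: is_classical_bspline_def)
  next
    fix P assume "P \<notin> {u (i - 2)..u (i + 1)} \<times> {v (j - 2)..v (j + 1)}"
    then have "P \<notin> octagon u v i j" using octagon_subset_box[of u i v j] U V by auto
    then have "f P = 0" "g P = 0" using f g unfolding is_classical_bspline_def by blast+
    then show "f P - g P = 0" by simp
  next
    show "f (u i, v j) - g (u i, v j) = 0" using f g by (auto simp: is_classical_bspline_def)
  qed
  then show "f P = g P" by simp
qed

subsection \<open>Interpolation of tensor products on one cell\<close>

text \<open>A function \<open>\<phi> :: int \<Rightarrow> real\<close> stands for the polynomial with coefficients \<open>\<phi> 0\<close>, \<open>\<phi> 1\<close>, \<open>\<phi> 2\<close>. In the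
  coordinates \<open>s, t \<in> [-1, 1]\<close> of a cell, \<open>cell_interp \<phi> \<psi>\<close> is the \<open>C\<^sup>1\<close> quadratic spline on the four
  triangles with the same values and gradients at the corners as \<open>\<phi>(s) \<psi>(t)\<close>: the products
  \<open>s\<^sup>2 t\<close>, \<open>s t\<^sup>2\<close>, \<open>s\<^sup>2 t\<^sup>2\<close> are replaced by their interpolants.\<close>

definition cell_interp :: "(int \<Rightarrow> real) \<Rightarrow> (int \<Rightarrow> real) \<Rightarrow> real \<Rightarrow> real \<Rightarrow> real" where
  "cell_interp \<phi> \<psi> s t =
     \<phi> 0 * \<psi> 0 + \<phi> 1 * \<psi> 0 * s + \<phi> 0 * \<psi> 1 * t + \<phi> 2 * \<psi> 0 * s\<^sup>2 + \<phi> 1 * \<psi> 1 * s * t + \<phi> 0 * \<psi> 2 * t\<^sup>2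
     + \<phi> 2 * \<psi> 1 * (((s + t) * \<bar>s + t\<bar> - (s - t) * \<bar>s - t\<bar>) / 2 - t)
     + \<phi> 1 * \<psi> 2 * (((s + t) * \<bar>s + t\<bar> + (s - t) * \<bar>s - t\<bar>) / 2 - s)
     + \<phi> 2 * \<psi> 2 * (s\<^sup>2 + t\<^sup>2 - 1)"

text \<open>The partial derivative of \<open>cell_interp\<close> in \<open>s\<close>; by the
  symmetry \<open>cell_interp_swap\<close> the one in \<open>t\<close> is
  \<open>cell_interp_s \<psi> \<phi> t s\<close>. A glued square \<open>z |z|\<close> contributes
  \<open>2 |z|\<close>.\<close>

definition cell_interp_s :: "(int \<Rightarrow> real) \<Rightarrow> (int \<Rightarrow> real) \<Rightarrow> real \<Rightarrow> real \<Rightarrow> real" where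
  "cell_interp_s \<phi> \<psi> s t =
     \<phi> 1 * \<psi> 0 + 2 * \<phi> 2 * \<psi> 0 * s + \<phi> 1 * \<psi> 1 * t + \<phi> 2 * \<psi> 1 * (\<bar>s + t\<bar> - \<bar>s - t\<bar>)
     + \<phi> 1 * \<psi> 2 * (\<bar>s + t\<bar> + \<bar>s - t\<bar> - 1) + 2 * \<phi> 2 * \<psi> 2 * s"

lemma cell_interp_swap: "cell_interp \<phi> \<psi> s t = cell_interp \<psi> \<phi> t s"
proof -
  have 1: "\<bar>s - t\<bar> = \<bar>t - s\<bar>" "\<bar>s + t\<bar> = \<bar>t + s\<bar>" by (simp_all add: add.commute)
  show ?thesis unfolding cell_interp_def 1 by (simp add: field_simps)
qed

lemma cell_interp_zero [simp]: "cell_interp (\<lambda>_. 0) \<psi> s t = 0" "cell_interp \<phi> (\<lambda>_. 0) s t = 0"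
  "cell_interp_s (\<lambda>_. 0) \<psi> s t = 0" "cell_interp_s \<phi> (\<lambda>_. 0) s t = 0"
  by (simp_all add: cell_interp_def cell_interp_s_def)

text \<open>On the side \<open>s = 1\<close> the value is the product itself, while the normal
  derivative carries \<psi> with \<open>t^2\<close> replaced by 1, its linear interpolant between
  the ends. On a side, \<phi> enters only through its end value and end slope, so univariate
  \<open>C^1\<close> gluing carries over to the plane.\<close>

lemma cell_interp_edge:
  assumes t: "\<bar>t\<bar> \<le> 1"
  shows "cell_interp \<phi> \<psi> 1 t = (\<phi> 0 + \<phi> 1 + \<phi> 2) * (\<psi> 0 + \<psi> 1 * t + \<psi> 2 * t\<^sup>2)" (is ?A)
    and "cell_interp \<phi> \<psi> (- 1) t = (\<phi> 0 - \<phi> 1 + \<phi> 2) * (\<psi> 0 + \<psi> 1 * t + \<psi> 2 * t\<^sup>2)" (is ?B)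
    and "cell_interp_s \<phi> \<psi> 1 t = (\<phi> 1 + 2 * \<phi> 2) * (\<psi> 0 + \<psi> 1 * t + \<psi> 2)" (is ?C)
    and "cell_interp_s \<phi> \<psi> (- 1) t = (\<phi> 1 - 2 * \<phi> 2) * (\<psi> 0 + \<psi> 1 * t + \<psi> 2)" (is ?D)
    and "cell_interp_s \<psi> \<phi> t 1 = (\<phi> 0 + \<phi> 1 + \<phi> 2) * (\<psi> 1 + 2 * \<psi> 2 * t)" (is ?E)
    and "cell_interp_s \<psi> \<phi> t (- 1) = (\<phi> 0 - \<phi> 1 + \<phi> 2) * (\<psi> 1 + 2 * \<psi> 2 * t)" (is ?F)
proof -
  have a: "\<bar>1 + t\<bar> = 1 + t" "\<bar>1 - t\<bar> = 1 - t" "\<bar>- 1 + t\<bar> = 1 - t" "\<bar>- 1 - t\<bar> = 1 + t"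
    "\<bar>t + 1\<bar> = 1 + t" "\<bar>t - 1\<bar> = 1 - t" "\<bar>t + - 1\<bar> = 1 - t" "\<bar>t - - 1\<bar> = 1 + t" using t by auto
  show ?A ?B ?C ?D ?E ?F
    unfolding cell_interp_def cell_interp_s_def a by (simp_all add: power2_eq_square field_simps)
qed

text \<open>The function \<open>z |z|\<close> has derivative \<open>2 |z|\<close> also at 0. This
  makes the cell interpolant \<open>C^1\<close> across the diagonals without a case distinction on
  triangles.\<close>

lemma has_derivative_mult_abs [derivative_intros]:
  fixes g :: "'a :: real_normed_vector \<Rightarrow> real"
  assumes "(g has_derivative g') (at x within S)"
  shows "((\<lambda>x. g x * \<bar>g x\<bar>) has_derivative (\<lambda>h. 2 * \<bar>g x\<bar> * g' h)) (at x within S)"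
proof -
  have "((\<lambda>z. z * \<bar>z\<bar>) has_real_derivative 2 * \<bar>z\<bar>) (at z)" for z :: real
  proof (cases "z = 0")
    case True
    have "((\<lambda>h :: real. \<bar>h\<bar>) \<longlongrightarrow> 0) (at 0)" by (rule tendsto_rabs_zero) (rule tendsto_ident_at)
    then have "((\<lambda>h :: real. h * \<bar>h\<bar> / h) \<longlongrightarrow> 0) (at 0)"
      by (rule Lim_transform_eventually) (auto simp: eventually_at_filter)
    then show ?thesis by (simp add: True DERIV_def)
  next
    case False
    show ?thesis
    proof (cases "z > 0")
      case True
      have "((\<lambda>z. z * z) has_real_derivative 2 * \<bar>z\<bar>) (at z)"
        using True by (auto intro!: derivative_eq_intros)
      then show ?thesis
        by (rule has_field_derivative_transform_within_open[of _ _ _ "{0<..}"]) (use True in auto)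
    next
      case F: False
      have "((\<lambda>z. - (z * z)) has_real_derivative 2 * \<bar>z\<bar>) (at z)"
        using F by (auto intro!: derivative_eq_intros)
      then show ?thesis
        by (rule has_field_derivative_transform_within_open[of _ _ _ "{..<0}"]) (use False F in auto)
    qed
  qed
  then have "((\<lambda>z. z * \<bar>z\<bar>) has_derivative (\<lambda>h. 2 * \<bar>g x\<bar> * h)) (at (g x))"
    by (simp only: has_field_derivative_def)
  from has_derivative_compose[OF assms this] show ?thesis .
qed

lemma cell_interp_has_derivative:
  assumes s: "(s has_derivative s') (at x within S)" and t: "(t has_derivative t') (at x within S)"
  shows "((\<lambda>x. cell_interp \<phi> \<psi> (s x) (t x)) has_derivative
    (\<lambda>h. cell_interp_s \<phi> \<psi> (s x) (t x) * s' h + cell_interp_s \<psi> \<phi> (t x) (s x) * t' h)) (at x within S)"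
proof -
  have lin: "((\<lambda>x. c0 + c1 * s x + c2 * t x + c3 * f3 x + c4 * f4 x + c5 * f5 x + c6 * f6 x
      + c7 * f7 x) has_derivative
     (\<lambda>h. c1 * s' h + c2 * t' h + c3 * f3' h + c4 * f4' h + c5 * f5' h + c6 * f6' h + c7 * f7' h))
         (at x within S)"
    if "(f3 has_derivative f3') (at x within S)" "(f4 has_derivative f4') (at x within S)"
      "(f5 has_derivative f5') (at x within S)" "(f6 has_derivative f6') (at x within S)"
          "(f7 has_derivative f7') (at x within S)"
    for c0 c1 c2 c3 c4 c5 c6 c7 f3 f3' f4 f4' f5 f5' f6 f6' f7 f7'
    by (rule derivative_eq_intros that s t refl)+ simp
  have 1: "\<bar>t x - s x\<bar> = \<bar>s x - t x\<bar>" "\<bar>t x + s x\<bar> = \<bar>s x + t x\<bar>" by (simp_all add: add.commute)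
  \<comment> \<open>Collected by basis function: the six monomials of degree at most two and the two
    glued squares across the diagonals.\<close>
  have e: "(\<lambda>x. cell_interp \<phi> \<psi> (s x) (t x)) = (\<lambda>x. (\<phi> 0 * \<psi> 0 - \<phi> 2 * \<psi> 2) + (\<phi> 1 * \<psi> 0 - \<phi> 1 * \<psi> 2) * s x +
      (\<phi> 0 * \<psi> 1 - \<phi> 2 * \<psi> 1) * t x
      + (\<phi> 2 * \<psi> 0 + \<phi> 2 * \<psi> 2) * (s x * s x) + \<phi> 1 * \<psi> 1 * (s x * t x) + (\<phi> 0 * \<psi> 2 + \<phi> 2 * \<psi> 2) * (t x * t x)
      + (\<phi> 2 * \<psi> 1 / 2 + \<phi> 1 * \<psi> 2 / 2) * ((s x + t x) * \<bar>s x + t x\<bar>)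
      + (\<phi> 1 * \<psi> 2 / 2 - \<phi> 2 * \<psi> 1 / 2) * ((s x - t x) * \<bar>s x - t x\<bar>))"
    by (rule ext, unfold cell_interp_def) (simp only: power2_eq_square, simp add: add_divide_distrib
        diff_divide_distrib algebra_simps)
  show ?thesis unfolding e cell_interp_s_def 1
    by (rule has_derivative_eq_rhs[OF lin[OF has_derivative_mult[OF s s] has_derivative_mult[OF s t]
          has_derivative_mult[OF t t] has_derivative_mult_abs[OF has_derivative_add[OF s t]]
          has_derivative_mult_abs[OF has_derivative_diff[OF s t]]]])
       (simp add: fun_eq_iff field_simps)
qed


text \<open>On a triangle the signs of \<open>s + t\<close> and \<open>s - t\<close> are constant, \<open>p\<close> and \<open>q\<close> say.\<close>

definition tri_ss :: "real \<Rightarrow> real \<Rightarrow> (int \<Rightarrow> real) \<Rightarrow> (int \<Rightarrow> real) \<Rightarrow> real" where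
  "tri_ss p q \<phi> \<psi> = 2 * \<phi> 2 * \<psi> 0 + (p - q) * \<phi> 2 * \<psi> 1 + (p + q) * \<phi> 1 * \<psi> 2 + 2 * \<phi> 2 * \<psi> 2"

definition tri_st :: "real \<Rightarrow> real \<Rightarrow> (int \<Rightarrow> real) \<Rightarrow> (int \<Rightarrow> real) \<Rightarrow> real" where
  "tri_st p q \<phi> \<psi> = \<phi> 1 * \<psi> 1 + (p + q) * \<phi> 2 * \<psi> 1 + (p - q) * \<phi> 1 * \<psi> 2"

definition tri_tt :: "real \<Rightarrow> real \<Rightarrow> (int \<Rightarrow> real) \<Rightarrow> (int \<Rightarrow> real) \<Rightarrow> real" where
  "tri_tt p q \<phi> \<psi> = 2 * \<phi> 0 * \<psi> 2 + (p - q) * \<phi> 2 * \<psi> 1 + (p + q) * \<phi> 1 * \<psi> 2 + 2 * \<phi> 2 * \<psi> 2"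

text \<open>With fixed signs the glued squares become \<open>p (s + t)^2\<close> and
  \<open>q (s - t)^2\<close>, so the interpolant is a polynomial and \<open>tri_ss\<close>,
  \<open>tri_st\<close>, \<open>tri_tt\<close> are its constant second derivatives in cell
  coordinates.\<close>

lemma cell_interp_tri:
  assumes "\<bar>s + t\<bar> = p * (s + t)" "\<bar>s - t\<bar> = q * (s - t)"
  shows "cell_interp \<phi> \<psi> s t = (\<phi> 0 * \<psi> 0 - \<phi> 2 * \<psi> 2) + (\<phi> 1 * \<psi> 0 - \<phi> 1 * \<psi> 2) * s + (\<phi> 0 * \<psi> 1
      - \<phi> 2 * \<psi> 1) * t
     + tri_ss p q \<phi> \<psi> / 2 * s\<^sup>2 + tri_st p q \<phi> \<psi> * s * t + tri_tt p q \<phi> \<psi> / 2 * t\<^sup>2"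
  unfolding cell_interp_def assms tri_ss_def tri_st_def tri_tt_def by (simp add: power2_eq_square field_simps)

definition cell_coord :: "(int \<Rightarrow> real) \<Rightarrow> int \<Rightarrow> real \<Rightarrow> real" where
  "cell_coord u k x = (2 * x - u (k - 1) - u k) / (u k - u (k - 1))"

lemma cell_coord_affine: "cell_coord u k x = 2 / (u k - u (k - 1)) * x - (u (k - 1) + u k) / (u k - u (k - 1))"
  by (simp add: cell_coord_def diff_divide_distrib add_divide_distrib)

lemma cell_coord_ends:
  "u (k - 1) < u k \<Longrightarrow> cell_coord u k (u k) = 1" "u (k - 1) < u k \<Longrightarrow> cell_coord u k (u (k - 1)) = - 1"
  by (auto simp: cell_coord_def field_simps)

lemma cell_coord_bounds:
  assumes "u (k - 1) < u k" "x \<in> {u (k - 1)..u k}"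
  shows "\<bar>cell_coord u k x\<bar> \<le> 1"
  using assms by (auto simp: cell_coord_def abs_le_iff field_simps)

abbreviation diag_signs :: "real \<Rightarrow> real \<Rightarrow> real \<Rightarrow> real \<Rightarrow> bool" where
  "diag_signs p q s t \<equiv> \<bar>s + t\<bar> = p * (s + t) \<and> \<bar>s - t\<bar> = q * (s - t)"

text \<open>Signs of \<open>s + t\<close> and \<open>s - t\<close> on the bottom, right, top and
  left triangle, in this order.\<close>

definition tri_signs :: "(real \<times> real) set" where
  "tri_signs = {(- 1, 1), (1, 1), (1, - 1), (- 1, - 1)}"

text \<open>The centre has cell coordinates 0, so a point of a triangle is a combination of its two
  corners with nonnegative weights, and \<open>s + t\<close> and \<open>s - t\<close> keep, weakly,
  the signs they have at these corners.\<close>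

lemma triangle_signs:
  assumes u: "u (k - 1) < u k" and v: "v (l - 1) < v l"
    and T: "T \<in> rect_triangles (u (k - 1)) (u k) (v (l - 1)) (v l)"
  shows "T \<subseteq> {u (k - 1)..u k} \<times> {v (l - 1)..v l}" (is ?P1)
    and "\<exists>(p, q)\<in>tri_signs. \<forall>(x, y)\<in>T.
      diag_signs p q (cell_coord u k x) (cell_coord v l y)" (is ?P2)
proof -
  let ?x0 = "u (k - 1)" and ?x1 = "u k" and ?y0 = "v (l - 1)" and ?y1 = "v l"
  let ?Z = "((?x0 + ?x1) / 2, (?y0 + ?y1) / 2)"
  show ?P1
  proof -
    have h: "convex hull {?Z, B, C} \<subseteq> {?x0..?x1} \<times> {?y0..?y1}"
      if "B \<in> {?x0, ?x1} \<times> {?y0, ?y1}" "C \<in> {?x0, ?x1} \<times> {?y0, ?y1}" for B C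
    proof (rule hull_minimal)
      show "{?Z, B, C} \<subseteq> {?x0..?x1} \<times> {?y0..?y1}" using that u v by auto
    qed (intro convex_Times convex_real_interval)
    from T obtain B C where "T = convex hull {?Z, B, C}"
      and "B \<in> {?x0, ?x1} \<times> {?y0, ?y1}" "C \<in> {?x0, ?x1} \<times> {?y0, ?y1}"
      unfolding rect_triangles_def Let_def by blast
    with h show ?thesis by simp
  qed
  have co: "\<exists>a b c. a \<ge> 0 \<and> b \<ge> 0 \<and> c \<ge> 0 \<and> a + b + c = 1 \<and>
       cell_coord u k x = b * cell_coord u k (fst B) + c * cell_coord u k (fst C) \<and>
       cell_coord v l y = b * cell_coord v l (snd B) + c * cell_coord v l (snd C)"
    if H: "(x, y) \<in> convex hull {?Z, B, C}" for x y B C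
  proof -
    obtain a b c where abc: "a \<ge> 0" "b \<ge> 0" "c \<ge> 0" "a + b + c = 1" and e: "(x, y) = a *\<^sub>R ?Z + b *\<^sub>R B
        + c *\<^sub>R C"
      using H[unfolded convex_hull_3 mem_Collect_eq] by (elim exE conjE) (rule that; assumption)
    have a: "a = 1 - b - c" using abc(4) by simp
    have "x = a * ((?x0 + ?x1) / 2) + b * fst B + c * fst C" "y = a * ((?y0 + ?y1) / 2) + b * snd B + c * snd C"
      using arg_cong[OF e, of fst] arg_cong[OF e, of snd] by simp_all
    then have "cell_coord u k x = b * cell_coord u k (fst B) + c * cell_coord u k (fst C)"
       "cell_coord v l y = b * cell_coord v l (snd B) + c * cell_coord v l (snd C)"
      using u v by (auto simp: cell_coord_def a divide_simps) (simp_all add: algebra_simps)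
    with abc show ?thesis by blast
  qed
  note ends = cell_coord_ends[of u k, OF u] cell_coord_ends[of v l, OF v]
  from T consider "T = convex hull {?Z, (?x0, ?y0), (?x1, ?y0)}" | "T = convex hull {?Z, (?x1, ?y0),
      (?x1, ?y1)}"
    | "T = convex hull {?Z, (?x1, ?y1), (?x0, ?y1)}" | "T = convex hull {?Z, (?x0, ?y1), (?x0, ?y0)}"
    unfolding rect_triangles_def Let_def by blast
  then show ?P2
  proof cases
    case 1
    have "\<forall>(x, y)\<in>T. diag_signs (- 1) 1 (cell_coord u k x) (cell_coord v l y)"
      using co unfolding 1 by (fastforce simp: ends)
    then show ?thesis by (intro bexI[of _ "(- 1, 1)"]) (auto simp: tri_signs_def)
  next
    case 2
    have "\<forall>(x, y)\<in>T. diag_signs 1 1 (cell_coord u k x) (cell_coord v l y)"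
      using co unfolding 2 by (fastforce simp: ends)
    then show ?thesis by (intro bexI[of _ "(1, 1)"]) (auto simp: tri_signs_def)
  next
    case 3
    have "\<forall>(x, y)\<in>T. diag_signs 1 (- 1) (cell_coord u k x) (cell_coord v l y)"
      using co unfolding 3 by (fastforce simp: ends)
    then show ?thesis by (intro bexI[of _ "(1, - 1)"]) (auto simp: tri_signs_def)
  next
    case 4
    have "\<forall>(x, y)\<in>T. diag_signs (- 1) (- 1) (cell_coord u k x) (cell_coord v l y)"
      using co unfolding 4 by (fastforce simp: ends)
    then show ?thesis by (intro bexI[of _ "(- 1, - 1)"]) (auto simp: tri_signs_def)
  qed
qed

lemma quadratic_on_affine:
  assumes "\<And>x y. (x, y) \<in> T \<Longrightarrow> g (x, y) = c0 + c1 * (a * x + b) + c2 * (c * y + d)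
     + c3 * (a * x + b)\<^sup>2 + c4 * (a * x + b) * (c * y + d) + c5 * (c * y + d)\<^sup>2"
  shows "quadratic_on T g"
proof -
  have "\<forall>(x, y)\<in>T. g (x, y) = (c0 + c1 * b + c2 * d + c3 * b\<^sup>2 + c4 * b * d + c5 * d\<^sup>2)
    + (c1 * a + 2 * c3 * a * b + c4 * a * d) * x + (c2 * c + 2 * c5 * c * d + c4 * b * c) * y
    + (c3 * a\<^sup>2) * x\<^sup>2 + (c4 * a * c) * x * y + (c5 * c\<^sup>2) * y\<^sup>2"
    using assms by (auto simp: power2_eq_square algebra_simps)
  then show ?thesis unfolding quadratic_on_def by blast
qed

lemma cell_interp_quadratic_on:
  assumes "u (k - 1) < u k" "v (l - 1) < v l" "T \<in> rect_triangles (u (k - 1)) (u k) (v (l - 1)) (v l)"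
  shows "quadratic_on T (\<lambda>(x, y). cell_interp \<phi> \<psi> (cell_coord u k x) (cell_coord v l y))"
proof -
  obtain p q where pq: "\<And>x y. (x, y) \<in> T \<Longrightarrow>
      diag_signs p q (cell_coord u k x) (cell_coord v l y)"
    using triangle_signs(2)[of u k v l T, OF assms] by fast
  let ?a = "2 / (u k - u (k - 1))" and ?b = "- ((u (k - 1) + u k) / (u k - u (k - 1)))"
  let ?c = "2 / (v l - v (l - 1))" and ?d = "- ((v (l - 1) + v l) / (v l - v (l - 1)))"
  have "cell_coord u k x = ?a * x + ?b" "cell_coord v l y = ?c * y + ?d" for x y
    by (simp_all add: cell_coord_affine)
  note e = this[symmetric]
  show ?thesis
    by (rule quadratic_on_affine[of T _ _ _ ?a ?b _ ?c ?d], unfold split e)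
       (rule cell_interp_tri[OF conjunct1[OF pq] conjunct2[OF pq]])
qed

subsection \<open>Existence of the classical B-spline\<close>

text \<open>Coefficients, in the coordinate of cell \<open>k\<close>, of the univariate quadratic B-spline with index
  \<open>k + r\<close>; \<open>\<sigma>\<close> and \<open>\<sigma>'\<close> compare the length of the cell with that of its left and right neighbours.\<close>

definition spline_coef :: "real \<Rightarrow> real \<Rightarrow> int \<Rightarrow> int \<Rightarrow> real" where
  "spline_coef \<sigma> \<sigma>' r c =
     (if r = - 1 then \<sigma> * (if c = 0 then 1 / 4 else if c = 1 then - 1 / 2 else if c = 2 then 1 / 4 else 0)
      else if r = 1 then \<sigma>' * (if c = 0 then 1 / 4 else if c = 1 then 1 / 2 else if c = 2 then 1 / 4 else 0)
      else if r = 0 then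
        (if c = 0 then 1 - (\<sigma> + \<sigma>') / 4 else if c = 1 then (\<sigma> - \<sigma>') / 2 else if c = 2 then - (\<sigma>
            + \<sigma>') / 4 else 0)
      else 0)"

definition ratio_left :: "(int \<Rightarrow> real) \<Rightarrow> int \<Rightarrow> real" where
  "ratio_left u k = (u k - u (k - 1)) / (u k - u (k - 2))"

definition ratio_right :: "(int \<Rightarrow> real) \<Rightarrow> int \<Rightarrow> real" where
  "ratio_right u k = (u k - u (k - 1)) / (u (k + 1) - u (k - 1))"

definition local_coef :: "(int \<Rightarrow> real) \<Rightarrow> int \<Rightarrow> int \<Rightarrow> int \<Rightarrow> real" where
  "local_coef u i k = spline_coef (ratio_left u k) (ratio_right u k) (i - k)"

lemma local_coef_zero: "i - k \<notin> {- 1, 0, 1} \<Longrightarrow> local_coef u i k = (\<lambda>_. 0)"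
  by (auto simp: local_coef_def spline_coef_def fun_eq_iff)

text \<open>Only the cells \<open>i - 1\<close>, \<open>i\<close>, \<open>i + 1\<close> carry
  nonzero coefficients. The next cell on either side is widened to a half-line, so that five closed
  sets cover the line and the B-spline is one formula on each.\<close>

definition knot_cell :: "(int \<Rightarrow> real) \<Rightarrow> int \<Rightarrow> int \<Rightarrow> real set" where
  "knot_cell u i k = (if k < i - 1 then {..u (i - 2)} else if k > i + 1 then {u (i + 1)..} else {u (k
      - 1)..u k})"

definition cell_jet ::
  "(int \<Rightarrow> real) \<Rightarrow> (int \<Rightarrow> real) \<Rightarrow> int \<Rightarrow> int \<Rightarrow> int \<Rightarrow> int \<Rightarrow> real \<times> real \<Rightarrow> real \<times> real \<times> real" where
  "cell_jet u v i j k l P =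
     (cell_interp (local_coef u i k) (local_coef v j l) (cell_coord u k (fst P)) (cell_coord v l (snd P)),
      2 / (u k - u (k - 1)) * cell_interp_s (local_coef u i k) (local_coef v j l) (cell_coord u k (fst P))
          (cell_coord v l (snd P)),
      2 / (v l - v (l - 1)) * cell_interp_s (local_coef v j l) (local_coef u i k) (cell_coord v l (snd P))
          (cell_coord u k (fst P)))"

text \<open>Cells overlap along their boundaries; the choice is harmless because the jets agree
  there (\<open>cell_jet_agree\<close>). Keeping the value together with both partial derivatives
  settles the continuity of all three at once.\<close>

definition spline_jet :: "(int \<Rightarrow> real) \<Rightarrow> (int \<Rightarrow> real) \<Rightarrow> int \<Rightarrow> int \<Rightarrow> real \<times> real \<Rightarrow> real \<times> real \<times> real" where
  "spline_jet u v i j P = (SOME z. \<exists>k\<in>{i - 2..i + 2}. \<exists>l\<in>{j - 2..j + 2}.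
     fst P \<in> knot_cell u i k \<and> snd P \<in> knot_cell v j l \<and> z = cell_jet u v i j k l P)"

definition strict_knots :: "(int \<Rightarrow> real) \<Rightarrow> int \<Rightarrow> bool" where
  "strict_knots u i \<longleftrightarrow> u (i - 2) < u (i - 1) \<and> u (i - 1) < u i \<and> u i < u (i + 1)"

lemma int_range_4: "k \<in> {i - 2..i + 1} \<longleftrightarrow> k = i - 2 \<or> k = i - 1 \<or> k = i \<or> k = i + 1" for i k :: int
  by auto

lemma int_range_3: "k \<in> {i - 1..i + 1} \<longleftrightarrow> k = i - 1 \<or> k = i \<or> k = i + 1" for i k :: int
  by auto

lemma spline_coef_ends:
  "spline_coef \<sigma> \<sigma>' r 0 + spline_coef \<sigma> \<sigma>' r 1 + spline_coef \<sigma> \<sigma>' r 2 = (if r = 1 then \<sigma>' else if r = 0 then 1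
      - \<sigma>' else 0)"
  "spline_coef \<sigma> \<sigma>' r 0 - spline_coef \<sigma> \<sigma>' r 1 + spline_coef \<sigma> \<sigma>' r 2 = (if r = - 1 then \<sigma> else if r = 0 then 1
      - \<sigma> else 0)"
  "spline_coef \<sigma> \<sigma>' r 1 + 2 * spline_coef \<sigma> \<sigma>' r 2 = (if r = 1 then \<sigma>' else if r = 0 then - \<sigma>' else 0)"
  "spline_coef \<sigma> \<sigma>' r 1 - 2 * spline_coef \<sigma> \<sigma>' r 2 = (if r = - 1 then - \<sigma> else if r = 0 then \<sigma> else 0)"
  by (simp_all add: spline_coef_def field_simps)

text \<open>These are equal values and equal slopes of the univariate B-spline at the knot
  \<open>u k\<close>, with \<open>2 / length\<close> as chain rule factor of the cell coordinate. At
  the two outer knots both sides are 0; at the two inner ones the ratios have a common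
  denominator.\<close>

lemma local_coef_edge:
  assumes u: "strict_knots u i" and k: "k \<in> {i - 2..i + 1}"
  shows "local_coef u i k 0 + local_coef u i k 1 + local_coef u i k 2
       = local_coef u i (k + 1) 0 - local_coef u i (k + 1) 1 + local_coef u i (k + 1) 2" (is ?A)
    and "2 / (u k - u (k - 1)) * (local_coef u i k 1 + 2 * local_coef u i k 2)
       = 2 / (u (k + 1) - u k) * (local_coef u i (k + 1) 1 - 2 * local_coef u i (k + 1) 2)" (is ?B)
proof -
  have u': "u (i - 2) < u (i - 1)" "u (i - 1) < u i" "u i < u (i + 1)"
    using u by (auto simp: strict_knots_def)
  have canc: "2 / p * (p / r) = 2 / q * (q / r)" if "p > 0" "q > 0" for p q r :: real
    using that by simp
  consider "k = i - 2" | "k = i - 1" | "k = i" | "k = i + 1" using k unfolding int_range_4 by blast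
  then have "?A \<and> ?B"
  proof cases
    case 1 then show ?thesis by (simp add: local_coef_def spline_coef_ends)
  next
    case 2
    have "(u (i - 1) - u (i - 2)) / (u i - u (i - 2)) = 1 - (u i - u (i - 1)) / (u i - u (i - 2))"
      "2 / (u (i - 1) - u (i - 2)) * ((u (i - 1) - u (i - 2)) / (u i - u (i - 2)))
        = 2 / (u i - u (i - 1)) * ((u i - u (i - 1)) / (u i - u (i - 2)))"
      by (use u' in \<open>simp add: field_simps\<close>) (rule canc; use u' in simp)
    with 2 show ?thesis by (simp add: local_coef_def spline_coef_ends ratio_left_def ratio_right_def)
  next
    case 3
    have "1 - (u i - u (i - 1)) / (u (i + 1) - u (i - 1)) = (u (i + 1) - u i) / (u (i + 1) - u (i - 1))"
      "2 / (u i - u (i - 1)) * ((u i - u (i - 1)) / (u (i + 1) - u (i - 1)))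
        = 2 / (u (i + 1) - u i) * ((u (i + 1) - u i) / (u (i + 1) - u (i - 1)))"
      by (use u' in \<open>simp add: field_simps\<close>) (rule canc; use u' in simp)
    with 3 show ?thesis by (simp add: local_coef_def spline_coef_ends ratio_left_def ratio_right_def)
  next
    case 4 then show ?thesis by (simp add: local_coef_def spline_coef_ends)
  qed
  then show ?A ?B by auto
qed

lemma cell_jet_edge:
  assumes u: "strict_knots u i" and v: "strict_knots v j" and k: "k \<in> {i - 2..i + 1}" and l: "l \<in> {j - 2..j
      + 2}"
    and y: "y \<in> knot_cell v j l"
  shows "cell_jet u v i j k l (u k, y) = cell_jet u v i j (k + 1) l (u k, y)"
proof (cases "l \<in> {j - 1..j + 1}")
  case False
  then have "local_coef v j l = (\<lambda>_. 0)" by (intro local_coef_zero) auto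
  then show ?thesis by (simp add: cell_jet_def)
next
  case True
  have "v (l - 1) < v l" using v True unfolding int_range_3 by (auto simp: strict_knots_def)
  moreover have "y \<in> {v (l - 1)..v l}" using y True by (auto simp: knot_cell_def)
  ultimately have t: "\<bar>cell_coord v l y\<bar> \<le> 1" by (rule cell_coord_bounds)
  define a where "a = local_coef u i k 0 + local_coef u i k 1 + local_coef u i k 2"
  define b where "b = 2 / (u k - u (k - 1)) * (local_coef u i k 1 + 2 * local_coef u i k 2)"
  let ?\<psi> = "local_coef v j l" and ?t = "cell_coord v l y"
  let ?J = "(a * (?\<psi> 0 + ?\<psi> 1 * ?t + ?\<psi> 2 * ?t\<^sup>2), b * (?\<psi> 0 + ?\<psi> 1 * ?t + ?\<psi> 2),
     2 / (v l - v (l - 1)) * (a * (?\<psi> 1 + 2 * ?\<psi> 2 * ?t)))"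
  have "cell_jet u v i j k l (u k, y) = ?J"
  \<comment> \<open>The outermost cell stands for a half-line and its formal length need not be
    positive; there the coefficients vanish instead.\<close>
  proof (cases "k = i - 2")
    case True
    then have "local_coef u i k = (\<lambda>_. 0)" by (intro local_coef_zero) auto
    then show ?thesis by (simp add: cell_jet_def a_def b_def)
  next
    case False
    then have "u (k - 1) < u k" using k u unfolding int_range_4 by (auto simp: strict_knots_def)
    then show ?thesis
      by (simp add: cell_jet_def cell_coord_ends cell_interp_edge[OF t] a_def b_def)
  qed
  moreover have "cell_jet u v i j (k + 1) l (u k, y) = ?J"
  proof (cases "k = i + 1")
    case True
    then have "local_coef u i (k + 1) = (\<lambda>_. 0)" by (intro local_coef_zero) auto
    moreover from this have "a = 0" "b = 0" unfolding a_def b_def local_coef_edge[OF u k] by simp_all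
    ultimately show ?thesis by (simp add: cell_jet_def)
  next
    case False
    then have "u k < u (k + 1)" using k u unfolding int_range_4 by (auto simp: strict_knots_def)
    then have "cell_coord u (k + 1) (u k) = - 1" using cell_coord_ends(2)[of u "k + 1"] by simp
    then show ?thesis using local_coef_edge[OF u k]
      by (simp add: cell_jet_def cell_interp_edge[OF t] a_def b_def)
  qed
  ultimately show ?thesis by simp
qed

lemma knot_cells_meet:
  assumes u: "strict_knots u i" and k: "k \<in> {i - 2..i + 2}" "k' \<in> {i - 2..i + 2}" "k < k'"
    and x: "x \<in> knot_cell u i k" "x \<in> knot_cell u i k'"
  shows "k' = k + 1 \<and> x = u k \<and> k \<in> {i - 2..i + 1}"
proof -
  obtain r where r: "k' = r + 1" by (metis diff_add_cancel)
  have k1: "k \<in> {i - 2..i + 1}" and k2: "r \<in> {i - 2..i + 1}" using k r by auto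
  have xk: "x \<le> u k" "u r \<le> x"
    using x k1 k2 r unfolding int_range_4 by (auto simp: knot_cell_def split: if_splits)
  have "k \<le> r" using k(3) r by simp
  moreover have "u k < u r" if "k < r"
    using that k1 k2 u unfolding int_range_4 by (auto simp: strict_knots_def)
  ultimately have "k' = k + 1" using xk r by force
  with r have "r = k" by simp
  with xk k1 r show ?thesis by auto
qed

lemma cell_jet_agree_x:
  assumes "strict_knots u i" "strict_knots v j" "k \<in> {i - 2..i + 2}" "k' \<in> {i - 2..i + 2}" "l \<in> {j - 2..j + 2}"
    and "x \<in> knot_cell u i k" "x \<in> knot_cell u i k'" "y \<in> knot_cell v j l"
  shows "cell_jet u v i j k l (x, y) = cell_jet u v i j k' l (x, y)"
proof -
  consider "k = k'" | "k < k'" | "k' < k" by linarith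
  then show ?thesis
  proof cases
    case 2 with knot_cells_meet[OF assms(1,3,4) 2 assms(6,7)] cell_jet_edge[OF assms(1,2) _ assms(5,8), of k]
        show ?thesis by auto
  next
    case 3 with knot_cells_meet[OF assms(1,4,3) 3 assms(7,6)] cell_jet_edge[OF assms(1,2) _ assms(5,8), of k']
        show ?thesis by auto
  qed simp
qed

text \<open>Exchanging the variables turns horizontal edges into vertical ones, so gluing need only
  be proved across vertical edges.\<close>

lemma cell_jet_swap:
  "cell_jet u v i j k l (x, y) = (let (a, b, c) = cell_jet v u j i l k (y, x) in (a, c, b))"
  by (simp add: cell_jet_def cell_interp_swap[of "local_coef u i k"])

lemma cell_jet_agree:
  assumes u: "strict_knots u i" and v: "strict_knots v j"
    and k: "k \<in> {i - 2..i + 2}" "k' \<in> {i - 2..i + 2}" and l: "l \<in> {j - 2..j + 2}" "l' \<in> {j - 2..j + 2}"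
    and x: "x \<in> knot_cell u i k" "x \<in> knot_cell u i k'" and y: "y \<in> knot_cell v j l" "y \<in> knot_cell v j l'"
  shows "cell_jet u v i j k l (x, y) = cell_jet u v i j k' l' (x, y)"
  using cell_jet_agree_x[OF u v k l(1) x y(1)] cell_jet_agree_x[OF v u l k(2) y x(2)]
    cell_jet_swap[of u v i j k' l x y] cell_jet_swap[of u v i j k' l' x y] by simp

lemma spline_jet_eq:
  assumes "strict_knots u i" "strict_knots v j" "k \<in> {i - 2..i + 2}" "l \<in> {j - 2..j + 2}"
    and "fst P \<in> knot_cell u i k" "snd P \<in> knot_cell v j l"
  shows "spline_jet u v i j P = cell_jet u v i j k l P"
  unfolding spline_jet_def
proof (rule some_equality)
  fix z assume "\<exists>k\<in>{i - 2..i + 2}. \<exists>l\<in>{j - 2..j + 2}.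
     fst P \<in> knot_cell u i k \<and> snd P \<in> knot_cell v j l \<and> z = cell_jet u v i j k l P"
  then show "z = cell_jet u v i j k l P"
    using cell_jet_agree[OF assms(1,2) _ assms(3) _ assms(4) _ assms(5) _ assms(6)] by fastforce
qed (use assms in blast)

lemma knot_cells_cover:
  obtains k where "k \<in> {i - 2..i + 2}" "x \<in> knot_cell u i k"
proof -
  have "x \<in> knot_cell u i (i - 2) \<or> x \<in> knot_cell u i (i - 1) \<or> x \<in> knot_cell u i i
      \<or> x \<in> knot_cell u i (i + 1) \<or> x \<in> knot_cell u i (i + 2)"
    by (auto simp: knot_cell_def)
  then show ?thesis
    using that[of "i - 2"] that[of "i - 1"] that[of i] that[of "i + 1"] that[of "i + 2"] by auto
qed

lemma closed_knot_cell: "closed (knot_cell u i k)"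
  by (auto simp: knot_cell_def)

text \<open>A closed set that misses \<open>P\<close> imposes no condition at \<open>P\<close>; for
  the others, limits within finitely many sets combine to a limit within their union.\<close>

lemma has_derivative_closed_cover:
  assumes I: "finite I" "I \<noteq> {}" "\<And>i. i \<in> I \<Longrightarrow> closed (C i)" "(\<Union>i\<in>I. C i) = UNIV"
    and D: "\<And>i. i \<in> I \<Longrightarrow> P \<in> C i \<Longrightarrow> (G has_derivative G') (at P within C i)"
  shows "(G has_derivative G') (at P)"
proof -
  obtain i where "i \<in> I" "P \<in> C i" using I(4) by blast
  then have bl: "bounded_linear G'" using D has_derivative_bounded_linear by blast
  have D': "(G has_derivative G') (at P within C i)" if "i \<in> I" for i
  proof (cases "P \<in> C i")
    case False
    then have "\<not> P islimpt C i" using I(3)[OF that] by (auto simp: closed_limpt)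
    then have "at P within C i = bot" by (simp add: trivial_limit_within)
    then show ?thesis using bl by (simp add: has_derivative_def)
  qed (rule D[OF that])
  have "(G has_derivative G') (at P within (\<Union>i\<in>J. C i))" if "finite J" "J \<subseteq> I" for J
    using that
  proof (induction J)
    case empty then show ?case using bl by (simp add: has_derivative_def)
  next
    case (insert j J)
    then show ?case using D'[of j] by (simp add: has_derivative_within Lim_within_Un)
  qed
  from this[OF I(1)] I(4) show ?thesis by simp
qed

lemma C1_I:
  assumes D: "\<And>P. (g has_derivative (\<lambda>h. gx P * fst h + gy P * snd h)) (at P)"
    and c: "continuous_on UNIV gx" "continuous_on UNIV gy"
  shows "C_k_on 1 UNIV g"
proof -
  have x: "((\<lambda>t. g (t, b)) has_real_derivative gx (a, b)) (at a)" for a b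
  proof -
    have "((\<lambda>t. g (t, b)) has_derivative (\<lambda>h. gx (a, b) * fst (h, 0 :: real) + gy (a, b) * snd (h, 0 :: real)))
        (at a)"
      by (rule has_derivative_compose[OF _ D]) (auto intro!: derivative_eq_intros)
    then show ?thesis by (simp add: has_field_derivative_def)
  qed
  have y: "((\<lambda>t. g (a, t)) has_real_derivative gy (a, b)) (at b)" for a b
  proof -
    have "((\<lambda>t. g (a, t)) has_derivative (\<lambda>h. gx (a, b) * fst (0 :: real, h) + gy (a, b) * snd (0 :: real, h)))
        (at b)"
      by (rule has_derivative_compose[OF _ D]) (auto intro!: derivative_eq_intros)
    then show ?thesis by (simp add: has_field_derivative_def)
  qed
  have px: "pderiv_x UNIV g = gx"
    using x by (auto simp: pderiv_x_def fun_eq_iff has_real_derivative_iff_has_vector_derivative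
        vector_derivative_at)
  have py: "pderiv_y UNIV g = gy"
    using y by (auto simp: pderiv_y_def fun_eq_iff has_real_derivative_iff_has_vector_derivative
        vector_derivative_at)
  have "continuous_on UNIV g"
    using has_derivative_continuous[OF D] by (simp add: continuous_on_eq_continuous_at)
  moreover have "(\<lambda>t. g (t, b)) differentiable at a" "(\<lambda>t. g (a, t)) differentiable at b" for a b
    using x[of b a] y[of a b] by (auto simp: differentiable_def has_field_derivative_def)
  ultimately show ?thesis using c by (auto simp: px py numeral_eq_Suc)
qed

lemma has_derivative_affine:
  fixes f :: "'a :: real_normed_vector \<Rightarrow> real"
  assumes "bounded_linear f"
  shows "((\<lambda>x. c * f x - d) has_derivative (\<lambda>h. c * f h)) (at x within S)"
  by (rule derivative_eq_intros bounded_linear_imp_has_derivative assms refl)+ simp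

lemma continuous_on_cell_interp [continuous_intros]:
  "continuous_on S f \<Longrightarrow> continuous_on S g \<Longrightarrow> continuous_on S (\<lambda>P. cell_interp \<phi> \<psi> (f P) (g P))"
  "continuous_on S f \<Longrightarrow> continuous_on S g \<Longrightarrow> continuous_on S (\<lambda>P. cell_interp_s \<phi> \<psi> (f P) (g P))"
  unfolding cell_interp_def cell_interp_s_def by (intro continuous_intros; simp)+

lemma continuous_on_cell_coord [continuous_intros]:
  "continuous_on S f \<Longrightarrow> continuous_on S (\<lambda>P. cell_coord u k (f P))"
  unfolding cell_coord_affine by (intro continuous_intros)

text \<open>The plane is covered by 25 closed cells whose jets agree where they meet, so continuity
  is pasted together and the derivative is computed on each cell with the same linear map.\<close>

lemma spline_jet_C1:
  assumes u: "strict_knots u i" and v: "strict_knots v j"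
  shows "C_k_on 1 UNIV (\<lambda>P. fst (spline_jet u v i j P))"
proof -
  let ?I = "{i - 2..i + 2} \<times> {j - 2..j + 2}"
  let ?C = "\<lambda>(k, l). knot_cell u i k \<times> knot_cell v j l"
  have cl: "closed (?C kl)" for kl by (auto simp: closed_Times closed_knot_cell case_prod_beta)
  have un: "(\<Union>kl\<in>?I. ?C kl) = UNIV"
  proof (intro set_eqI iffI UNIV_I)
    fix P :: "real \<times> real"
    obtain k where "k \<in> {i - 2..i + 2}" "fst P \<in> knot_cell u i k" by (rule knot_cells_cover)
    moreover obtain l where "l \<in> {j - 2..j + 2}" "snd P \<in> knot_cell v j l" by (rule knot_cells_cover)
    ultimately show "P \<in> (\<Union>kl\<in>?I. ?C kl)" by (intro UN_I[of "(k, l)"]) (auto simp: mem_Times_iff)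
  qed
  have eq: "spline_jet u v i j P = cell_jet u v i j k l P" if "(k, l) \<in> ?I" "P \<in> ?C (k, l)" for k l P
    using that by (intro spline_jet_eq[OF u v]) (auto simp: mem_Times_iff)
  have cont: "continuous_on UNIV (\<lambda>P. F (spline_jet u v i j P))"
    if "\<And>k l. continuous_on UNIV (\<lambda>P. F (cell_jet u v i j k l P))" for F :: "real \<times> real \<times> real \<Rightarrow> real"
  proof -
    have "continuous_on (?C kl) (\<lambda>P. F (spline_jet u v i j P))" if kl: "kl \<in> ?I" for kl
    proof -
      obtain k l where [simp]: "kl = (k, l)" by (cases kl)
      have "continuous_on (?C kl) (\<lambda>P. F (cell_jet u v i j k l P))"
        by (rule continuous_on_subset[OF \<open>\<And>k l. continuous_on UNIV (\<lambda>P. F (cell_jet u v i j k l P))\<close>]) auto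
      then show ?thesis
        by (rule continuous_on_eq) (use kl eq in auto)
    qed
    then have "continuous_on (\<Union>kl\<in>?I. ?C kl) (\<lambda>P. F (spline_jet u v i j P))"
      by (intro continuous_on_closed_Union cl) auto
    then show ?thesis unfolding un .
  qed
  show ?thesis
  proof (rule C1_I)
    show "continuous_on UNIV (\<lambda>P. fst (snd (spline_jet u v i j P)))"
      by (rule cont, unfold cell_jet_def fst_conv snd_conv, rule continuous_on_mult_left)
          (intro continuous_intros)
    show "continuous_on UNIV (\<lambda>P. snd (snd (spline_jet u v i j P)))"
      by (rule cont, unfold cell_jet_def fst_conv snd_conv, rule continuous_on_mult_left)
          (intro continuous_intros)
  next
    fix P :: "real \<times> real"
    show "((\<lambda>P. fst (spline_jet u v i j P)) has_derivative
       (\<lambda>h. fst (snd (spline_jet u v i j P)) * fst h + snd (snd (spline_jet u v i j P)) * snd h)) (at P)"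
    proof (rule has_derivative_closed_cover[OF _ _ cl un])
      fix kl assume kl: "kl \<in> ?I" "P \<in> ?C kl"
      obtain k l where [simp]: "kl = (k, l)" by (cases kl)
      have J: "spline_jet u v i j Q = cell_jet u v i j k l Q" if "Q \<in> ?C kl" for Q
        using kl(1) that eq by auto
      have "((\<lambda>Q. cell_interp (local_coef u i k) (local_coef v j l) (cell_coord u k (fst Q)) (cell_coord v l
          (snd Q)))
         has_derivative (\<lambda>h. cell_interp_s (local_coef u i k) (local_coef v j l) (cell_coord u k (fst P))
             (cell_coord v l (snd P)) * (2 / (u k - u (k - 1)) * fst h)
           + cell_interp_s (local_coef v j l) (local_coef u i k) (cell_coord v l (snd P)) (cell_coord u k
               (fst P)) * (2 / (v l - v (l - 1)) * snd h)))
           (at P within ?C kl)"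
        unfolding cell_coord_affine
        by (rule cell_interp_has_derivative; rule has_derivative_affine; simp add: bounded_linear_fst
            bounded_linear_snd)
      then have "((\<lambda>P. fst (spline_jet u v i j P)) has_derivative (\<lambda>h. cell_interp_s (local_coef u i k)
          (local_coef v j l) (cell_coord u k (fst P)) (cell_coord v l (snd P)) * (2 / (u k - u (k - 1)) * fst h)
           + cell_interp_s (local_coef v j l) (local_coef u i k) (cell_coord v l (snd P)) (cell_coord u k
               (fst P)) * (2 / (v l - v (l - 1)) * snd h)))
           (at P within ?C kl)"
        by (rule has_derivative_transform[OF kl(2), rotated]) (simp add: J cell_jet_def)
      then show "((\<lambda>P. fst (spline_jet u v i j P)) has_derivative
         (\<lambda>h. fst (snd (spline_jet u v i j P)) * fst h + snd (snd (spline_jet u v i j P)) * snd h))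
             (at P within ?C kl)"
        unfolding J[OF kl(2)] by (simp add: cell_jet_def mult_ac)
    qed auto
  qed
qed

definition increasing_knots :: "int \<Rightarrow> (int \<Rightarrow> real) \<Rightarrow> bool" where
  "increasing_knots m u \<longleftrightarrow> (\<forall>i\<in>{- 1..m + 2}. u (i - 1) < u i)"

lemma increasing_knots_mono:
  assumes u: "increasing_knots m u" and rs: "- 2 \<le> r" "r \<le> s" "s \<le> m + 2"
  shows "u r \<le> u s"
proof -
  have "s \<le> m + 2 \<longrightarrow> u r \<le> u s"
    using rs(2)
  proof (induction s rule: int_ge_induct)
    case (step s)
    show ?case
    proof
      assume "s + 1 \<le> m + 2"
      then have "u (s + 1 - 1) < u (s + 1)" using u rs(1) step(1) unfolding increasing_knots_def by
          (intro bspec[of _ _ "s + 1"]) auto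
      then show "u r \<le> u (s + 1)" using step \<open>s + 1 \<le> m + 2\<close> by auto
    qed
  qed simp
  then show ?thesis using rs by simp
qed

lemma increasing_knots_strict: "increasing_knots m u \<Longrightarrow> i \<in> {0..m + 1} \<Longrightarrow> strict_knots u i"
  unfolding increasing_knots_def strict_knots_def
  by (auto dest: bspec[of _ _ "i - 1"] bspec[of _ _ i] bspec[of _ _ "i + 1"])

lemma spline_jet_on_cell:
  assumes u: "increasing_knots m u" and v: "increasing_knots n v"
    and i: "i \<in> {0..m + 1}" and j: "j \<in> {0..n + 1}" and k: "k \<in> {- 1..m + 2}" and l: "l \<in> {- 1..n + 2}"
    and x: "x \<in> {u (k - 1)..u k}" and y: "y \<in> {v (l - 1)..v l}"
  shows "fst (spline_jet u v i j (x, y)) = cell_interp (local_coef u i k) (local_coef v j l) (cell_coord u k x)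
      (cell_coord v l y)"
proof -
  \<comment> \<open>A grid cell beyond the support is contained in a widened half-line; both indices
    carry zero coefficients, so either formula gives 0.\<close>
  have clamp: "\<exists>k'\<in>{i - 2..i + 2}. z \<in> knot_cell w i k' \<and> (k' = k \<or> local_coef w i k' = (\<lambda>_. 0)
      \<and> local_coef w i k = (\<lambda>_. 0))"
    if w: "increasing_knots m w" and i: "i \<in> {0..m + 1}" and k: "k \<in> {- 1..m + 2}" and z: "z \<in> {w (k
        - 1)..w k}" for w m i k z
  proof -
    consider "k < i - 1" | "k > i + 1" | "k \<in> {i - 1..i + 1}" by fastforce
    then show ?thesis
    proof cases
      case 1
      then have "w k \<le> w (i - 2)" using i k by (intro increasing_knots_mono[OF w]) auto
      then show ?thesis using z 1 by (intro bexI[of _ "i - 2"]) (auto simp: knot_cell_def local_coef_zero)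
    next
      case 2
      then have "w (i + 1) \<le> w (k - 1)" using i k by (intro increasing_knots_mono[OF w]) auto
      then show ?thesis using z 2 by (intro bexI[of _ "i + 2"]) (auto simp: knot_cell_def local_coef_zero)
    next
      case 3
      then show ?thesis using z by (intro bexI[of _ k]) (auto simp: knot_cell_def)
    qed
  qed
  obtain k' where k': "k' \<in> {i - 2..i + 2}" "x \<in> knot_cell u i k'" "k' = k \<or> local_coef u i k' = (\<lambda>_. 0)
      \<and> local_coef u i k = (\<lambda>_. 0)"
    using clamp[OF u i k x] by blast
  obtain l' where l': "l' \<in> {j - 2..j + 2}" "y \<in> knot_cell v j l'" "l' = l \<or> local_coef v j l' = (\<lambda>_. 0)
      \<and> local_coef v j l = (\<lambda>_. 0)"
    using clamp[OF v j l y] by blast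
  have "fst (spline_jet u v i j (x, y)) = fst (cell_jet u v i j k' l' (x, y))"
    using k' l' by (subst spline_jet_eq[OF increasing_knots_strict[OF u i] increasing_knots_strict[OF v j]])
        auto
  then show ?thesis using k'(3) l'(3) by (auto simp: cell_jet_def)
qed

section \<open>Vanishing outside the octagon\<close>

lemma convex_corner:
  fixes X Y X' Y' p q :: real
  assumes S: "convex S" "(X, Y) \<in> S" "(X', Y) \<in> S" "(X, Y') \<in> S" and pq: "0 \<le> p" "0 \<le> q" "p + q \<le> 1"
  shows "(X + p * (X' - X), Y + q * (Y' - Y)) \<in> S"
proof -
  have "convex hull {(X, Y), (X', Y), (X, Y')} \<subseteq> S"
    using S by (intro hull_minimal) auto
  moreover have "(1 - p - q) *\<^sub>R (X, Y) + p *\<^sub>R (X', Y) + q *\<^sub>R (X, Y') \<in> convex hull {(X, Y), (X', Y),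
      (X, Y')}"
    unfolding convex_hull_3 mem_Collect_eq using pq
    by (intro exI[of _ "1 - p - q"] exI[of _ p] exI[of _ q]) auto
  moreover have "(1 - p - q) *\<^sub>R (X, Y) + p *\<^sub>R (X', Y) + q *\<^sub>R (X, Y') = (X + p * (X' - X), Y + q * (Y' - Y))"
    by (simp add: algebra_simps)
  ultimately show ?thesis by auto
qed

text \<open>In the corner cells of its support the B-spline is a multiple of \<open>(e s + e' t)\<^sup>2\<close> on one side
  of a diagonal and vanishes on the other.\<close>

lemma cell_interp_corner:
  assumes "e \<in> {- 1, 1}" "e' \<in> {- 1, 1 :: int}" "0 \<le> of_int e * s + of_int e' * t"
  shows "cell_interp (spline_coef \<sigma> \<sigma>' (- e)) (spline_coef \<tau> \<tau>' (- e')) s t = 0"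
proof -
  consider "e = 1" "e' = 1" | "e = 1" "e' = - 1" | "e = - 1" "e' = 1" | "e = - 1" "e' = - 1"
    using assms by auto
  then show ?thesis
  proof cases
    case 1
    then have a: "\<bar>s + t\<bar> = s + t" using assms(3) by simp
    show ?thesis unfolding cell_interp_def a using 1 by (simp add: spline_coef_def power2_eq_square field_simps)
  next
    case 2
    then have a: "\<bar>s - t\<bar> = s - t" using assms(3) by simp
    show ?thesis unfolding cell_interp_def a using 2 by (simp add: spline_coef_def power2_eq_square field_simps)
  next
    case 3
    then have a: "\<bar>s - t\<bar> = t - s" using assms(3) by simp
    show ?thesis unfolding cell_interp_def a using 3 by (simp add: spline_coef_def power2_eq_square field_simps)
  next
    case 4
    then have a: "\<bar>s + t\<bar> = - s - t" using assms(3) by simp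
    show ?thesis unfolding cell_interp_def a using 4 by (simp add: spline_coef_def power2_eq_square field_simps)
  qed
qed

text \<open>For increasing knots the octagon is the union of this cross of two strips and one half
  of each corner cell; the halves are treated in \<open>corner_in_octagon\<close>.\<close>

lemma octagon_contains:
  shows "{u (i - 2)..u (i + 1)} \<times> {v (j - 1)..v j} \<subseteq> octagon u v i j" (is ?P1)
    and "{u (i - 1)..u i} \<times> {v (j - 2)..v (j + 1)} \<subseteq> octagon u v i j" (is ?P2)
proof -
  show ?P1
  proof safe
    fix x y assume "x \<in> {u (i - 2)..u (i + 1)}" "y \<in> {v (j - 1)..v j}"
    then show "(x, y) \<in> octagon u v i j" unfolding octagon_def
      by (intro convex_box[of _ "u (i - 2)" "v (j - 1)" "u (i + 1)"
          "v j" x y, OF convex_convex_hull hull_inc hull_inc hull_inc hull_inc]) simp_all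
  qed
  show ?P2
  proof safe
    fix x y assume "x \<in> {u (i - 1)..u i}" "y \<in> {v (j - 2)..v (j + 1)}"
    then show "(x, y) \<in> octagon u v i j" unfolding octagon_def
      by (intro convex_box[of _ "u (i - 1)" "v (j - 2)" "u i" "v (j
          + 1)" x y, OF convex_convex_hull hull_inc hull_inc hull_inc hull_inc]) simp_all
  qed
qed

text \<open>The pair \<open>e\<close>, \<open>e'\<close> names the corner cell. Measured from its
  inner node, the fractions \<open>(1 + e s) / 2\<close> and \<open>(1 + e' t) / 2\<close> add up to
  at most 1 exactly when \<open>e s + e' t \<le> 0\<close>; the point then lies in the triangle
  spanned by the inner node and two vertices of the octagon.\<close>

lemma corner_in_octagon:
  assumes u: "strict_knots u i" and v: "strict_knots v j" and e: "e \<in> {- 1, 1}" "e' \<in> {- 1, 1 :: int}"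
    and x: "x \<in> {u (i + e - 1)..u (i + e)}" and y: "y \<in> {v (j + e' - 1)..v (j + e')}"
    and neg: "of_int e * cell_coord u (i + e) x + of_int e' * cell_coord v (j + e') y \<le> 0"
  shows "(x, y) \<in> octagon u v i j"
proof -
  define X where "X = (if e = 1 then u i else u (i - 1))"
  define X' where "X' = (if e = 1 then u (i + 1) else u (i - 2))"
  define Y where "Y = (if e' = 1 then v j else v (j - 1))"
  define Y' where "Y' = (if e' = 1 then v (j + 1) else v (j - 2))"
  define s where "s = cell_coord u (i + e) x"
  define t where "t = cell_coord v (j + e') y"
  have s: "x = X + (1 + of_int e * s) / 2 * (X' - X)"
    using u e(1) by (auto simp: s_def cell_coord_def X_def X'_def strict_knots_def field_simps)
  have t: "y = Y + (1 + of_int e' * t) / 2 * (Y' - Y)"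
    using v e(2) by (auto simp: t_def cell_coord_def Y_def Y'_def strict_knots_def field_simps)
  have "\<bar>s\<bar> \<le> 1" unfolding s_def
    using u e(1) x by (intro cell_coord_bounds) (auto simp: strict_knots_def)
  moreover have "\<bar>t\<bar> \<le> 1" unfolding t_def
    using v e(2) y by (intro cell_coord_bounds) (auto simp: strict_knots_def)
  ultimately have st: "0 \<le> (1 + of_int e * s) / 2" "0 \<le> (1 + of_int e' * t) / 2"
      "(1 + of_int e * s) / 2 + (1 + of_int e' * t) / 2 \<le> 1"
    using e neg unfolding s_def[symmetric] t_def[symmetric] by (auto simp: field_simps)
  have "(X, Y) \<in> octagon u v i j"
    by (rule subsetD[OF octagon_contains(1)]) (use u v in \<open>auto simp: X_def Y_def strict_knots_def\<close>)
  moreover have "(X', Y) \<in> octagon u v i j"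
    by (rule subsetD[OF octagon_contains(1)]) (use u v in \<open>auto simp: X'_def Y_def strict_knots_def\<close>)
  moreover have "(X, Y') \<in> octagon u v i j"
    by (rule subsetD[OF octagon_contains(2)]) (use u v in \<open>auto simp: X_def Y'_def strict_knots_def\<close>)
  ultimately show ?thesis
    unfolding s[THEN trans[OF _ refl]] t using convex_corner[OF _ _ _ _ st, of "octagon u v i j" X Y X' Y'] s t
    by (simp add: octagon_def convex_convex_hull)
qed

text \<open>A point of the supporting block outside the octagon lies in a corner cell, on the far
  side of its diagonal, where \<open>cell_interp_corner\<close> gives 0.\<close>

lemma spline_jet_octagon:
  assumes u: "strict_knots u i" and v: "strict_knots v j" and P: "(x, y) \<notin> octagon u v i j"
  shows "fst (spline_jet u v i j (x, y)) = 0"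
proof -
  obtain k where k: "k \<in> {i - 2..i + 2}" "x \<in> knot_cell u i k" by (rule knot_cells_cover)
  obtain l where l: "l \<in> {j - 2..j + 2}" "y \<in> knot_cell v j l" by (rule knot_cells_cover)
  have J: "fst (spline_jet u v i j (x, y)) = cell_interp (local_coef u i k) (local_coef v j l)
      (cell_coord u k x) (cell_coord v l y)"
    using spline_jet_eq[OF u v k(1) l(1)] k(2) l(2) by (simp add: cell_jet_def)
  show ?thesis
  proof (cases "k \<in> {i - 1..i + 1} \<and> l \<in> {j - 1..j + 1}")
    case False
    then have "local_coef u i k = (\<lambda>_. 0) \<or> local_coef v j l = (\<lambda>_. 0)"
      using local_coef_zero[of i k] local_coef_zero[of j l] by auto
    then show ?thesis unfolding J by auto
  next
    case True
    have x: "x \<in> {u (k - 1)..u k}" and y: "y \<in> {v (l - 1)..v l}"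
      using True k l by (auto simp: knot_cell_def)
    have xb: "x \<in> {u (i - 2)..u (i + 1)}" and yb: "y \<in> {v (j - 2)..v (j + 1)}"
      using x y True u v unfolding int_range_3 by (auto simp: strict_knots_def)
    have "(x, y) \<notin> {u (i - 1)..u i} \<times> {v (j - 2)..v (j + 1)}" "(x, y) \<notin> {u (i - 2)..u (i + 1)} \<times> {v (j
        - 1)..v j}"
      using octagon_contains[of u i v j] P by blast+
    then have "k \<noteq> i" "l \<noteq> j" using x y xb yb by auto
    then have e: "k - i \<in> {- 1, 1}" "l - j \<in> {- 1, 1}" using True by auto
    have "\<not> of_int (k - i) * cell_coord u k x + of_int (l - j) * cell_coord v l y \<le> 0"
      using corner_in_octagon[OF u v e, of x y] x y P by auto
    then show ?thesis unfolding J local_coef_def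
      using cell_interp_corner[OF e, of "cell_coord u k x" "cell_coord v l y"] by simp
  qed
qed

lemma quadratic_on_cong: "quadratic_on T f \<Longrightarrow> (\<And>P. P \<in> T \<Longrightarrow> g P = f P) \<Longrightarrow> quadratic_on T g"
  unfolding quadratic_on_def by (elim exE, intro exI) (auto simp: case_prod_beta')

lemma classical_bspline_eq:
  assumes u: "increasing_knots m u" and v: "increasing_knots n v"
    and i: "i \<in> {0..m + 1}" and j: "j \<in> {0..n + 1}"
  shows "classical_bspline m n u v i j = (\<lambda>P. fst (spline_jet u v i j P))"
  unfolding classical_bspline_def
proof (rule the_equality)
  note su = increasing_knots_strict[OF u i] and sv = increasing_knots_strict[OF v j]
  show B: "is_classical_bspline m n u v i j (\<lambda>P. fst (spline_jet u v i j P))"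
    unfolding is_classical_bspline_def
  proof (intro conjI ballI allI impI)
    show "C_k_on 1 UNIV (\<lambda>P. fst (spline_jet u v i j P))" by (rule spline_jet_C1[OF su sv])
  next
    fix T assume "T \<in> criss_cross {- 1..m + 2} {- 1..n + 2} u v"
    then obtain k l where kl: "k \<in> {- 1..m + 2}" "l \<in> {- 1..n + 2}"
      and T: "T \<in> rect_triangles (u (k - 1)) (u k) (v (l - 1)) (v l)"
      unfolding criss_cross_def by blast
    have lt: "u (k - 1) < u k" "v (l - 1) < v l" using kl u v by (auto simp: increasing_knots_def)
    show "quadratic_on T (\<lambda>P. fst (spline_jet u v i j P))"
    proof (rule quadratic_on_cong[OF cell_interp_quadratic_on[OF lt T]])
      fix P assume "P \<in> T"
      then have "P \<in> {u (k - 1)..u k} \<times> {v (l - 1)..v l}" using triangle_signs(1)[of u k v l, OF lt T] by blast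
      then show "fst (spline_jet u v i j P) = (case P of (x, y) \<Rightarrow>
          cell_interp (local_coef u i k) (local_coef v j l) (cell_coord u k x) (cell_coord v l y))"
        using spline_jet_on_cell[OF u v i j kl] by (cases P) auto
    qed
  next
    fix P assume "P \<notin> octagon u v i j"
    then show "fst (spline_jet u v i j P) = 0" using spline_jet_octagon[OF su sv] by (cases P) auto
  next
    have lt: "u (i - 1) < u i" "v (j - 1) < v j" "u i < u (i + 1)" "v j < v (j + 1)"
      using su sv by (auto simp: strict_knots_def)
    \<comment> \<open>At the upper right end of cell \<open>(i, j)\<close> each factor is one minus
      the right ratio, which is the prescribed normalisation.\<close>
    have r: "1 - (w i - w (i - 1)) / (w (i + 1) - w (i - 1)) = (w (i + 1) - w i) / (w (i + 1) - w (i - 1))"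
      if "w (i - 1) < w i" "w i < w (i + 1)" for w :: "int \<Rightarrow> real" and i
      using that by (simp add: field_simps)
    have e: "local_coef w i i 0 + local_coef w i i 1 + local_coef w i i 2 = 1 - (w i - w (i - 1)) / (w (i + 1)
        - w (i - 1))"
      for w :: "int \<Rightarrow> real" and i
      by (simp add: local_coef_def spline_coef_ends ratio_right_def)
    have "fst (spline_jet u v i j (u i, v j)) = cell_interp (local_coef u i i) (local_coef v j j) 1 1"
      using spline_jet_on_cell[OF u v i j, of i j "u i" "v j"] lt i j by (simp add: cell_coord_ends)
    also have "\<dots> = (local_coef u i i 0 + local_coef u i i 1 + local_coef u i i 2)
                 * (local_coef v j j 0 + local_coef v j j 1 + local_coef v j j 2)"
      by (subst cell_interp_edge(1)) auto
    finally show "fst (spline_jet u v i j (u i, v j)) = (u (i + 1) - u i) / (u (i + 1) - u (i - 1)) *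
                    ((v (j + 1) - v j) / (v (j + 1) - v (j - 1)))"
      unfolding e r[OF lt(1,3)] r[OF lt(2,4)] .
  qed
  fix g assume "is_classical_bspline m n u v i j g"
  from classical_bspline_unique[OF _ _ i j this B] u v show "g = (\<lambda>P. fst (spline_jet u v i j P))"
    by (auto simp: increasing_knots_def)
qed

subsection \<open>Second derivatives of a spline on a triangle\<close>

text \<open>Evaluation of the interpolant and each second derivative on a triangle are linear in
  each univariate factor, so sums over B-splines can be moved into the factors. The combined law for
  \<open>a * \<phi> + \<phi>'\<close> is the induction step over such a sum.\<close>

definition bilinear_form :: "((int \<Rightarrow> real) \<Rightarrow> (int \<Rightarrow> real) \<Rightarrow> real) \<Rightarrow> bool" where
  "bilinear_form F \<longleftrightarrow>
     (\<forall>a \<phi> \<phi>' \<psi>. F (\<lambda>c. a * \<phi> c + \<phi>' c) \<psi> = a * F \<phi> \<psi> + F \<phi>' \<psi>) \<and>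
     (\<forall>a \<phi> \<psi> \<psi>'. F \<phi> (\<lambda>c. a * \<psi> c + \<psi>' c) = a * F \<phi> \<psi> + F \<phi> \<psi>')"

lemma bilinear_form_cell:
  "bilinear_form (\<lambda>\<phi> \<psi>. cell_interp \<phi> \<psi> s t)" "bilinear_form (tri_ss p q)"
  "bilinear_form (tri_st p q)" "bilinear_form (tri_tt p q)"
proof -
  have "bilinear_form (\<lambda>\<phi> \<psi>. \<phi> 0 * \<psi> 0 + \<phi> 1 * \<psi> 0 * a + \<phi> 0 * \<psi> 1 * b + \<phi> 2 * \<psi> 0 * c + \<phi> 1 * \<psi> 1 * a * b
      + \<phi> 0 * \<psi> 2 * d
     + \<phi> 2 * \<psi> 1 * A + \<phi> 1 * \<psi> 2 * B + \<phi> 2 * \<psi> 2 * C)" for a b c d A B C :: real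
    by (simp add: bilinear_form_def algebra_simps)
  then show "bilinear_form (\<lambda>\<phi> \<psi>. cell_interp \<phi> \<psi> s t)"
    unfolding cell_interp_def .
qed (simp_all add: bilinear_form_def tri_ss_def tri_st_def tri_tt_def algebra_simps)

lemma bilinear_form_zero:
  assumes "bilinear_form F"
  shows "F (\<lambda>_. 0) \<psi> = 0" "F \<phi> (\<lambda>_. 0) = 0"
proof -
  have "F (\<lambda>c. a * \<phi> c + \<phi>' c) \<psi> = a * F \<phi> \<psi> + F \<phi>' \<psi>" "F \<phi> (\<lambda>c. a * \<psi> c + \<psi>' c) = a * F \<phi> \<psi>
      + F \<phi> \<psi>'" for a \<phi> \<phi>' \<psi> \<psi>'
    using assms unfolding bilinear_form_def by blast+
  from this(1)[of 1 "\<lambda>_. 0" "\<lambda>_. 0" \<psi>] this(2)[of \<phi> 1 "\<lambda>_. 0" "\<lambda>_. 0"]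
  show "F (\<lambda>_. 0) \<psi> = 0" "F \<phi> (\<lambda>_. 0) = 0" by simp_all
qed

lemma bilinear_form_sum:
  assumes F: "bilinear_form F" and fin: "finite I" "finite J"
  shows "F (\<lambda>c. \<Sum>i\<in>I. \<alpha> i * \<phi> i c) (\<lambda>c. \<Sum>j\<in>J. \<beta> j * \<psi> j c) = (\<Sum>i\<in>I. \<Sum>j\<in>J. \<alpha> i * \<beta> j * F (\<phi> i) (\<psi> j))"
proof -
  have l: "F (\<lambda>c. a * \<phi> c + \<phi>' c) \<psi> = a * F \<phi> \<psi> + F \<phi>' \<psi>" for a \<phi> \<phi>' \<psi>
    using F unfolding bilinear_form_def by blast
  have r: "F \<phi> (\<lambda>c. a * \<psi> c + \<psi>' c) = a * F \<phi> \<psi> + F \<phi> \<psi>'" for a \<phi> \<psi> \<psi>'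
    using F unfolding bilinear_form_def by blast
  note z = bilinear_form_zero[OF F]
  have 1: "F (\<lambda>c. \<Sum>i\<in>I. \<alpha> i * \<phi> i c) \<psi> = (\<Sum>i\<in>I. \<alpha> i * F (\<phi> i) \<psi>)" for \<psi>
    using fin(1) by (induction I) (simp_all add: z l)
  have 2: "F \<phi> (\<lambda>c. \<Sum>j\<in>J. \<beta> j * \<psi> j c) = (\<Sum>j\<in>J. \<beta> j * F \<phi> (\<psi> j))" for \<phi>
    using fin(2) by (induction J) (simp_all add: z r)
  show ?thesis unfolding 1 2 by (simp add: sum_distrib_left mult.assoc)
qed

section \<open>Bounds and exactness of the nine-coefficient stencil\<close>

abbreviation stencil :: "int set" where "stencil \<equiv> {- 1, 0, 1}"

abbreviation stencil_form ::
  "(int \<Rightarrow> int \<Rightarrow> real) \<Rightarrow> ((int \<Rightarrow> real) \<Rightarrow> (int \<Rightarrow> real) \<Rightarrow> real) \<Rightarrow> real \<Rightarrow> real \<Rightarrow> real \<Rightarrow> real \<Rightarrow> real" where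
  "stencil_form w F \<sigma> \<sigma>' \<tau> \<tau>' \<equiv>
     \<Sum>r\<in>stencil. \<Sum>r'\<in>stencil. w r r' * F (spline_coef \<sigma> \<sigma>' r) (spline_coef \<tau> \<tau>' r')"

lemma sum_stencil: "(\<Sum>r\<in>stencil. f r) = f (- 1) + f 0 + f 1" for f :: "int \<Rightarrow> real"
  by (simp add: add.assoc)

lemma abs_scale_le: "\<lbrakk>0 \<le> a; a \<le> 1; \<bar>X\<bar> \<le> B\<rbrakk> \<Longrightarrow> \<bar>a * X\<bar> \<le> B" for a X B :: real
  using mult_mono[of a 1 "\<bar>X\<bar>" B] by (simp add: abs_mult)

text \<open>Of the weights \<open>w r 1\<close> only \<open>w 0 1\<close> enters on the bottom triangle, which keeps the constants small.\<close>

lemma bottom_triangle_bound: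
  fixes \<sigma> \<sigma>' \<tau> \<tau>' E1 E2 :: real
  assumes s: "0 \<le> \<sigma>" "\<sigma> \<le> 1" "0 \<le> \<sigma>'" "\<sigma>' \<le> 1" "0 \<le> \<tau>" "\<tau> \<le> 1" "0 \<le> \<tau>'" "\<tau>' \<le> 1"
    and w1: "\<And>r r'. r \<in> stencil \<Longrightarrow> r' \<in> stencil \<Longrightarrow> r = 0 \<or> r' = 0 \<Longrightarrow> \<bar>w r r'\<bar> \<le> E1"
    and w2: "\<And>r r'. r \<in> stencil \<Longrightarrow> r' \<in> stencil \<Longrightarrow> \<bar>w r r'\<bar> \<le> E2" and E: "E1 \<le> E2"
  shows "\<bar>stencil_form w (tri_ss (- 1) 1) \<sigma> \<sigma>' \<tau> \<tau>'\<bar> \<le> 3 * E1 + E2" (is ?P1)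
    and "\<bar>stencil_form w (tri_st (- 1) 1) \<sigma> \<sigma>' \<tau> \<tau>'\<bar> \<le> 3 * E1 + E2" (is ?P2)
    and "\<bar>stencil_form w (tri_tt (- 1) 1) \<sigma> \<sigma>' \<tau> \<tau>'\<bar> \<le> 3 * E1 + E2" (is ?P3)
proof -
  have b: "\<bar>w (- 1) 0\<bar> \<le> E1" "\<bar>w 1 0\<bar> \<le> E1" "\<bar>w 0 0\<bar> \<le> E1" "\<bar>w 0 (- 1)\<bar> \<le> E1" "\<bar>w 0 1\<bar> \<le> E1"
    "\<bar>w (- 1) (- 1)\<bar> \<le> E2" "\<bar>w 1 (- 1)\<bar> \<le> E2"
    by (auto intro!: w1 w2)
  have E1: "0 \<le> E1" using b(1) by linarith
  have le: "2 * (E1 + E2) \<le> 6 * E1 + 2 * E2" "4 * E1 + 2 * E2 \<le> 6 * E1 + 2 * E2"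
    using E1 by simp_all
  have half: "\<bar>S\<bar> \<le> 3 * E1 + E2" if "S = R / 2" "\<bar>R\<bar> \<le> B" "B \<le> 6 * E1 + 2 * E2" for S R B :: real
    using that by linarith
  have three: "\<bar>x + y - z\<bar> \<le> 4 * E1 + 2 * E2" "\<bar>y + z + x\<bar> \<le> 4 * E1 + 2 * E2"
    if "\<bar>x\<bar> \<le> E1 + E2" "\<bar>y\<bar> \<le> 2 * E1" "\<bar>z\<bar> \<le> E1 + E2" for x y z :: real
    using that by linarith+
  \<comment> \<open>Differences between the rows 0 and -1. The mixed derivative is a horizontal
    difference of these, and through them the corner weights enter the \<open>tt\<close>
    derivative.\<close>
  define Dm where "Dm = w (- 1) 0 - w (- 1) (- 1)"
  define D0 where "D0 = w 0 0 - w 0 (- 1)"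
  define Dp where "Dp = w 1 0 - w 1 (- 1)"
  have D: "\<bar>Dm\<bar> \<le> E1 + E2" "\<bar>D0\<bar> \<le> 2 * E1" "\<bar>Dp\<bar> \<le> E1 + E2"
    using b by (auto simp: Dm_def D0_def Dp_def)
  \<comment> \<open>An average, with weights \<tau> and \<open>1 - \<tau>\<close>, of the horizontal
    second differences in the rows -1 and 0.\<close>
  have "stencil_form w (tri_ss (- 1) 1) \<sigma> \<sigma>' \<tau> \<tau>'
     = (\<tau> * (\<sigma> * (w (- 1) (- 1) - w 0 (- 1)) + \<sigma>' * (w 1 (- 1) - w 0 (- 1)))
      + (1 - \<tau>) * (\<sigma> * (w (- 1) 0 - w 0 0) + \<sigma>' * (w 1 0 - w 0 0))) / 2"
    unfolding sum_stencil tri_ss_def by (simp add: spline_coef_def field_simps)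
  moreover have "\<bar>\<tau> * (\<sigma> * (w (- 1) (- 1) - w 0 (- 1)) + \<sigma>' * (w 1 (- 1) - w 0 (- 1)))
      + (1 - \<tau>) * (\<sigma> * (w (- 1) 0 - w 0 0) + \<sigma>' * (w 1 0 - w 0 0))\<bar> \<le> 2 * (E1 + E2)"
  proof -
    have two: "\<bar>x + y\<bar> \<le> 2 * B" if "\<bar>x\<bar> \<le> B" "\<bar>y\<bar> \<le> B" for x y B :: real
      using that by linarith
    have d: "\<bar>w (- 1) (- 1) - w 0 (- 1)\<bar> \<le> E1 + E2" "\<bar>w 1 (- 1) - w 0 (- 1)\<bar> \<le> E1 + E2"
      using b(4,6,7) by linarith+
    have d': "\<bar>w (- 1) 0 - w 0 0\<bar> \<le> E1 + E2" "\<bar>w 1 0 - w 0 0\<bar> \<le> E1 + E2"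
      using b(1-3) E by linarith+
    have "\<bar>\<sigma> * (w (- 1) (- 1) - w 0 (- 1))\<bar> \<le> E1 + E2" "\<bar>\<sigma>' * (w 1 (- 1) - w 0 (- 1))\<bar> \<le> E1 + E2"
      "\<bar>\<sigma> * (w (- 1) 0 - w 0 0)\<bar> \<le> E1 + E2" "\<bar>\<sigma>' * (w 1 0 - w 0 0)\<bar> \<le> E1 + E2"
      using s d d' by (auto intro!: abs_scale_le)
    from two[OF this(1,2)] two[OF this(3,4)] have 1: "\<bar>\<sigma> * (w (- 1) (- 1) - w 0 (- 1)) + \<sigma>' * (w 1 (- 1) - w 0
        (- 1))\<bar> \<le> 2 * (E1 + E2)"
      "\<bar>\<sigma> * (w (- 1) 0 - w 0 0) + \<sigma>' * (w 1 0 - w 0 0)\<bar> \<le> 2 * (E1 + E2)" by this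
    have "\<bar>\<tau> * x + (1 - \<tau>) * y\<bar> \<le> B" if "\<bar>x\<bar> \<le> B" "\<bar>y\<bar> \<le> B" for x y B :: real
    proof -
      have "\<bar>\<tau> * x + (1 - \<tau>) * y\<bar> \<le> \<bar>\<tau> * x\<bar> + \<bar>(1 - \<tau>) * y\<bar>" by (rule abs_triangle_ineq)
      also have "\<dots> = \<tau> * \<bar>x\<bar> + (1 - \<tau>) * \<bar>y\<bar>" using s by (simp add: abs_mult)
      also have "\<dots> \<le> \<tau> * B + (1 - \<tau>) * B" using s that by (intro add_mono mult_left_mono) auto
      finally show ?thesis by (simp add: algebra_simps)
    qed
    from this[OF 1] show ?thesis .
  qed
  ultimately show ?P1
    by (rule half[OF _ _ le(1)])
  have sd: "\<bar>\<sigma> * Dm\<bar> \<le> E1 + E2" "\<bar>\<sigma>' * Dp\<bar> \<le> E1 + E2"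
    using D s by (auto intro!: abs_scale_le)
  have "stencil_form w (tri_st (- 1) 1) \<sigma> \<sigma>' \<tau> \<tau>'
     = \<tau> * (\<sigma>' * Dp + (\<sigma> - \<sigma>') * D0 - \<sigma> * Dm) / 2"
    unfolding sum_stencil tri_st_def Dm_def D0_def Dp_def by (simp add: spline_coef_def field_simps)
  moreover have "\<bar>\<tau> * (\<sigma>' * Dp + (\<sigma> - \<sigma>') * D0 - \<sigma> * Dm)\<bar> \<le> 4 * E1 + 2 * E2"
  proof (rule abs_scale_le)
    have "\<bar>\<bar>\<sigma> - \<sigma>'\<bar> * D0\<bar> \<le> 2 * E1" using D s by (intro abs_scale_le) auto
    then have "\<bar>(\<sigma> - \<sigma>') * D0\<bar> \<le> 2 * E1" by (simp add: abs_mult)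
    then show "\<bar>\<sigma>' * Dp + (\<sigma> - \<sigma>') * D0 - \<sigma> * Dm\<bar> \<le> 4 * E1 + 2 * E2"
      using sd three by blast
  qed (use s in auto)
  ultimately show ?P2
    by (rule half[OF _ _ le(2)])
  \<comment> \<open>This derivative determines the constant: \<open>2 * E1\<close> from the
    difference to the row above and \<open>4 * E1 + 2 * E2\<close> from the row below, halved to
    \<open>3 * E1 + E2\<close>.\<close>
  have "stencil_form w (tri_tt (- 1) 1) \<sigma> \<sigma>' \<tau> \<tau>'
     = (\<tau>' * (w 0 1 - w 0 0) - \<tau> * ((1 - \<sigma> - \<sigma>') * D0 + \<sigma> * Dm + \<sigma>' * Dp)) / 2"
    unfolding sum_stencil tri_tt_def Dm_def D0_def Dp_def by (simp add: spline_coef_def field_simps)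
  moreover have "\<bar>\<tau>' * (w 0 1 - w 0 0) - \<tau> * ((1 - \<sigma> - \<sigma>') * D0 + \<sigma> * Dm + \<sigma>' * Dp)\<bar> \<le> 2 * E1 + (4 * E1
      + 2 * E2)"
  proof (rule order_trans[OF abs_triangle_ineq4 add_mono])
  show "\<bar>\<tau>' * (w 0 1 - w 0 0)\<bar> \<le> 2 * E1" using b s by (intro abs_scale_le) auto
  show "\<bar>\<tau> * ((1 - \<sigma> - \<sigma>') * D0 + \<sigma> * Dm + \<sigma>' * Dp)\<bar> \<le> 4 * E1 + 2 * E2"
  proof (rule abs_scale_le)
    have "\<bar>\<bar>1 - \<sigma> - \<sigma>'\<bar> * D0\<bar> \<le> 2 * E1" using D s by (intro abs_scale_le) auto
    then have "\<bar>(1 - \<sigma> - \<sigma>') * D0\<bar> \<le> 2 * E1" by (simp add: abs_mult)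
    then show "\<bar>(1 - \<sigma> - \<sigma>') * D0 + \<sigma> * Dm + \<sigma>' * Dp\<bar> \<le> 4 * E1 + 2 * E2"
      using sd three by blast
  qed (use s in auto)
  qed
  ultimately show ?P3
    by (rule half) linarith
qed

text \<open>The reflection of \<open>t\<close> to \<open>- t\<close> maps the top triangle to the
  bottom one; it reverses the index, exchanges the neighbour ratios \<open>\<tau>\<close> and
  \<open>\<tau>'\<close>, and changes the sign of the mixed derivative.\<close>

lemma tri_reflect:
  "tri_ss 1 (- 1) \<phi> (spline_coef \<tau> \<tau>' r) = tri_ss (- 1) 1 \<phi> (spline_coef \<tau>' \<tau> (- r))" (is ?P1)
  "tri_st 1 (- 1) \<phi> (spline_coef \<tau> \<tau>' r) = - tri_st (- 1) 1 \<phi> (spline_coef \<tau>' \<tau> (- r))"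
  "tri_tt 1 (- 1) \<phi> (spline_coef \<tau> \<tau>' r) = tri_tt (- 1) 1 \<phi> (spline_coef \<tau>' \<tau> (- r))"
proof -
  have "spline_coef \<tau>' \<tau> (- r) 0 = spline_coef \<tau> \<tau>' r 0" "spline_coef \<tau>' \<tau> (- r) 1 = - spline_coef \<tau> \<tau>' r 1"
    "spline_coef \<tau>' \<tau> (- r) 2 = spline_coef \<tau> \<tau>' r 2"
    by (auto simp: spline_coef_def field_simps)
  then show ?P1
    "tri_st 1 (- 1) \<phi> (spline_coef \<tau> \<tau>' r) = - tri_st (- 1) 1 \<phi> (spline_coef \<tau>' \<tau> (- r))"
    "tri_tt 1 (- 1) \<phi> (spline_coef \<tau> \<tau>' r) = tri_tt (- 1) 1 \<phi> (spline_coef \<tau>' \<tau> (- r))"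
    by (simp_all add: tri_ss_def tri_st_def tri_tt_def)
qed

lemma horizontal_triangle_bound:
  fixes \<sigma> \<sigma>' \<tau> \<tau>' E1 E2 p :: real
  assumes p: "p \<in> {- 1, 1}"
    and s: "0 \<le> \<sigma>" "\<sigma> \<le> 1" "0 \<le> \<sigma>'" "\<sigma>' \<le> 1" "0 \<le> \<tau>" "\<tau> \<le> 1" "0 \<le> \<tau>'" "\<tau>' \<le> 1"
    and w1: "\<And>r r'. r \<in> stencil \<Longrightarrow> r' \<in> stencil \<Longrightarrow> r = 0 \<or> r' = 0 \<Longrightarrow> \<bar>w r r'\<bar> \<le> E1"
    and w2: "\<And>r r'. r \<in> stencil \<Longrightarrow> r' \<in> stencil \<Longrightarrow> \<bar>w r r'\<bar> \<le> E2" and E: "E1 \<le> E2"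
    and F: "F \<in> {tri_ss p (- p), tri_st p (- p), tri_tt p (- p)}"
  shows "\<bar>stencil_form w F \<sigma> \<sigma>' \<tau> \<tau>'\<bar> \<le> 3 * E1 + E2"
proof (cases "p = - 1")
  case True
  then show ?thesis using F bottom_triangle_bound[of \<sigma> \<sigma>' \<tau> \<tau>' w E1 E2, OF s w1 w2 E] by auto
next
  case False
  then have p1: "p = 1" using p by simp
  have w: "\<bar>w r (- r')\<bar> \<le> E1" if "r \<in> stencil" "r' \<in> stencil" "r = 0 \<or> r' = 0" for r r'
    using that by (intro w1) auto
  have w': "\<bar>w r (- r')\<bar> \<le> E2" if "r \<in> stencil" "r' \<in> stencil" for r r'
    using that by (intro w2) auto
  have re: "(\<Sum>r\<in>stencil. \<Sum>r'\<in>stencil. G r r') = (\<Sum>r\<in>stencil. \<Sum>r'\<in>stencil. G r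
      (- r'))" for G :: "int \<Rightarrow> int \<Rightarrow> real"
    unfolding sum_stencil by simp
  note B = bottom_triangle_bound[of \<sigma> \<sigma>' \<tau>' \<tau> "\<lambda>r r'. w r (- r')" E1 E2, OF s(1-4) s(7,8) s(5,6) w w' E]
  from F B show ?thesis
    unfolding p1 by (subst re) (auto simp only: tri_reflect insert_iff empty_iff minus_minus mult_minus_right
        sum_negf abs_minus_cancel)
qed

text \<open>The left and right triangles, where \<open>q = p\<close>, follow from the horizontal
  ones by exchanging the coordinates: \<open>tri_ss\<close> and \<open>tri_tt\<close> change places,
  and the hypotheses on the weights are symmetric.\<close>

lemma triangle_bound:
  fixes \<sigma> \<sigma>' \<tau> \<tau>' E1 E2 p q :: real
  assumes pq: "(p, q) \<in> tri_signs"
    and s: "0 \<le> \<sigma>" "\<sigma> \<le> 1" "0 \<le> \<sigma>'" "\<sigma>' \<le> 1" "0 \<le> \<tau>" "\<tau> \<le> 1" "0 \<le> \<tau>'" "\<tau>' \<le> 1"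
    and w1: "\<And>r r'. r \<in> stencil \<Longrightarrow> r' \<in> stencil \<Longrightarrow> r = 0 \<or> r' = 0 \<Longrightarrow> \<bar>w r r'\<bar> \<le> E1"
    and w2: "\<And>r r'. r \<in> stencil \<Longrightarrow> r' \<in> stencil \<Longrightarrow> \<bar>w r r'\<bar> \<le> E2" and E: "E1 \<le> E2"
    and F: "F \<in> {tri_ss p q, tri_st p q, tri_tt p q}"
  shows "\<bar>stencil_form w F \<sigma> \<sigma>' \<tau> \<tau>'\<bar> \<le> 3 * E1 + E2"
proof -
  have p: "p \<in> {- 1, 1}" using pq by (auto simp: tri_signs_def)
  consider "q = - p" | "q = p" using pq by (auto simp: tri_signs_def)
  then show ?thesis
  proof cases
    case 1
    show ?thesis by (rule horizontal_triangle_bound[OF p s w1 w2 E]) (use F 1 in auto)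
  next
    case 2
    define G where "G = (\<lambda>\<psi> \<phi>. F \<phi> \<psi>)"
    have G: "G \<in> {tri_ss p (- p), tri_st p (- p), tri_tt p (- p)}"
    proof -
      have "tri_tt p (- p) = (\<lambda>\<psi> \<phi>. tri_ss p p \<phi> \<psi>)" "tri_st p (- p) = (\<lambda>\<psi> \<phi>. tri_st p p \<phi> \<psi>)"
        "tri_ss p (- p) = (\<lambda>\<psi> \<phi>. tri_tt p p \<phi> \<psi>)"
        by (simp_all add: fun_eq_iff tri_ss_def tri_st_def tri_tt_def)
      then show ?thesis using F unfolding 2 G_def by auto
    qed
    have "stencil_form w F \<sigma> \<sigma>' \<tau> \<tau>'
      = (\<Sum>r'\<in>stencil. \<Sum>r\<in>stencil. w r r' * G (spline_coef \<tau> \<tau>' r') (spline_coef \<sigma> \<sigma>' r))"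
      unfolding G_def by (rule sum.swap)
    moreover have "\<bar>\<dots>\<bar> \<le> 3 * E1 + E2"
      by (rule horizontal_triangle_bound[OF p s(5-8) s(1-4) _ _ E G]) (use w1 w2 in auto)
    ultimately show ?thesis by simp
  qed
qed

text \<open>\<open>\<xi>\<close> and \<open>\<eta>\<close> are the coefficients of \<open>X\<close> and \<open>X\<^sup>2\<close> in the B-spline basis, where \<open>X\<close> is measured
  from the centre of the cell of length \<open>h\<close>.\<close>

definition moment_weights :: "real \<Rightarrow> real \<Rightarrow> real \<Rightarrow> (int \<Rightarrow> real) \<Rightarrow> (int \<Rightarrow> real) \<Rightarrow> bool" where
  "moment_weights h \<sigma> \<sigma>' \<xi> \<eta> \<longleftrightarrow>
     \<sigma> * \<xi> (- 1) = - h / 2 \<and> \<xi> 0 = 0 \<and> \<sigma>' * \<xi> 1 = h / 2 \<and>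
     \<sigma> * (\<eta> (- 1) - \<eta> 0) = h\<^sup>2 / 2 \<and> \<eta> 0 = - h\<^sup>2 / 4 \<and> \<sigma>' * (\<eta> 1 - \<eta> 0) = h\<^sup>2 / 2"

text \<open>With \<open>X = (h / 2) s\<close> the right-hand sides are the coefficients of 1,
  \<open>X\<close> and \<open>X^2\<close> in the cell coordinate: partition of unity and
  reproduction of degrees one and two.\<close>

lemma spline_coef_moments:
  assumes "moment_weights h \<sigma> \<sigma>' \<xi> \<eta>"
  shows "(\<lambda>c. \<Sum>r\<in>stencil. 1 * spline_coef \<sigma> \<sigma>' r c) = (\<lambda>c. if c = 0 then 1 else 0)" (is ?P1)
    and "(\<lambda>c. \<Sum>r\<in>stencil. \<xi> r * spline_coef \<sigma> \<sigma>' r c) = (\<lambda>c. if c = 1 then h / 2 else 0)" (is ?P2)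
    and "(\<lambda>c. \<Sum>r\<in>stencil. \<eta> r * spline_coef \<sigma> \<sigma>' r c) = (\<lambda>c. if c = 2 then h\<^sup>2 / 4 else 0)" (is ?P3)
proof -
  have x: "\<sigma> * \<xi> (- 1) = - h / 2" "\<xi> 0 = 0" "\<sigma>' * \<xi> 1 = h / 2"
    and e: "\<sigma> * \<eta> (- 1) = h\<^sup>2 / 2 + \<sigma> * \<eta> 0" "\<eta> 0 = - h\<^sup>2 / 4" "\<sigma>' * \<eta> 1 = h\<^sup>2 / 2 + \<sigma>' * \<eta> 0"
    using assms unfolding moment_weights_def by (simp_all add: algebra_simps)
  show ?P1
    unfolding sum_stencil by (auto simp: fun_eq_iff spline_coef_def field_simps)
  have "\<xi> (- 1) * spline_coef \<sigma> \<sigma>' (- 1) c = (\<sigma> * \<xi> (- 1)) * (if c = 0 then 1 / 4 else if c = 1 then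
      - 1 / 2 else if c = 2 then 1 / 4 else 0)"
    "\<xi> 1 * spline_coef \<sigma> \<sigma>' 1 c = (\<sigma>' * \<xi> 1) * (if c = 0 then 1 / 4 else if c = 1 then 1 / 2 else if c
        = 2 then 1 / 4 else 0)" for c
    by (simp_all add: spline_coef_def)
  then show ?P2
    unfolding sum_stencil x by (auto simp: fun_eq_iff)
  have m: "\<eta> (- 1) * spline_coef \<sigma> \<sigma>' (- 1) c
      = (h\<^sup>2 / 2 + \<sigma> * \<eta> 0) * (if c = 0 then 1 / 4 else if c = 1 then - 1 / 2 else if c = 2 then 1 / 4 else 0)"
    "\<eta> 1 * spline_coef \<sigma> \<sigma>' 1 c
      = (h\<^sup>2 / 2 + \<sigma>' * \<eta> 0) * (if c = 0 then 1 / 4 else if c = 1 then 1 / 2 else if c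
          = 2 then 1 / 4 else 0)" for c
    unfolding e(1)[symmetric] e(3)[symmetric] by (simp_all add: spline_coef_def)
  show ?P3
    unfolding sum_stencil m e(2) by (rule ext) (simp add: spline_coef_def field_simps)
qed

text \<open>B-spline coefficients of the quadratic polynomial with these derivatives at the cell
  centre; the coefficient of \<open>X Y\<close> is the product of the univariate ones.\<close>

definition quadratic_coef ::
  "(int \<Rightarrow> real) \<Rightarrow> (int \<Rightarrow> real) \<Rightarrow> (int \<Rightarrow> real) \<Rightarrow> (int \<Rightarrow> real) \<Rightarrow>
    real \<Rightarrow> real \<Rightarrow> real \<Rightarrow> real \<Rightarrow> real \<Rightarrow> real \<Rightarrow> int \<Rightarrow> int \<Rightarrow> real" where
  "quadratic_coef \<xi> \<eta> \<zeta> \<theta> f0 fx fy fxx fxy fyy r r' =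
     f0 + fx * \<xi> r + fy * \<zeta> r' + fxx / 2 * \<eta> r + fxy * \<xi> r * \<zeta> r' + fyy / 2 * \<theta> r'"

text \<open>Every monomial of degree at most two is a product of univariate moments, so the stencil
  evaluates the form on single monomials. The factors \<open>h^2 / 4\<close>,
  \<open>h * k / 4\<close>, \<open>k^2 / 4\<close> convert derivatives to cell coordinates.\<close>

lemma quadratic_reproduction:
  fixes f0 fx fy fxx fxy fyy :: real
  assumes X: "moment_weights h \<sigma> \<sigma>' \<xi> \<eta>" and Y: "moment_weights k \<tau> \<tau>' \<zeta> \<theta>"
  defines "L \<equiv> quadratic_coef \<xi> \<eta> \<zeta> \<theta> f0 fx fy fxx fxy fyy"
  shows "stencil_form L (tri_ss p q) \<sigma> \<sigma>' \<tau> \<tau>' = fxx * (h\<^sup>2 / 4)" (is ?P1)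
    and "stencil_form L (tri_st p q) \<sigma> \<sigma>' \<tau> \<tau>' = fxy * (h * k / 4)" (is ?P2)
    and "stencil_form L (tri_tt p q) \<sigma> \<sigma>' \<tau> \<tau>' = fyy * (k\<^sup>2 / 4)" (is ?P3)
proof -
  have split: "stencil_form L F \<sigma> \<sigma>' \<tau> \<tau>'
    = f0 * F (\<lambda>c. if c = 0 then 1 else 0) (\<lambda>c. if c = 0 then 1 else 0)
     + fx * F (\<lambda>c. if c = 1 then h / 2 else 0) (\<lambda>c. if c = 0 then 1 else 0)
     + fy * F (\<lambda>c. if c = 0 then 1 else 0) (\<lambda>c. if c = 1 then k / 2 else 0)
     + fxx / 2 * F (\<lambda>c. if c = 2 then h\<^sup>2 / 4 else 0) (\<lambda>c. if c = 0 then 1 else 0)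
     + fxy * F (\<lambda>c. if c = 1 then h / 2 else 0) (\<lambda>c. if c = 1 then k / 2 else 0)
     + fyy / 2 * F (\<lambda>c. if c = 0 then 1 else 0) (\<lambda>c. if c = 2 then k\<^sup>2 / 4 else 0)"
    if F: "bilinear_form F" for F
  proof -
    have bs: "F (\<lambda>c. \<Sum>i\<in>stencil. \<alpha> i * spline_coef \<sigma> \<sigma>' i c) (\<lambda>c. \<Sum>j\<in>stencil. \<beta> j * spline_coef \<tau> \<tau>' j c)
       = (\<Sum>i\<in>stencil. \<Sum>j\<in>stencil. \<alpha> i * \<beta> j * F (spline_coef \<sigma> \<sigma>' i) (spline_coef \<tau> \<tau>' j))" for \<alpha> \<beta>
      by (rule bilinear_form_sum[OF F]) auto
    note m = spline_coef_moments[OF X] spline_coef_moments[OF Y]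
    note q = bs[of "\<lambda>_. 1" "\<lambda>_. 1", unfolded m] bs[of \<xi> "\<lambda>_. 1", unfolded m] bs[of "\<lambda>_. 1" \<zeta>, unfolded m]
      bs[of \<eta> "\<lambda>_. 1", unfolded m] bs[of \<xi> \<zeta>, unfolded m] bs[of "\<lambda>_. 1" \<theta>, unfolded m]
    show ?thesis
      unfolding q L_def quadratic_coef_def sum_distrib_left sum.distrib[symmetric]
      by (intro sum.cong refl) (simp add: algebra_simps)
  qed
  show ?P1
    unfolding split[OF bilinear_form_cell(2)] by (simp add: tri_ss_def)
  show ?P2
    unfolding split[OF bilinear_form_cell(3)] by (simp add: tri_st_def)
  show ?P3
    unfolding split[OF bilinear_form_cell(4)] by (simp add: tri_tt_def)
qed

section \<open>B-splines of the partition with repeated end knots\<close>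

lemma partition_of_strict: "partition_of a b m x \<Longrightarrow> k \<in> {1..m} \<Longrightarrow> x (k - 1) < x k"
  by (simp add: partition_of_def)

lemma partition_of_le:
  assumes "partition_of a b m x" "k \<in> {0..m + 1}"
  shows "x (k - 1) \<le> x k"
proof -
  consider "k = 0" | "k = m + 1" | "k \<in> {1..m}" using assms(2) by fastforce
  then show ?thesis
  proof cases
    case 3 then show ?thesis using partition_of_strict[OF assms(1) 3] by simp
  qed (use assms(1) in \<open>auto simp: partition_of_def\<close>)
qed

lemma partition_of_mono:
  assumes x: "partition_of a b m x" and rs: "- 1 \<le> r" "r \<le> s" "s \<le> m + 1"
  shows "x r \<le> x s"
proof -
  have "s \<le> m + 1 \<longrightarrow> x r \<le> x s"
    using rs(2)
  proof (induction s rule: int_ge_induct)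
    case (step s)
    show ?case
    proof
      assume "s + 1 \<le> m + 1"
      then have "x (s + 1 - 1) \<le> x (s + 1)" using rs(1) step(1) by (intro partition_of_le[OF x]) auto
      then show "x r \<le> x (s + 1)" using step \<open>s + 1 \<le> m + 1\<close> by auto
    qed
  qed simp
  then show ?thesis using rs by simp
qed

lemma partition_of_range:
  assumes "partition_of a b m x" "r \<in> {- 1..m + 1}"
  shows "x r \<in> {a..b}"
  using partition_of_mono[OF assms(1), of "- 1" r] partition_of_mono[OF assms(1), of r "m + 1"] assms
  by (auto simp: partition_of_def)

lemma extended_knots_increasing: "extended_knots m x u \<Longrightarrow> increasing_knots m u"
  by (simp add: extended_knots_def increasing_knots_def)

text \<open>The matrix \<open>bcoeff\<close> trades the simple outer knots for repeated end knots.
  In the first and last cell it changes the ratio to the outer neighbour into 1, its value for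
  \<open>x (- 1) = x 0\<close> and \<open>x (m + 1) = x m\<close>, so the choice of the extended
  knots drops out.\<close>

lemma bcoeff_local_coef:
  assumes x: "partition_of a b m x" and u: "extended_knots m x u" and i: "i \<in> {0..m + 1}" and k: "k \<in> {1..m}"
  shows "(\<lambda>c. \<Sum>p=0..m + 1. bcoeff m x u i p * local_coef u p k c) = local_coef x i k"
proof
  fix c :: int
  have m: "1 \<le> m" using x by (simp add: partition_of_def)
  have ux: "u r = x r" if "0 \<le> r" "r \<le> m" for r using u that by (simp add: extended_knots_def)
  define L where "L = (if c = 0 then 1 / 4 else if c = 1 then - 1 / 2 else if c = 2 then 1 / 4 else
      (0 :: real))"
  define R where "R = (if c = 0 then 1 / 4 else if c = 1 then 1 / 2 else if c = 2 then 1 / 4 else (0 :: real))"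
  define d where "d = (if c = 0 then 1 else (0 :: real))"
  \<comment> \<open>Partition of unity: the middle piece is 1 minus the contributions of the two
    neighbours, so everything is linear in \<open>L\<close> and \<open>R\<close>.\<close>
  have sc: "spline_coef \<sigma> \<sigma>' r c = (if r = - 1 then \<sigma> * L else if r = 1 then \<sigma>' * R else if r = 0 then d
      - \<sigma> * L - \<sigma>' * R else 0)" for \<sigma> \<sigma>' r
    by (simp add: spline_coef_def L_def R_def d_def field_simps)
  define \<sigma> where "\<sigma> = ratio_left u k"
  define \<sigma>' where "\<sigma>' = ratio_right u k"
  \<comment> \<open>Inside the partition the classical B-spline of index 0 is felt only in cell 1:
    its entry in row 0 rescales \<sigma> to 1, and its entry in row 1 takes the missing
    \<open>1 - \<sigma>\<close> away from the neighbour.\<close>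
  have left1: "ratio_left x k = 1" "(step u 0 + step x 1) / step x 1 * \<sigma> = 1" "step u 0 / step x 1 * \<sigma> = 1
      - \<sigma>" if "k = 1"
  proof -
    have "u (- 1) < u 0" "x 0 < x 1" "x (- 1) = x 0"
      using u x m by (auto simp: extended_knots_def partition_of_def dest: bspec[of _ _ 0] bspec[of _ _ 1])
    moreover have "u 0 = x 0" "u 1 = x 1" using ux m by auto
    moreover define p h where "p = x 0 - u (- 1)" and "h = x 1 - x 0"
    ultimately have "p > 0" "h > 0" and e: "ratio_left x k = h / h" "step u 0 = p" "step x 1 = h" "\<sigma> = h / (p
        + h)"
      using that by (auto simp: ratio_left_def \<sigma>_def step_def)
    moreover from this have "p + h \<noteq> 0" by linarith
    ultimately show "ratio_left x k = 1" "(step u 0 + step x 1) / step x 1 * \<sigma> = 1" "step u 0 / step x 1 * \<sigma>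
        = 1 - \<sigma>"
      unfolding e by (simp_all add: divide_simps) (simp_all add: algebra_simps)?
  qed
  have left2: "ratio_left x k = \<sigma>" if "k \<noteq> 1"
    using that k by (simp add: ratio_left_def \<sigma>_def ux)
  have right1: "ratio_right x k = 1" "(step x m + step u (m + 1)) / step x m * \<sigma>' = 1" "step u (m
      + 1) / step x m * \<sigma>' = 1 - \<sigma>'" if "k = m"
  proof -
    have "u m < u (m + 1)" "x (m - 1) < x m" "x (m + 1) = x m"
      using u x m by (auto simp: extended_knots_def partition_of_def dest: bspec[of _ _ "m
          + 1"] bspec[of _ _ m])
    moreover have "u m = x m" "u (m - 1) = x (m - 1)" using ux m by auto
    moreover define p h where "p = u (m + 1) - x m" and "h = x m - x (m - 1)"
    ultimately have "p > 0" "h > 0" and e: "ratio_right x k = h / h" "step u (m + 1) = p" "step x m = h" "\<sigma>'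
        = h / (h + p)"
      using that by (auto simp: ratio_right_def \<sigma>'_def step_def)
    moreover from this have "h + p \<noteq> 0" by linarith
    ultimately show "ratio_right x k = 1" "(step x m + step u (m + 1)) / step x m * \<sigma>' = 1" "step u (m
        + 1) / step x m * \<sigma>' = 1 - \<sigma>'"
      unfolding e by (simp_all add: divide_simps) (simp_all add: algebra_simps)?
  qed
  have right2: "ratio_right x k = \<sigma>'" if "k \<noteq> m"
    using that k by (simp add: ratio_right_def \<sigma>'_def ux)
  have set: "{0..m + 1} = insert 0 (insert (m + 1) {1..m})" using m by auto
  define F where "F = (\<lambda>p. local_coef u p k c)"
  have "(\<Sum>p=0..m + 1. bcoeff m x u i p * F p) = bcoeff m x u i 0 * F 0 + bcoeff m x u i (m + 1) * F (m + 1)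
     + (\<Sum>p=1..m. bcoeff m x u i p * F p)"
    unfolding set using m by simp
  also have "(\<Sum>p=1..m. bcoeff m x u i p * F p) = (\<Sum>p=1..m. if p = i then F p else 0)"
    by (rule sum.cong) (auto simp: bcoeff_def)
  also have "\<dots> = (if i \<in> {1..m} then F i else 0)" by simp
  also have "bcoeff m x u i 0 * F 0 + bcoeff m x u i (m + 1) * F (m + 1) + (if i \<in> {1..m} then F i else 0)
      = local_coef x i k c"
  proof -
    have F0: "F 0 = (if k = 1 then \<sigma> * L else 0)"
      using k by (auto simp: F_def local_coef_def sc \<sigma>_def)
    have Fm: "F (m + 1) = (if k = m then \<sigma>' * R else 0)"
      using k by (auto simp: F_def local_coef_def sc \<sigma>'_def)
    have Fi: "F i = spline_coef \<sigma> \<sigma>' (i - k) c" by (simp add: F_def local_coef_def \<sigma>_def \<sigma>'_def)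
    have b0: "bcoeff m x u i 0 * F 0 = (if k = 1 then (if i = 0 then L else if i = 1 then - (1
        - \<sigma>) * L else 0) else 0)"
      using left1 m unfolding F0 by (auto simp: bcoeff_def mult.assoc[symmetric] simp del: times_divide_eq_left)
    have bm: "bcoeff m x u i (m + 1) * F (m + 1) = (if k = m then (if i = m + 1 then R else if i = m then - (1
        - \<sigma>') * R else 0) else 0)"
      using right1 m unfolding Fm by (auto simp: bcoeff_def mult.assoc[symmetric] simp del:
          times_divide_eq_left)
    have lx: "local_coef x i k c = spline_coef (if k = 1 then 1 else \<sigma>) (if k = m then 1 else \<sigma>') (i - k) c"
      using left1(1) left2 right1(1) right2 by (auto simp: local_coef_def)
    consider "i = 0" | "i = m + 1" | "i \<in> {1..m}" using i by fastforce
    then show ?thesis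
    proof cases
      case 1
      then show ?thesis unfolding b0 bm lx sc using k m by auto
    next
      case 2
      then show ?thesis unfolding b0 bm lx sc using k m by auto
    next
      case 3
      then show ?thesis unfolding b0 bm lx Fi sc using k m by (auto simp: algebra_simps)
    qed
  qed
  finally show "(\<Sum>p=0..m + 1. bcoeff m x u i p * local_coef u p k c) = local_coef x i k c"
    unfolding F_def .
qed

lemma cell_coord_cong: "u k = x k \<Longrightarrow> u (k - 1) = x (k - 1) \<Longrightarrow> cell_coord u k = cell_coord x k"
  by (simp add: cell_coord_def fun_eq_iff)

text \<open>The weights are products of one factor per direction, so bilinearity reduces the double
  sum to \<open>bcoeff_local_coef\<close> in each variable.\<close>

lemma bspline_on_cell:
  assumes x: "partition_of a b m x" and y: "partition_of c d n y"
    and u: "extended_knots m x u" and v: "extended_knots n y v"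
    and i: "i \<in> {0..m + 1}" and j: "j \<in> {0..n + 1}" and k: "k \<in> {1..m}" and l: "l \<in> {1..n}"
    and X: "X \<in> {x (k - 1)..x k}" and Y: "Y \<in> {y (l - 1)..y l}"
  shows "bspline m n x y u v i j (X, Y)
    = cell_interp (local_coef x i k) (local_coef y j l) (cell_coord x k X) (cell_coord y l Y)"
proof -
  have uk: "u k = x k" "u (k - 1) = x (k - 1)" using u k by (auto simp: extended_knots_def)
  have vl: "v l = y l" "v (l - 1) = y (l - 1)" using v l by (auto simp: extended_knots_def)
  have B: "classical_bspline m n u v p q (X, Y)
      = cell_interp (local_coef u p k) (local_coef v q l) (cell_coord x k X) (cell_coord y l Y)"
    if p: "p \<in> {0..m + 1}" and q: "q \<in> {0..n + 1}" for p q
    using spline_jet_on_cell[OF extended_knots_increasing[OF u] extended_knots_increasing[OF v] p q, of k l X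
        Y] X Y k l uk vl
    by (simp add: classical_bspline_eq[OF extended_knots_increasing[OF u] extended_knots_increasing[OF v] p q]
        cell_coord_cong[OF uk] cell_coord_cong[OF vl])
  have "bspline m n x y u v i j (X, Y)
      = (\<Sum>p=0..m + 1. \<Sum>q=0..n + 1. bcoeff m x u i p * bcoeff n y v j q *
          cell_interp (local_coef u p k) (local_coef v q l) (cell_coord x k X) (cell_coord y l Y))"
    unfolding bspline_def by (intro sum.cong refl) (simp add: B)
  also have "\<dots> = cell_interp (\<lambda>c. \<Sum>p=0..m + 1. bcoeff m x u i p * local_coef u p k c)
      (\<lambda>c. \<Sum>q=0..n + 1. bcoeff n y v j q * local_coef v q l c) (cell_coord x k X) (cell_coord y l Y)"
    by (rule bilinear_form_sum[OF bilinear_form_cell(1), symmetric]) auto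
  finally show ?thesis
    unfolding bcoeff_local_coef[OF x u i k] bcoeff_local_coef[OF y v j l] .
qed

section \<open>Second derivatives on a triangle and the effect of coefficient errors\<close>

lemma pderiv_x_open:
  assumes U: "open U" "U \<subseteq> S" "(X, Y) \<in> U" and g: "\<And>P. P \<in> U \<Longrightarrow> g P = \<phi> P"
    and D: "((\<lambda>t. \<phi> (t, Y)) has_real_derivative D) (at X)"
  shows "pderiv_x S g (X, Y) = D"
proof -
  have V: "open {t. (t, Y) \<in> U}"
    using open_vimage[OF U(1), of "\<lambda>t. (t, Y)"] by (simp add: vimage_def continuous_intros)
  have "((\<lambda>t. g (t, Y)) has_real_derivative D) (at X)"
    by (rule has_field_derivative_transform_within_open[OF D V]) (use U(3) g in auto)
  moreover have "at X within {t. (t, Y) \<in> S} = at X"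
    by (rule at_within_open_subset[OF _ V]) (use U in auto)
  ultimately show ?thesis
    by (simp add: pderiv_x_def has_real_derivative_iff_has_vector_derivative vector_derivative_at)
qed

lemma pderiv_y_open:
  assumes U: "open U" "U \<subseteq> S" "(X, Y) \<in> U" and g: "\<And>P. P \<in> U \<Longrightarrow> g P = \<phi> P"
    and D: "((\<lambda>t. \<phi> (X, t)) has_real_derivative D) (at Y)"
  shows "pderiv_y S g (X, Y) = D"
proof -
  have V: "open {t. (X, t) \<in> U}"
    using open_vimage[OF U(1), of "\<lambda>t. (X, t)"] by (simp add: vimage_def continuous_intros)
  have "((\<lambda>t. g (X, t)) has_real_derivative D) (at Y)"
    by (rule has_field_derivative_transform_within_open[OF D V]) (use U(3) g in auto)
  moreover have "at Y within {t. (X, t) \<in> S} = at Y"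
    by (rule at_within_open_subset[OF _ V]) (use U in auto)
  ultimately show ?thesis
    by (simp add: pderiv_y_def has_real_derivative_iff_has_vector_derivative vector_derivative_at)
qed

lemma multi_deriv_2:
  "multi_deriv S (2, 0) g = pderiv_x S (pderiv_x S g)" "multi_deriv S (1, 1) g = pderiv_x S (pderiv_y S g)"
  "multi_deriv S (0, 2) g = pderiv_y S (pderiv_y S g)"
  by (simp_all add: multi_deriv_def numeral_2_eq_2)

lemma multi_deriv_quadratic:
  fixes c0 c1 c2 A B C a b c d :: real
  assumes U: "open U" "U \<subseteq> S" "P \<in> U"
    and g: "\<And>X Y. (X, Y) \<in> U \<Longrightarrow> g (X, Y) = c0 + c1 * (a * X - b) + c2 * (c * Y - d)
       + A / 2 * (a * X - b)\<^sup>2 + B * (a * X - b) * (c * Y - d) + C / 2 * (c * Y - d)\<^sup>2"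
  shows "multi_deriv S (2, 0) g P = A * a\<^sup>2" (is ?P1) "multi_deriv S (1, 1) g P = B * (a * c)"
      (is ?P2) "multi_deriv S (0, 2) g P = C * c\<^sup>2" (is ?P3)
proof -
  define q where "q = (\<lambda>(X, Y). c0 + c1 * (a * X - b) + c2 * (c * Y - d)
       + A / 2 * (a * X - b)\<^sup>2 + B * (a * X - b) * (c * Y - d) + C / 2 * (c * Y - d)\<^sup>2)"
  have gq: "g Q = q Q" if "Q \<in> U" for Q using g that by (cases Q) (auto simp: q_def)
  define qx where "qx = (\<lambda>(X, Y). c1 * a + A * a * (a * X - b) + B * a * (c * Y - d))"
  define qy where "qy = (\<lambda>(X, Y). c2 * c + C * c * (c * Y - d) + B * c * (a * X - b))"
  have px: "pderiv_x S g Q = qx Q" if "Q \<in> U" for Q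
  proof -
    obtain X Y where Q: "Q = (X, Y)" by (cases Q)
    show ?thesis unfolding Q
      by (rule pderiv_x_open[OF U(1,2) _ gq]) (use that Q in \<open>auto simp: q_def qx_def power2_eq_square
          algebra_simps intro!: derivative_eq_intros\<close>)
  qed
  have py: "pderiv_y S g Q = qy Q" if "Q \<in> U" for Q
  proof -
    obtain X Y where Q: "Q = (X, Y)" by (cases Q)
    show ?thesis unfolding Q
      by (rule pderiv_y_open[OF U(1,2) _ gq]) (use that Q in \<open>auto simp: q_def qy_def power2_eq_square
          algebra_simps intro!: derivative_eq_intros\<close>)
  qed
  obtain X Y where P: "P = (X, Y)" by (cases P)
  show ?P1
    unfolding multi_deriv_2 P
    by (rule pderiv_x_open[OF U(1,2) _ px]) (use U(3) P in \<open>auto simp: qx_def power2_eq_square intro!: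
        derivative_eq_intros\<close>)
  show ?P2
    unfolding multi_deriv_2 P
    by (rule pderiv_x_open[OF U(1,2) _ py]) (use U(3) P in \<open>auto simp: qy_def intro!: derivative_eq_intros\<close>)
  show ?P3
    unfolding multi_deriv_2 P
    by (rule pderiv_y_open[OF U(1,2) _ py]) (use U(3) P in \<open>auto simp: qy_def power2_eq_square intro!:
        derivative_eq_intros\<close>)
qed

lemma sum_shifted_stencil:
  fixes G :: "int \<Rightarrow> real"
  assumes "k \<in> {1..m}" and z: "\<And>i. i - k \<notin> stencil \<Longrightarrow> G i = 0"
  shows "(\<Sum>i=0..m + 1. G i) = (\<Sum>r\<in>stencil. G (k + r))"
proof -
  have "(\<Sum>i=0..m + 1. G i) = (\<Sum>i\<in>(+) k ` stencil. G i)"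
  proof (rule sum.mono_neutral_right)
    show "\<forall>i\<in>{0..m + 1} - (+) k ` stencil. G i = 0"
      by (intro ballI z) (auto simp: image_iff)
  qed (use assms in auto)
  also have "\<dots> = (\<Sum>r\<in>stencil. G (k + r))"
    by (subst sum.reindex) (auto simp: inj_on_def)
  finally show ?thesis .
qed

lemma sum_cell_stencil:
  assumes F: "bilinear_form F" and k: "k \<in> {1..m}" and l: "l \<in> {1..n}"
  shows "(\<Sum>i=0..m + 1. \<Sum>j=0..n + 1. M i j * F (local_coef x i k) (local_coef y j l))
    = (stencil_form (\<lambda>r r'. M (k + r) (l + r')) F (ratio_left x k) (ratio_right x k) (ratio_left y l)
        (ratio_right y l))"
proof -
  note z = bilinear_form_zero[OF F]
  have "(\<Sum>i=0..m + 1. \<Sum>j=0..n + 1. M i j * F (local_coef x i k) (local_coef y j l))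
    = (\<Sum>r\<in>stencil. \<Sum>j=0..n + 1. M (k + r) j * F (local_coef x (k + r) k) (local_coef y j l))"
    by (rule sum_shifted_stencil[OF k]) (simp add: local_coef_zero z)
  also have "\<dots> = (\<Sum>r\<in>stencil. \<Sum>r'\<in>stencil. M (k + r) (l + r') * F (local_coef x (k + r) k) (local_coef y (l
      + r') l))"
    by (intro sum.cong refl sum_shifted_stencil[OF l]) (simp add: local_coef_zero z)
  finally show ?thesis by (simp only: local_coef_def add_diff_cancel_left')
qed

abbreviation mesh_offset :: "(int \<Rightarrow> real) \<Rightarrow> int \<Rightarrow> int \<Rightarrow> real" where
  "mesh_offset x k \<equiv> \<lambda>r. midpt x (k + r) - midpt x k"

text \<open>The \<open>X^2\<close> coefficient of a quadratic B-spline is the product of its two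
  inner knots, here measured from the centre of cell \<open>k\<close> and rewritten by midpoint and
  half step.\<close>

abbreviation mesh_square :: "(int \<Rightarrow> real) \<Rightarrow> int \<Rightarrow> int \<Rightarrow> real" where
  "mesh_square x k \<equiv> \<lambda>r. (midpt x (k + r) - midpt x k)\<^sup>2 - (step x (k + r))\<^sup>2 / 4"

lemma partition_moment_weights:
  assumes x: "partition_of a b m x" and k: "k \<in> {1..m}"
  shows "moment_weights (step x k) (ratio_left x k) (ratio_right x k) (mesh_offset x k) (mesh_square x k)"
      (is ?P1)
    and "0 \<le> ratio_left x k" "ratio_left x k \<le> 1" "0 \<le> ratio_right x k" "ratio_right x k \<le> 1"
proof -
  have lt: "x (k - 1) < x k" by (rule partition_of_strict[OF x k])
  have le: "x (k - 2) \<le> x (k - 1)" "x k \<le> x (k + 1)"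
    using partition_of_mono[OF x, of "k - 2" "k - 1"] partition_of_mono[OF x, of k "k + 1"] k by auto
  show "0 \<le> ratio_left x k" "ratio_left x k \<le> 1" "0 \<le> ratio_right x k" "ratio_right x k \<le> 1"
    using lt le by (auto simp: ratio_left_def ratio_right_def)
  \<comment> \<open>\<open>D\<close> and \<open>D'\<close> are twice the distances from the centre
    to the midpoints of the neighbouring cells, so ratio times offset is half a step.\<close>
  define D h where "D = x k - x (k - 2)" and "h = x k - x (k - 1)"
  define D' where "D' = x (k + 1) - x (k - 1)"
  have D: "D > 0" "D' > 0" using lt le by (auto simp: D_def D'_def)
  have e: "step x k = h" "ratio_left x k = h / D" "ratio_right x k = h / D'"
    "midpt x (k - 1) - midpt x k = - D / 2" "midpt x (k + 1) - midpt x k = D' / 2"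
    "step x (k - 1) = D - h" "step x (k + 1) = D' - h"
    by (simp_all add: step_def h_def ratio_left_def ratio_right_def D_def D'_def midpt_def field_simps)
  show ?P1
    unfolding moment_weights_def using D by (simp add: e) (simp add: power2_eq_square field_simps)
qed

text \<open>The numbers \<open>f0\<close> to \<open>fyy\<close> are arbitrary. Subtracting the
  coefficients of the quadratic with these derivatives changes the second derivatives by exactly
  \<open>fxx\<close>, \<open>fxy\<close>, \<open>fyy\<close>, so only coefficient differences pass
  through \<open>triangle_bound\<close>.\<close>

lemma spline_deriv_error:
  assumes x: "partition_of a b m x" and y: "partition_of c d n y"
    and u: "extended_knots m x u" and v: "extended_knots n y v"
    and k: "k \<in> {1..m}" and l: "l \<in> {1..n}"
    and T: "T \<in> rect_triangles (x (k - 1)) (x k) (y (l - 1)) (y l)" and P: "P \<in> interior T"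
    and \<delta>: "0 < \<delta>" "\<delta> \<le> step x k" "\<delta> \<le> step y l"
    and E1: "\<And>r r'. r \<in> stencil \<Longrightarrow> r' \<in> stencil \<Longrightarrow> r = 0 \<or> r' = 0 \<Longrightarrow>
       \<bar>M (k + r) (l + r') - quadratic_coef (mesh_offset x k) (mesh_square x k) (mesh_offset y l)
           (mesh_square y l) f0 fx fy fxx fxy fyy r r'\<bar> \<le> E1"
    and E2: "\<And>r r'. r \<in> stencil \<Longrightarrow> r' \<in> stencil \<Longrightarrow>
       \<bar>M (k + r) (l + r') - quadratic_coef (mesh_offset x k) (mesh_square x k) (mesh_offset y l)
           (mesh_square y l) f0 fx fy fxx fxy fyy r r'\<bar> \<le> E2"
    and E: "E1 \<le> E2"
  defines "S \<equiv> \<lambda>P. \<Sum>i=0..m + 1. \<Sum>j=0..n + 1. M i j * bspline m n x y u v i j P"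
  shows "\<bar>fxx - multi_deriv ({a..b} \<times> {c..d}) (2, 0) S P\<bar> \<le> (12 * E1 + 4 * E2) / \<delta>\<^sup>2" (is ?P1)
    and "\<bar>fxy - multi_deriv ({a..b} \<times> {c..d}) (1, 1) S P\<bar> \<le> (12 * E1 + 4 * E2) / \<delta>\<^sup>2" (is ?P2)
    and "\<bar>fyy - multi_deriv ({a..b} \<times> {c..d}) (0, 2) S P\<bar> \<le> (12 * E1 + 4 * E2) / \<delta>\<^sup>2" (is ?P3)
proof -
  let ?L = "quadratic_coef (mesh_offset x k) (mesh_square x k) (mesh_offset y l)
      (mesh_square y l) f0 fx fy fxx fxy fyy"
  have lt: "x (k - 1) < x k" "y (l - 1) < y l" using partition_of_strict x y k l by auto
  note T1 = triangle_signs[of x k y l, OF lt T]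
  obtain p q where pq: "(p, q) \<in> tri_signs" and sg: "\<And>X Y. (X, Y) \<in> T \<Longrightarrow>
      diag_signs p q (cell_coord x k X) (cell_coord y l Y)"
    using T1(2) by blast
  define SS where "SS = (\<lambda>F. \<Sum>i=0..m + 1. \<Sum>j=0..n + 1. M i j * F (local_coef x i k) (local_coef y j l))"
  let ?a = "2 / (x k - x (k - 1))" and ?b = "(x (k - 1) + x k) / (x k - x (k - 1))"
  let ?c = "2 / (y l - y (l - 1))" and ?d = "(y (l - 1) + y l) / (y l - y (l - 1))"
  have quad: "S (X, Y) = SS (\<lambda>\<phi> \<psi>. \<phi> 0 * \<psi> 0 - \<phi> 2 * \<psi> 2) + SS (\<lambda>\<phi> \<psi>. \<phi> 1 * \<psi> 0 - \<phi> 1 * \<psi> 2) * (?a * X - ?b)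
      + SS (\<lambda>\<phi> \<psi>. \<phi> 0 * \<psi> 1 - \<phi> 2 * \<psi> 1) * (?c * Y - ?d) + SS (tri_ss p q) / 2 * (?a * X - ?b)\<^sup>2
      + SS (tri_st p q) * (?a * X - ?b) * (?c * Y - ?d) + SS (tri_tt p q) / 2 * (?c * Y - ?d)\<^sup>2"
    if XY: "(X, Y) \<in> interior T" for X Y
  proof -
    have XT: "(X, Y) \<in> T" using XY interior_subset by blast
    then have XY': "X \<in> {x (k - 1)..x k}" "Y \<in> {y (l - 1)..y l}" using T1(1) by auto
    have "S (X, Y) = (\<Sum>i=0..m + 1. \<Sum>j=0..n + 1. M i j * cell_interp (local_coef x i k) (local_coef y j l)
        (cell_coord x k X) (cell_coord y l Y))"
      unfolding S_def by (intro sum.cong refl) (simp add: bspline_on_cell[OF x y u v _ _ k l XY'])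
    also have "\<dots> = SS (\<lambda>\<phi> \<psi>. \<phi> 0 * \<psi> 0 - \<phi> 2 * \<psi> 2) + SS (\<lambda>\<phi> \<psi>. \<phi> 1 * \<psi> 0 - \<phi> 1 * \<psi> 2) * cell_coord x k X
      + SS (\<lambda>\<phi> \<psi>. \<phi> 0 * \<psi> 1 - \<phi> 2 * \<psi> 1) * cell_coord y l Y + SS (tri_ss p q) / 2 * (cell_coord x k X)\<^sup>2
      + SS (tri_st p q) * cell_coord x k X * cell_coord y l Y + SS (tri_tt p q) / 2 * (cell_coord y l Y)\<^sup>2"
      unfolding SS_def sum_distrib_right sum_divide_distrib sum.distrib[symmetric]
      by (intro sum.cong refl) (simp add: cell_interp_tri[OF conjunct1[OF sg[OF XT]] conjunct2[OF sg[OF XT]]]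
          distrib_left mult.assoc)
    finally show ?thesis unfolding cell_coord_affine .
  qed
  have sub: "interior T \<subseteq> {a..b} \<times> {c..d}"
  proof
    fix Q assume "Q \<in> interior T"
    then have "Q \<in> {x (k - 1)..x k} \<times> {y (l - 1)..y l}" using T1(1) interior_subset by blast
    moreover have "x (k - 1) \<in> {a..b}" "x k \<in> {a..b}" "y (l - 1) \<in> {c..d}" "y l \<in> {c..d}"
      using k l by (auto intro!: partition_of_range[OF x] partition_of_range[OF y] simp del: atLeastAtMost_iff)
          auto
    ultimately show "Q \<in> {a..b} \<times> {c..d}" by (auto simp: mem_Times_iff)
  qed
  have md: "multi_deriv ({a..b} \<times> {c..d}) (2, 0) S P = SS (tri_ss p q) * ?a\<^sup>2"
    "multi_deriv ({a..b} \<times> {c..d}) (1, 1) S P = SS (tri_st p q) * (?a * ?c)"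
    "multi_deriv ({a..b} \<times> {c..d}) (0, 2) S P = SS (tri_tt p q) * ?c\<^sup>2"
    by (rule multi_deriv_quadratic[OF open_interior sub P quad]; assumption)+
  note mx = partition_moment_weights[OF x k] and my = partition_moment_weights[OF y l]
  have bound: "\<bar>SS F - (stencil_form ?L F (ratio_left x k) (ratio_right x k) (ratio_left y l)
      (ratio_right y l))\<bar> \<le> 3 * E1 + E2"
    if F: "F \<in> {tri_ss p q, tri_st p q, tri_tt p q}" for F
  proof -
    have "bilinear_form F" using F bilinear_form_cell by auto
    then have "SS F - (stencil_form ?L F (ratio_left x k) (ratio_right x k) (ratio_left y l) (ratio_right y l))
       = (stencil_form (\<lambda>r r'. M (k + r) (l + r') - ?L r r') F (ratio_left x k) (ratio_right x k)
           (ratio_left y l) (ratio_right y l))"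
      unfolding SS_def by (subst sum_cell_stencil[OF _ k l]) (simp_all only: sum_subtractf left_diff_distrib)
    moreover have "\<bar>\<dots>\<bar> \<le> 3 * E1 + E2"
      by (rule triangle_bound[OF pq mx(2-5) my(2-5) E1 E2 E F])
    ultimately show ?thesis by (simp only:)
  qed
  \<comment> \<open>The chain rule contributes \<open>4 / (h * h')\<close>, at most
    \<open>4 / \<delta>^2\<close>; hence four times the bound \<open>3 * E1 + E2\<close>.\<close>
  have scale: "\<bar>g - A * (2 / h * (2 / h'))\<bar> \<le> (12 * E1 + 4 * E2) / \<delta>\<^sup>2"
    if "\<bar>A - g * (h * h' / 4)\<bar> \<le> 3 * E1 + E2" "\<delta> \<le> h" "\<delta> \<le> h'" for g A h h' :: real
  proof -
    have hh: "\<delta>\<^sup>2 \<le> h * h'" "0 < h" "0 < h'" using that \<delta> by (auto simp: power2_eq_square intro!: mult_mono)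
    have "\<bar>g - A * (2 / h * (2 / h'))\<bar> = \<bar>A - g * (h * h' / 4)\<bar> * (4 / (h * h'))"
    proof -
      have "g - A * (2 / h * (2 / h')) = - ((A - g * (h * h' / 4)) * (4 / (h * h')))"
        using hh by (simp add: field_simps)
      then show ?thesis using hh by (simp only: abs_minus_cancel abs_mult) simp
    qed
    also have "\<dots> \<le> (3 * E1 + E2) * (4 / \<delta>\<^sup>2)"
      using that hh \<delta> by (intro mult_mono divide_left_mono) (auto intro: order_trans[OF abs_ge_zero])
    finally show ?thesis by (simp add: field_simps)
  qed
  show ?P1
    using scale[of "SS (tri_ss p q)" fxx "step x k" "step x k"] bound[of "tri_ss p q"] \<delta>
    unfolding md quadratic_reproduction[OF mx(1) my(1)] by (simp add: step_def power2_eq_square)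
  show ?P2
    using scale[of "SS (tri_st p q)" fxy "step x k" "step y l"] bound[of "tri_st p q"] \<delta>
    unfolding md quadratic_reproduction[OF mx(1) my(1)] by (simp add: step_def)
  show ?P3
    using scale[of "SS (tri_tt p q)" fyy "step y l" "step y l"] bound[of "tri_tt p q"] \<delta>
    unfolding md quadratic_reproduction[OF mx(1) my(1)] by (simp add: step_def power2_eq_square)
qed

subsection \<open>Taylor expansions on a rectangle\<close>

text \<open>By the mean value theorem, \<open>C |t - x0|^(n+1) / (n+1)\<close> minus or plus
  \<open>g\<close> is no smaller at \<open>X\<close> than at \<open>x0\<close>; the sign
  \<open>s\<close> covers both halves of the absolute value.\<close>

lemma growth_bound:
  fixes g g' :: "real \<Rightarrow> real"
  assumes D: "\<And>t. t \<in> {a..b} \<Longrightarrow> (g has_real_derivative g' t) (at t within {a..b})"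
    and x0: "x0 \<in> {a..b}" and X: "X \<in> {a..b}"
    and B: "\<And>t. t \<in> {a..b} \<Longrightarrow> \<bar>t - x0\<bar> \<le> \<bar>X - x0\<bar> \<Longrightarrow> \<bar>g' t\<bar> \<le> C * \<bar>t - x0\<bar> ^ n"
  shows "\<bar>g X - g x0\<bar> \<le> C * \<bar>X - x0\<bar> ^ Suc n / Suc n"
proof -
  have pow1: "((\<lambda>t. (t - x0) ^ Suc n) has_real_derivative real (Suc n) * (1 * (t - x0) ^ n)) (at t within A)"
    and pow2: "((\<lambda>t. (x0 - t) ^ Suc n) has_real_derivative real (Suc n) * (- 1 * (x0 - t) ^ n))
        (at t within A)" for t A
    using DERIV_power[where f = "\<lambda>t. t - x0" and n = "Suc n", of 1 t A]
      DERIV_power[where f = "\<lambda>t. x0 - t" and n = "Suc n", of "- 1" t A]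
    by (auto intro!: derivative_eq_intros simp del: power_Suc of_nat_Suc)
  have main: "s * (g X - g x0) \<le> C * \<bar>X - x0\<bar> ^ Suc n / Suc n" if s: "s \<in> {- 1, 1}" for s
  proof (cases X x0 rule: linorder_cases)
    case equal then show ?thesis by simp
  next
    case greater
    define \<phi> where "\<phi> = (\<lambda>t. C * (t - x0) ^ Suc n / Suc n - s * g t)"
    have "(\<phi> has_derivative (*) (C * (t - x0) ^ n - s * g' t)) (at t within {x0..X})" if t: "x0 \<le> t" "t
        \<le> X" for t
    proof -
      have "(g has_real_derivative g' t) (at t within {x0..X})"
        by (rule DERIV_subset[OF D]) (use t x0 X in auto)
      from DERIV_diff[OF DERIV_cdivide[OF DERIV_cmult[OF pow1]] DERIV_cmult[OF this]]
      have "(\<phi> has_real_derivative C * (t - x0) ^ n - s * g' t) (at t within {x0..X})"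
        unfolding \<phi>_def by (rule DERIV_cong) (simp del: of_nat_Suc power_Suc)
      then show ?thesis by (simp only: has_field_derivative_def)
    qed
    from mvt_simple[OF greater this] obtain t where t: "x0 < t" "t < X"
      and e: "\<phi> X - \<phi> x0 = (C * (t - x0) ^ n - s * g' t) * (X - x0)" by auto
    have "\<bar>g' t\<bar> \<le> C * (t - x0) ^ n" using B[of t] t x0 X by auto
    then have "s * g' t \<le> C * (t - x0) ^ n" using s by auto
    then have "\<phi> X - \<phi> x0 \<ge> 0" unfolding e using t by (intro mult_nonneg_nonneg) auto
    then show ?thesis using greater by (simp add: \<phi>_def right_diff_distrib)
  next
    case less
    define \<phi> where "\<phi> = (\<lambda>t. C * (x0 - t) ^ Suc n / Suc n - s * g t)"
    have "(\<phi> has_derivative (*) (- (C * (x0 - t) ^ n) - s * g' t)) (at t within {X..x0})" if t: "X \<le> t" "t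
        \<le> x0" for t
    proof -
      have "(g has_real_derivative g' t) (at t within {X..x0})"
        by (rule DERIV_subset[OF D]) (use t x0 X in auto)
      from DERIV_diff[OF DERIV_cdivide[OF DERIV_cmult[OF pow2]] DERIV_cmult[OF this]]
      have "(\<phi> has_real_derivative - (C * (x0 - t) ^ n) - s * g' t) (at t within {X..x0})"
        unfolding \<phi>_def by (rule DERIV_cong) (simp del: of_nat_Suc power_Suc)
      then show ?thesis by (simp only: has_field_derivative_def)
    qed
    from mvt_simple[OF less this] obtain t where t: "X < t" "t < x0"
      and e: "\<phi> x0 - \<phi> X = (- (C * (x0 - t) ^ n) - s * g' t) * (x0 - X)" by auto
    have "\<bar>g' t\<bar> \<le> C * (x0 - t) ^ n" using B[of t] t x0 X by auto
    then have "- (s * g' t) \<le> C * (x0 - t) ^ n" using s by auto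
    then have "\<phi> x0 - \<phi> X \<le> 0" unfolding e using t by (intro mult_nonpos_nonneg) auto
    then show ?thesis using less by (simp add: \<phi>_def right_diff_distrib)
  qed
  show ?thesis using main[of 1] main[of "- 1"] by (simp add: abs_le_iff)
qed

lemma taylor_1:
  fixes g g' :: "real \<Rightarrow> real"
  assumes D: "\<And>t. t \<in> {a..b} \<Longrightarrow> (g has_real_derivative g' t) (at t within {a..b})"
    and x0: "x0 \<in> {a..b}" and X: "X \<in> {a..b}"
    and B: "\<And>t. t \<in> {a..b} \<Longrightarrow> \<bar>t - x0\<bar> \<le> \<bar>X - x0\<bar> \<Longrightarrow> \<bar>g' t - A\<bar> \<le> C"
  shows "\<bar>g X - g x0 - A * (X - x0)\<bar> \<le> C * \<bar>X - x0\<bar>"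
proof -
  have "\<bar>(g X - A * X) - (g x0 - A * x0)\<bar> \<le> C * \<bar>X - x0\<bar> ^ Suc 0 / real (Suc 0)"
    by (rule growth_bound[where g' = "\<lambda>t. g' t - A", OF _ x0 X])
        (use B in \<open>auto intro!: derivative_eq_intros D\<close>)
  then show ?thesis by (simp add: algebra_simps)
qed

text \<open>The reference value \<open>A\<close> may differ from \<open>g'' x0\<close>: the
  oscillation can be measured against a second derivative taken at another point, as needed for
  expansions along a broken path.\<close>

lemma taylor_2:
  fixes g g' g'' :: "real \<Rightarrow> real"
  assumes D: "\<And>t. t \<in> {a..b} \<Longrightarrow> (g has_real_derivative g' t) (at t within {a..b})"
    and D': "\<And>t. t \<in> {a..b} \<Longrightarrow> (g' has_real_derivative g'' t) (at t within {a..b})"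
    and x0: "x0 \<in> {a..b}" and X: "X \<in> {a..b}"
    and B: "\<And>t. t \<in> {a..b} \<Longrightarrow> \<bar>t - x0\<bar> \<le> \<bar>X - x0\<bar> \<Longrightarrow> \<bar>g'' t - A\<bar> \<le> C"
  shows "\<bar>g X - g x0 - g' x0 * (X - x0) - A / 2 * (X - x0)\<^sup>2\<bar> \<le> C * (X - x0)\<^sup>2 / 2"
proof -
  have 1: "\<bar>g' t - g' x0 - A * (t - x0)\<bar> \<le> C * \<bar>t - x0\<bar> ^ 1" if "t \<in> {a..b}" "\<bar>t - x0\<bar> \<le> \<bar>X - x0\<bar>" for t
    using taylor_1[OF D' x0 that(1), of A C] B that(2) by auto
  have "\<bar>(g X - g' x0 * (X - x0) - A / 2 * (X - x0)\<^sup>2) - (g x0 - g' x0 * (x0 - x0) - A / 2 * (x0 - x0)\<^sup>2)\<bar>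
      \<le> C * \<bar>X - x0\<bar> ^ Suc 1 / real (Suc 1)"
    by (rule growth_bound[where g' = "\<lambda>t. g' t - g' x0 - A * (t - x0)", OF _ x0 X 1])
       (auto intro!: derivative_eq_intros D simp: field_simps)
  then show ?thesis by (simp add: algebra_simps power2_eq_square[symmetric])
qed

lemma taylor_3:
  fixes g g' g'' g''' :: "real \<Rightarrow> real"
  assumes D: "\<And>t. t \<in> {a..b} \<Longrightarrow> (g has_real_derivative g' t) (at t within {a..b})"
    and D': "\<And>t. t \<in> {a..b} \<Longrightarrow> (g' has_real_derivative g'' t) (at t within {a..b})"
    and D'': "\<And>t. t \<in> {a..b} \<Longrightarrow> (g'' has_real_derivative g''' t) (at t within {a..b})"
    and x0: "x0 \<in> {a..b}" and X: "X \<in> {a..b}" and B: "\<And>t. t \<in> {a..b} \<Longrightarrow> \<bar>g''' t\<bar> \<le> N"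
  shows "\<bar>g X - g x0 - g' x0 * (X - x0) - g'' x0 / 2 * (X - x0)\<^sup>2\<bar> \<le> N * \<bar>X - x0\<bar> ^ 3 / 6"
proof -
  have 1: "\<bar>g' t - g' x0 - g'' x0 * (t - x0)\<bar> \<le> N / 2 * \<bar>t - x0\<bar> ^ 2" if "t \<in> {a..b}" for t
    using taylor_2[OF D' D'' x0 that, of 0 N] B by auto
  have "\<bar>(g X - g' x0 * (X - x0) - g'' x0 / 2 * (X - x0)\<^sup>2) - (g x0 - g' x0 * (x0 - x0) - g'' x0 / 2 * (x0
      - x0)\<^sup>2)\<bar>
      \<le> N / 2 * \<bar>X - x0\<bar> ^ Suc 2 / real (Suc 2)"
    by (rule growth_bound[where g' = "\<lambda>t. g' t - g' x0 - g'' x0 * (t - x0)", OF _ x0 X 1])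
       (auto intro!: derivative_eq_intros D simp: field_simps)
  then show ?thesis by (simp add: algebra_simps numeral_3_eq_3 numeral_2_eq_2)
qed

lemma C_k_on_pderiv_x:
  assumes "C_k_on (Suc k) ({a..b} \<times> {c..d}) f" "Y \<in> {c..d}" "X \<in> {a..b}"
  shows "((\<lambda>t. f (t, Y)) has_real_derivative pderiv_x ({a..b} \<times> {c..d}) f (X, Y)) (at X within {a..b})"
proof -
  have "{t. (t, Y) \<in> {a..b} \<times> {c..d}} = {a..b}" using assms(2) by auto
  moreover have "(\<lambda>t. f (t, Y)) differentiable (at X within {t. (t, Y) \<in> {a..b} \<times> {c..d}})"
    using assms by auto
  ultimately show ?thesis
    by (simp add: pderiv_x_def has_real_derivative_iff_has_vector_derivative vector_derivative_works)
qed

lemma C_k_on_pderiv_y: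
  assumes "C_k_on (Suc k) ({a..b} \<times> {c..d}) f" "X \<in> {a..b}" "Y \<in> {c..d}"
  shows "((\<lambda>t. f (X, t)) has_real_derivative pderiv_y ({a..b} \<times> {c..d}) f (X, Y)) (at Y within {c..d})"
proof -
  have "{t. (X, t) \<in> {a..b} \<times> {c..d}} = {c..d}" using assms(2) by auto
  moreover have "(\<lambda>t. f (X, t)) differentiable (at Y within {t. (X, t) \<in> {a..b} \<times> {c..d}})"
    using assms by auto
  ultimately show ?thesis
    by (simp add: pderiv_y_def has_real_derivative_iff_has_vector_derivative vector_derivative_works)
qed

definition taylor_poly :: "(real \<times> real) set \<Rightarrow> (real \<times> real \<Rightarrow> real) \<Rightarrow> real \<times> real \<Rightarrow> real \<times> real \<Rightarrow> real" where
  "taylor_poly S f P0 P =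
     f P0 + pderiv_x S f P0 * (fst P - fst P0) + pderiv_y S f P0 * (snd P - snd P0)
     + multi_deriv S (2, 0) f P0 / 2 * (fst P - fst P0)\<^sup>2 + multi_deriv S (1, 1) f P0 * (fst P - fst P0) *
         (snd P - snd P0)
     + multi_deriv S (0, 2) f P0 / 2 * (snd P - snd P0)\<^sup>2"

lemma multi_indices_2: "multi_indices 2 = {(2, 0), (1, 1), (0, 2)}"
proof -
  have "(i, j) \<in> multi_indices 2 \<longleftrightarrow> (i, j) \<in> {(2, 0), (1, 1), (0, 2)}" for i j :: nat
    unfolding multi_indices_def mem_Collect_eq fst_conv snd_conv insert_iff prod.inject empty_iff by arith
  then show ?thesis by (intro set_eqI) (metis surj_pair)
qed

lemma multi_indices_3: "multi_indices 3 = {(3, 0), (2, 1), (1, 2), (0, 3)}"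
proof -
  have "(i, j) \<in> multi_indices 3 \<longleftrightarrow> (i, j) \<in> {(3, 0), (2, 1), (1, 2), (0, 3)}" for i j :: nat
    unfolding multi_indices_def mem_Collect_eq fst_conv snd_conv insert_iff prod.inject empty_iff by arith
  then show ?thesis by (intro set_eqI) (metis surj_pair)
qed

text \<open>Expanding first along \<open>x\<close> and then along \<open>y\<close> uses mixed derivatives only in the order
  in which \<open>multi_deriv\<close> takes them.\<close>

lemma taylor_C2:
  fixes f :: "real \<times> real \<Rightarrow> real" and a b c d :: real
  defines "S \<equiv> {a..b} \<times> {c..d}"
  assumes f: "C_k_on 2 ({a..b} \<times> {c..d}) f" and P0: "P0 \<in> S" and P: "P \<in> S"
    and B: "\<And>\<alpha> Q. \<lbrakk>\<alpha> \<in> multi_indices 2; Q \<in> S; \<bar>fst Q - fst P0\<bar> \<le> \<bar>fst P - fst P0\<bar>; \<bar>snd Q - snd P0\<bar> \<le> \<bar>snd P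
        - snd P0\<bar>\<rbrakk>
       \<Longrightarrow> \<bar>multi_deriv S \<alpha> f Q - multi_deriv S \<alpha> f P0\<bar> \<le> C"
  shows "\<bar>f P - taylor_poly S f P0 P\<bar> \<le> C / 2 * (\<bar>fst P - fst P0\<bar> + \<bar>snd P - snd P0\<bar>)\<^sup>2"
proof -
  obtain x0 y0 X Y where e: "P0 = (x0, y0)" "P = (X, Y)" by (cases P0, cases P)
  have in0: "x0 \<in> {a..b}" "y0 \<in> {c..d}" "X \<in> {a..b}" "Y \<in> {c..d}" using P0 P by (auto simp: S_def e)
  have f1: "C_k_on 1 ({a..b} \<times> {c..d}) (pderiv_x S f)" "C_k_on 1 ({a..b} \<times> {c..d}) (pderiv_y S f)"
    using f by (auto simp: numeral_2_eq_2 S_def)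
  have f': "C_k_on (Suc 1) ({a..b} \<times> {c..d}) f" using f by (simp add: numeral_2_eq_2)
  note Dx = C_k_on_pderiv_x[OF f', folded S_def] C_k_on_pderiv_x[OF f1(1)[unfolded One_nat_def], folded S_def]
    C_k_on_pderiv_x[OF f1(2)[unfolded One_nat_def], folded S_def]
  note Dy = C_k_on_pderiv_y[OF f', folded S_def] C_k_on_pderiv_y[OF f1(2)[unfolded One_nat_def], folded S_def]
  define dx dy where "dx = X - x0" and "dy = Y - y0"
  \<comment> \<open>\<open>R1\<close> and \<open>R3\<close> are the remainders along the two legs of
    the path, \<open>R2\<close> is that of the \<open>y\<close> derivative along the first
    leg.\<close>
  define R1 where "R1 = f (X, y0) - f (x0, y0) - pderiv_x S f (x0, y0) * dx - multi_deriv S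
      (2, 0) f P0 / 2 * dx\<^sup>2"
  define R2 where "R2 = pderiv_y S f (X, y0) - pderiv_y S f (x0, y0) - multi_deriv S (1, 1) f P0 * dx"
  define R3 where "R3 = f (X, Y) - f (X, y0) - pderiv_y S f (X, y0) * dy - multi_deriv S (0, 2) f P0 / 2 * dy\<^sup>2"
  have 1: "\<bar>R1\<bar> \<le> C * dx\<^sup>2 / 2"
    unfolding R1_def dx_def
    by (rule taylor_2[OF Dx(1) Dx(2) in0(1,3), OF in0(2) _ in0(2)])
       (use B[of "(2, 0)" "(t, y0)" for t] in0 in \<open>auto simp: multi_indices_2 multi_deriv_2 S_def e simp del:
           One_nat_def\<close>)
  have 2: "\<bar>R2\<bar> \<le> C * \<bar>dx\<bar>"
    unfolding R2_def dx_def
    by (rule taylor_1[OF Dx(3) in0(1,3), OF in0(2)])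
       (use B[of "(1, 1)" "(t, y0)" for t] in0 in \<open>auto simp: multi_indices_2 multi_deriv_2 S_def e simp del:
           One_nat_def\<close>)
  have 3: "\<bar>R3\<bar> \<le> C * dy\<^sup>2 / 2"
    unfolding R3_def dy_def
    by (rule taylor_2[OF Dy(1) Dy(2) in0(2,4), OF in0(3) _ in0(3)])
       (use B[of "(0, 2)" "(X, t)" for t] in0 in \<open>auto simp: multi_indices_2 multi_deriv_2 S_def e simp del:
           One_nat_def\<close>)
  have "f P - taylor_poly S f P0 P = R1 + R2 * dy + R3"
    by (simp add: R1_def R2_def R3_def taylor_poly_def e dx_def dy_def algebra_simps)
  also have "\<bar>\<dots>\<bar> \<le> C * dx\<^sup>2 / 2 + C * \<bar>dx\<bar> * \<bar>dy\<bar> + C * dy\<^sup>2 / 2"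
  proof -
    have "\<bar>R2 * dy\<bar> \<le> C * \<bar>dx\<bar> * \<bar>dy\<bar>" using 2 by (simp add: abs_mult mult_right_mono)
    then show ?thesis using 1 3 by linarith
  qed
  \<comment> \<open>The three bounds form a binomial square; this is why the sum of the coordinate
    increments measures the remainder.\<close>
  also have "\<dots> = C / 2 * (\<bar>dx\<bar> + \<bar>dy\<bar>)\<^sup>2" by (simp add: power2_sum field_simps)
  finally show ?thesis by (simp add: e dx_def dy_def)
qed

lemma multi_deriv_3:
  "multi_deriv S (3, 0) g = pderiv_x S (pderiv_x S (pderiv_x S g))" "multi_deriv S (2, 1) g = pderiv_x S
      (pderiv_x S (pderiv_y S g))"
  "multi_deriv S (1, 2) g = pderiv_x S (pderiv_y S (pderiv_y S g))" "multi_deriv S (0, 3) g = pderiv_y S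
      (pderiv_y S (pderiv_y S g))"
  by (simp_all add: multi_deriv_def numeral_2_eq_2 numeral_3_eq_3)

text \<open>The same broken path as for \<open>C^2\<close>; since \<open>R3\<close> uses the second
  \<open>y\<close> derivative at the corner \<open>(X, y0)\<close>, the extra term \<open>R4\<close>
  moves it back to \<open>P0\<close>. The four bounds are the binomial expansion of
  \<open>N / 6 * (|dx| + |dy|)^3\<close>.\<close>

lemma taylor_C3:
  fixes f :: "real \<times> real \<Rightarrow> real" and a b c d :: real
  defines "S \<equiv> {a..b} \<times> {c..d}"
  assumes f: "C_k_on 3 ({a..b} \<times> {c..d}) f" and P0: "P0 \<in> S" and P: "P \<in> S"
    and B: "\<And>\<alpha> Q. \<lbrakk>\<alpha> \<in> multi_indices 3; Q \<in> S\<rbrakk> \<Longrightarrow> \<bar>multi_deriv S \<alpha> f Q\<bar> \<le> N"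
  shows "\<bar>f P - taylor_poly S f P0 P\<bar> \<le> N / 6 * (\<bar>fst P - fst P0\<bar> + \<bar>snd P - snd P0\<bar>) ^ 3"
proof -
  obtain x0 y0 X Y where e: "P0 = (x0, y0)" "P = (X, Y)" by (cases P0, cases P)
  have in0: "x0 \<in> {a..b}" "y0 \<in> {c..d}" "X \<in> {a..b}" "Y \<in> {c..d}" using P0 P by (auto simp: S_def e)
  have f0: "C_k_on (Suc 2) ({a..b} \<times> {c..d}) f" using f by (simp add: numeral_3_eq_3 numeral_2_eq_2)
  have f1: "C_k_on (Suc 1) ({a..b} \<times> {c..d}) (pderiv_x S f)" "C_k_on (Suc 1) ({a..b} \<times> {c..d}) (pderiv_y S f)"
    using f by (auto simp: numeral_3_eq_3 S_def)
  have f2: "C_k_on (Suc 0) ({a..b} \<times> {c..d}) (pderiv_x S (pderiv_x S f))" "C_k_on (Suc 0) ({a..b} \<times> {c..d})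
      (pderiv_x S (pderiv_y S f))"
    "C_k_on (Suc 0) ({a..b} \<times> {c..d}) (pderiv_y S (pderiv_y S f))"
    using f by (auto simp: numeral_3_eq_3 S_def)
  note Dx = C_k_on_pderiv_x[OF f0, folded S_def] C_k_on_pderiv_x[OF f1(1), folded S_def] C_k_on_pderiv_x[OF
      f2(1), folded S_def]
  note Dxy = C_k_on_pderiv_x[OF f1(2), folded S_def] C_k_on_pderiv_x[OF f2(2), folded S_def] C_k_on_pderiv_x[OF
      f2(3), folded S_def]
  note Dy = C_k_on_pderiv_y[OF f0, folded S_def] C_k_on_pderiv_y[OF f1(2), folded S_def] C_k_on_pderiv_y[OF
      f2(3), folded S_def]
  define dx dy where "dx = X - x0" and "dy = Y - y0"
  define R1 where "R1 = f (X, y0) - f (x0, y0) - pderiv_x S f (x0, y0) * dx - multi_deriv S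
      (2, 0) f P0 / 2 * dx\<^sup>2"
  define R2 where "R2 = pderiv_y S f (X, y0) - pderiv_y S f (x0, y0) - multi_deriv S (1, 1) f P0 * dx"
  define R3 where "R3 = f (X, Y) - f (X, y0) - pderiv_y S f (X, y0) * dy - multi_deriv S (0, 2) f
      (X, y0) / 2 * dy\<^sup>2"
  define R4 where "R4 = multi_deriv S (0, 2) f (X, y0) - multi_deriv S (0, 2) f P0"
  have 1: "\<bar>R1\<bar> \<le> N * \<bar>dx\<bar> ^ 3 / 6"
    unfolding R1_def dx_def e multi_deriv_2
    by (rule taylor_3[OF Dx(1) Dx(2) Dx(3) in0(1,3), OF in0(2) _ in0(2) _ in0(2)])
       (use B[of "(3, 0)" "(t, y0)" for t] in0 in \<open>auto simp: multi_indices_3 multi_deriv_3 S_def simp del: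
           One_nat_def\<close>)
  have 2: "\<bar>R2\<bar> \<le> N * dx\<^sup>2 / 2"
    using taylor_2[OF Dxy(1) Dxy(2) in0(1,3), OF in0(2) _ in0(2), of 0 N] B[of "(2, 1)" "(t, y0)" for t] in0
    unfolding R2_def dx_def e multi_deriv_2 by (auto simp: multi_indices_3 multi_deriv_3 S_def simp del:
        One_nat_def)
  have 3: "\<bar>R3\<bar> \<le> N * \<bar>dy\<bar> ^ 3 / 6"
    unfolding R3_def dy_def multi_deriv_2
    by (rule taylor_3[OF Dy(1) Dy(2) Dy(3) in0(2,4), OF in0(3) _ in0(3) _ in0(3)])
       (use B[of "(0, 3)" "(X, t)" for t] in0 in \<open>auto simp: multi_indices_3 multi_deriv_3 S_def simp del:
           One_nat_def\<close>)
  have 4: "\<bar>R4\<bar> \<le> N * \<bar>dx\<bar>"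
    using taylor_1[OF Dxy(3) in0(1,3), OF in0(2), of 0 N] B[of "(1, 2)" "(t, y0)" for t] in0
    unfolding R4_def dx_def e multi_deriv_2 by (auto simp: multi_indices_3 multi_deriv_3 S_def simp del:
        One_nat_def)
  have cube: "N * p ^ 3 / 6 + N * p\<^sup>2 / 2 * q + N * q ^ 3 / 6 + N * p * (q\<^sup>2 / 2) = N / 6 * (p
      + q) ^ 3" for p q :: real
    by (simp add: power3_eq_cube power2_eq_square field_simps)
  have "f P - taylor_poly S f P0 P = R1 + R2 * dy + R3 + R4 * (dy\<^sup>2 / 2)"
    by (simp add: R1_def R2_def R3_def R4_def taylor_poly_def e dx_def dy_def field_simps)
  also have "\<bar>\<dots>\<bar> \<le> N * \<bar>dx\<bar> ^ 3 / 6 + N * dx\<^sup>2 / 2 * \<bar>dy\<bar> + N * \<bar>dy\<bar> ^ 3 / 6 + N * \<bar>dx\<bar> * (dy\<^sup>2 / 2)"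
  proof -
    have "\<bar>R2 * dy\<bar> \<le> N * dx\<^sup>2 / 2 * \<bar>dy\<bar>" unfolding abs_mult by (rule mult_right_mono[OF 2]) simp
    moreover have "\<bar>R4 * (dy\<^sup>2 / 2)\<bar> \<le> N * \<bar>dx\<bar> * (dy\<^sup>2 / 2)" using mult_right_mono[OF 4, of "dy\<^sup>2 / 2"] by
        (simp add: abs_mult)
    ultimately show ?thesis using 1 3 by linarith
  qed
  also have "\<dots> = N * \<bar>dx\<bar> ^ 3 / 6 + N * \<bar>dx\<bar>\<^sup>2 / 2 * \<bar>dy\<bar> + N * \<bar>dy\<bar> ^ 3 / 6 + N * \<bar>dx\<bar> * (\<bar>dy\<bar>\<^sup>2 / 2)" by simp
  also have "\<dots> = N / 6 * (\<bar>dx\<bar> + \<bar>dy\<bar>) ^ 3" by (rule cube)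
  finally show ?thesis by (simp add: e dx_def dy_def)
qed

section \<open>Symmetry of mixed derivatives up to the boundary\<close>

lemma mixed_difference_bound:
  fixes g :: "real \<times> real \<Rightarrow> real" and a b c d :: real
  defines "S \<equiv> {a..b} \<times> {c..d}"
  assumes g: "C_k_on 2 ({a..b} \<times> {c..d}) g" and x: "x0 \<in> {a..b}" "X \<in> {a..b}" and y: "y0 \<in> {c..d}" "Y \<in> {c..d}"
  shows "(\<And>Q. Q \<in> S \<Longrightarrow> \<bar>fst Q - x0\<bar> \<le> \<bar>X - x0\<bar> \<Longrightarrow> \<bar>snd Q - y0\<bar> \<le> \<bar>Y - y0\<bar> \<Longrightarrow>
           \<bar>pderiv_y S (pderiv_x S g) Q - G\<bar> \<le> e) \<Longrightarrow>
      \<bar>g (X, Y) - g (X, y0) - g (x0, Y) + g (x0, y0) - G * (X - x0) * (Y - y0)\<bar> \<le> e * \<bar>X - x0\<bar> * \<bar>Y - y0\<bar>"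
    and "(\<And>Q. Q \<in> S \<Longrightarrow> \<bar>fst Q - x0\<bar> \<le> \<bar>X - x0\<bar> \<Longrightarrow> \<bar>snd Q - y0\<bar> \<le> \<bar>Y - y0\<bar> \<Longrightarrow>
           \<bar>pderiv_x S (pderiv_y S g) Q - G\<bar> \<le> e) \<Longrightarrow>
      \<bar>g (X, Y) - g (X, y0) - g (x0, Y) + g (x0, y0) - G * (X - x0) * (Y - y0)\<bar> \<le> e * \<bar>X - x0\<bar> * \<bar>Y - y0\<bar>"
proof -
  have g0: "C_k_on (Suc 1) ({a..b} \<times> {c..d}) g" using g by (simp add: numeral_2_eq_2)
  have g1: "C_k_on (Suc 0) ({a..b} \<times> {c..d}) (pderiv_x S g)" "C_k_on (Suc 0) ({a..b} \<times> {c..d}) (pderiv_y S g)"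
    using g by (auto simp: numeral_2_eq_2 S_def)
  note Dx = C_k_on_pderiv_x[OF g0, folded S_def] C_k_on_pderiv_x[OF g1(2), folded S_def]
  note Dy = C_k_on_pderiv_y[OF g0, folded S_def] C_k_on_pderiv_y[OF g1(1), folded S_def]
  {
    assume B: "\<And>Q. Q \<in> S \<Longrightarrow> \<bar>fst Q - x0\<bar> \<le> \<bar>X - x0\<bar> \<Longrightarrow> \<bar>snd Q - y0\<bar> \<le> \<bar>Y - y0\<bar> \<Longrightarrow>
           \<bar>pderiv_y S (pderiv_x S g) Q - G\<bar> \<le> e"
    have 1: "\<bar>pderiv_x S g (t, Y) - pderiv_x S g (t, y0) - G * (Y - y0)\<bar> \<le> e * \<bar>Y - y0\<bar>"
      if t: "t \<in> {a..b}" "\<bar>t - x0\<bar> \<le> \<bar>X - x0\<bar>" for t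
      by (rule taylor_1[OF Dy(2)[OF t(1)] y]) (use B[of "(t, z)" for z] t in \<open>auto simp: S_def\<close>)
    have "\<bar>(g (X, Y) - g (X, y0)) - (g (x0, Y) - g (x0, y0)) - G * (Y - y0) * (X - x0)\<bar> \<le> e * \<bar>Y - y0\<bar> * \<bar>X
        - x0\<bar>"
      by (rule taylor_1[OF DERIV_diff[OF Dx(1)[OF y(2)] Dx(1)[OF y(1)]] x 1])
    then show "\<bar>g (X, Y) - g (X, y0) - g (x0, Y) + g (x0, y0) - G * (X - x0) * (Y - y0)\<bar> \<le> e * \<bar>X - x0\<bar> * \<bar>Y
        - y0\<bar>"
      by (simp add: algebra_simps)
  }
  {
    assume B: "\<And>Q. Q \<in> S \<Longrightarrow> \<bar>fst Q - x0\<bar> \<le> \<bar>X - x0\<bar> \<Longrightarrow> \<bar>snd Q - y0\<bar> \<le> \<bar>Y - y0\<bar> \<Longrightarrow>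
           \<bar>pderiv_x S (pderiv_y S g) Q - G\<bar> \<le> e"
    have 1: "\<bar>pderiv_y S g (X, t) - pderiv_y S g (x0, t) - G * (X - x0)\<bar> \<le> e * \<bar>X - x0\<bar>"
      if t: "t \<in> {c..d}" "\<bar>t - y0\<bar> \<le> \<bar>Y - y0\<bar>" for t
      by (rule taylor_1[OF Dx(2)[OF t(1)] x]) (use B[of "(z, t)" for z] t in \<open>auto simp: S_def\<close>)
    have "\<bar>(g (X, Y) - g (x0, Y)) - (g (X, y0) - g (x0, y0)) - G * (X - x0) * (Y - y0)\<bar> \<le> e * \<bar>X - x0\<bar> * \<bar>Y
        - y0\<bar>"
      by (rule taylor_1[OF DERIV_diff[OF Dy(1)[OF x(2)] Dy(1)[OF x(1)]] y 1])
    then show "\<bar>g (X, Y) - g (X, y0) - g (x0, Y) + g (x0, y0) - G * (X - x0) * (Y - y0)\<bar> \<le> e * \<bar>X - x0\<bar> * \<bar>Y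
        - y0\<bar>"
      by (simp add: algebra_simps)
  }
qed

text \<open>Schwarz's theorem on a closed rectangle with one-sided boundary derivatives: divided by
  the product of its sides, the mixed difference over a small rectangle with a corner at
  \<open>P\<close> approximates both orders of differentiation.\<close>

lemma mixed_partials_commute:
  fixes g :: "real \<times> real \<Rightarrow> real" and a b c d :: real
  defines "S \<equiv> {a..b} \<times> {c..d}"
  assumes g: "C_k_on 2 ({a..b} \<times> {c..d}) g" and ab: "a < b" and cd: "c < d" and P: "P \<in> S"
  shows "pderiv_y S (pderiv_x S g) P = pderiv_x S (pderiv_y S g) P"
proof -
  obtain x0 y0 where e: "P = (x0, y0)" by (cases P)
  have in0: "x0 \<in> {a..b}" "y0 \<in> {c..d}" using P by (auto simp: S_def e)
  define G H where "G = pderiv_y S (pderiv_x S g)" and "H = pderiv_x S (pderiv_y S g)"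
  have cont: "continuous_on S G" "continuous_on S H"
    using g by (auto simp: numeral_2_eq_2 S_def G_def H_def)
  \<comment> \<open>\<open>P\<close> may lie on the boundary, so the increment goes to whichever
    side has room; this uses that the interval is not a point.\<close>
  have near: "\<exists>z\<in>{p..q}. z \<noteq> z0 \<and> \<bar>z - z0\<bar> \<le> r" if "p < q" "z0 \<in> {p..q}" "r > 0" for p q z0 r :: real
  proof (cases "z0 < q")
    case True then show ?thesis using that by (intro bexI[of _ "z0 + min r (q - z0)"]) auto
  next
    case False then show ?thesis using that by (intro bexI[of _ "z0 - min r (z0 - p)"]) auto
  qed
  have "\<bar>G P - H P\<bar> \<le> 2 * \<epsilon>" if \<epsilon>: "\<epsilon> > 0" for \<epsilon>
  proof -
    obtain r1 where r1: "r1 > 0" "\<And>Q. Q \<in> S \<Longrightarrow> dist Q P < r1 \<Longrightarrow> dist (G Q) (G P) < \<epsilon>"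
      using cont(1) P \<epsilon> unfolding continuous_on_iff by blast
    obtain r2 where r2: "r2 > 0" "\<And>Q. Q \<in> S \<Longrightarrow> dist Q P < r2 \<Longrightarrow> dist (H Q) (H P) < \<epsilon>"
      using cont(2) P \<epsilon> unfolding continuous_on_iff by blast
    \<comment> \<open>Two coordinate increments of at most \<open>r\<close> give a distance of at
      most \<open>2 * r\<close>, strictly below both radii.\<close>
    define r where "r = min r1 r2 / 3"
    have r: "r > 0" using r1 r2 by (simp add: r_def)
    obtain X where X: "X \<in> {a..b}" "X \<noteq> x0" "\<bar>X - x0\<bar> \<le> r" using near[OF ab in0(1) r] by blast
    obtain Y where Y: "Y \<in> {c..d}" "Y \<noteq> y0" "\<bar>Y - y0\<bar> \<le> r" using near[OF cd in0(2) r] by blast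
    have close: "dist Q P < r1" "dist Q P < r2" if "\<bar>fst Q - x0\<bar> \<le> \<bar>X - x0\<bar>" "\<bar>snd Q - y0\<bar> \<le> \<bar>Y - y0\<bar>" for Q
    proof -
      have "dist Q P \<le> \<bar>fst Q - x0\<bar> + \<bar>snd Q - y0\<bar>"
        unfolding e dist_prod_def dist_real_def using sqrt_sum_squares_le_sum_abs by simp
      also have "\<dots> \<le> 2 * r" using that X(3) Y(3) by linarith
      finally show "dist Q P < r1" "dist Q P < r2" using r1(1) r2(1) by (auto simp: r_def)
    qed
    let ?D = "g (X, Y) - g (X, y0) - g (x0, Y) + g (x0, y0)"
    have 1: "\<bar>?D - G P * (X - x0) * (Y - y0)\<bar> \<le> \<epsilon> * \<bar>X - x0\<bar> * \<bar>Y - y0\<bar>"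
    proof (rule mixed_difference_bound(1)[OF g in0(1) X(1) in0(2) Y(1), folded S_def])
      fix Q assume "Q \<in> S" "\<bar>fst Q - x0\<bar> \<le> \<bar>X - x0\<bar>" "\<bar>snd Q - y0\<bar> \<le> \<bar>Y - y0\<bar>"
      from r1(2)[OF this(1) close(1)[OF this(2,3)]] show "\<bar>pderiv_y S (pderiv_x S g) Q - G P\<bar> \<le> \<epsilon>"
        unfolding dist_real_def G_def by (rule less_imp_le)
    qed
    have 2: "\<bar>?D - H P * (X - x0) * (Y - y0)\<bar> \<le> \<epsilon> * \<bar>X - x0\<bar> * \<bar>Y - y0\<bar>"
    proof (rule mixed_difference_bound(2)[OF g in0(1) X(1) in0(2) Y(1), folded S_def])
      fix Q assume "Q \<in> S" "\<bar>fst Q - x0\<bar> \<le> \<bar>X - x0\<bar>" "\<bar>snd Q - y0\<bar> \<le> \<bar>Y - y0\<bar>"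
      from r2(2)[OF this(1) close(2)[OF this(2,3)]] show "\<bar>pderiv_x S (pderiv_y S g) Q - H P\<bar> \<le> \<epsilon>"
        unfolding dist_real_def H_def by (rule less_imp_le)
    qed
    have "\<bar>G P * (X - x0) * (Y - y0) - H P * (X - x0) * (Y - y0)\<bar> \<le> 2 * (\<epsilon> * \<bar>X - x0\<bar> * \<bar>Y - y0\<bar>)"
      using 1 2 by linarith
    also have "G P * (X - x0) * (Y - y0) - H P * (X - x0) * (Y - y0) = (G P - H P) * ((X - x0) * (Y - y0))"
      by (simp add: algebra_simps)
    finally have "\<bar>G P - H P\<bar> * (\<bar>X - x0\<bar> * \<bar>Y - y0\<bar>) \<le> 2 * \<epsilon> * (\<bar>X - x0\<bar> * \<bar>Y - y0\<bar>)"
      by (simp add: abs_mult mult.assoc)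
    moreover have "\<bar>X - x0\<bar> * \<bar>Y - y0\<bar> > 0" using X(2) Y(2) by simp
    ultimately show ?thesis by (rule mult_right_le_imp_le)
  qed
  from this[of "\<bar>G P - H P\<bar> / 4"] have "G P = H P" by (cases "G P = H P") auto
  then show ?thesis by (simp add: G_def H_def)
qed

lemma pderiv_x_cong:
  assumes "\<And>Q. Q \<in> S \<Longrightarrow> f Q = g Q" "P \<in> S"
  shows "pderiv_x S f P = pderiv_x S g P"
proof -
  obtain X Y where P: "P = (X, Y)" by (cases P)
  have "((\<lambda>t. f (t, Y)) has_vector_derivative D) (at X within {t. (t, Y) \<in> S})
      \<longleftrightarrow> ((\<lambda>t. g (t, Y)) has_vector_derivative D) (at X within {t. (t, Y) \<in> S})" for D
    using assms P by (auto elim!: has_vector_derivative_transform[rotated 2])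
  then show ?thesis by (simp add: P pderiv_x_def vector_derivative_def)
qed

text \<open>The bound \<open>N\<close> concerns third derivatives with the \<open>y\<close>
  derivatives taken first. Moving along \<open>y\<close> from a derivative that already contains
  \<open>x\<close> produces another order, which \<open>mixed_partials_commute\<close>
  rearranges.\<close>

lemma second_deriv_lipschitz:
  fixes f :: "real \<times> real \<Rightarrow> real" and a b c d :: real
  defines "S \<equiv> {a..b} \<times> {c..d}"
  assumes f: "C_k_on 3 ({a..b} \<times> {c..d}) f" and ab: "a < b" and cd: "c < d"
    and P0: "P0 \<in> S" and P: "P \<in> S" and \<alpha>: "\<alpha> \<in> multi_indices 2"
    and B: "\<And>\<beta> Q. \<lbrakk>\<beta> \<in> multi_indices 3; Q \<in> S\<rbrakk> \<Longrightarrow> \<bar>multi_deriv S \<beta> f Q\<bar> \<le> N"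
  shows "\<bar>multi_deriv S \<alpha> f P - multi_deriv S \<alpha> f P0\<bar> \<le> N * (\<bar>fst P - fst P0\<bar> + \<bar>snd P - snd P0\<bar>)"
proof -
  obtain x0 y0 X Y where e: "P0 = (x0, y0)" "P = (X, Y)" by (cases P0, cases P)
  have in0: "x0 \<in> {a..b}" "y0 \<in> {c..d}" "X \<in> {a..b}" "Y \<in> {c..d}" using P0 P by (auto simp: S_def e)
  have f0: "C_k_on 2 ({a..b} \<times> {c..d}) f" using f by (auto simp: numeral_3_eq_3 numeral_2_eq_2)
  have f1: "C_k_on 2 ({a..b} \<times> {c..d}) (pderiv_x S f)" "C_k_on 2 ({a..b} \<times> {c..d}) (pderiv_y S f)"
    using f by (auto simp: numeral_3_eq_3 numeral_2_eq_2 S_def)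
  have lip: "\<bar>D P - D P0\<bar> \<le> N * (\<bar>X - x0\<bar> + \<bar>Y - y0\<bar>)"
    if D: "C_k_on (Suc 0) ({a..b} \<times> {c..d}) D" and x: "\<And>Q. Q \<in> S \<Longrightarrow> \<bar>pderiv_x S D Q\<bar> \<le> N"
      and y: "\<And>Q. Q \<in> S \<Longrightarrow> \<bar>pderiv_y S D Q\<bar> \<le> N" for D
  proof -
    have "\<bar>D (X, Y) - D (x0, Y) - 0 * (X - x0)\<bar> \<le> N * \<bar>X - x0\<bar>"
      by (rule taylor_1[OF C_k_on_pderiv_x[OF D in0(4)] in0(1,3)]) (use x in0 in \<open>auto simp: S_def\<close>)
    moreover have "\<bar>D (x0, Y) - D (x0, y0) - 0 * (Y - y0)\<bar> \<le> N * \<bar>Y - y0\<bar>"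
      by (rule taylor_1[OF C_k_on_pderiv_y[OF D in0(1)] in0(2,4)]) (use y in0 in \<open>auto simp: S_def\<close>)
    ultimately show ?thesis unfolding e by (simp add: distrib_left)
  qed
  note com = mixed_partials_commute[OF _ ab cd, folded S_def]
  have xx: "pderiv_y S (pderiv_x S (pderiv_x S f)) Q = multi_deriv S (2, 1) f Q" if "Q \<in> S" for Q
  proof -
    have "pderiv_y S (pderiv_x S (pderiv_x S f)) Q = pderiv_x S (pderiv_y S (pderiv_x S f)) Q"
      by (rule com[OF f1(1)[folded S_def] that])
    also have "\<dots> = pderiv_x S (pderiv_x S (pderiv_y S f)) Q"
      by (rule pderiv_x_cong[OF com[OF f0[folded S_def]] that])
    finally show ?thesis by (simp only: multi_deriv_3)
  qed
  have xy: "pderiv_y S (pderiv_x S (pderiv_y S f)) Q = multi_deriv S (1, 2) f Q" if "Q \<in> S" for Q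
    unfolding multi_deriv_3 by (rule com[OF f1(2)[folded S_def] that])
  have f2: "C_k_on (Suc 0) ({a..b} \<times> {c..d}) (pderiv_x S (pderiv_x S f))" "C_k_on (Suc 0) ({a..b} \<times> {c..d})
      (pderiv_x S (pderiv_y S f))"
    "C_k_on (Suc 0) ({a..b} \<times> {c..d}) (pderiv_y S (pderiv_y S f))"
    using f by (auto simp: numeral_3_eq_3 S_def)
  note B3 = B[of "(3, 0)"] B[of "(2, 1)"] B[of "(1, 2)"] B[of "(0, 3)"]
  have "\<bar>multi_deriv S (2, 0) f P - multi_deriv S (2, 0) f P0\<bar> \<le> N * (\<bar>X - x0\<bar> + \<bar>Y - y0\<bar>)"
    unfolding multi_deriv_2 by (rule lip[OF f2(1)]) (use B3 xx in \<open>auto simp: multi_indices_3 multi_deriv_3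
        simp del: One_nat_def\<close>)
  moreover have "\<bar>multi_deriv S (1, 1) f P - multi_deriv S (1, 1) f P0\<bar> \<le> N * (\<bar>X - x0\<bar> + \<bar>Y - y0\<bar>)"
    unfolding multi_deriv_2 by (rule lip[OF f2(2)]) (use B3 xy in \<open>auto simp: multi_indices_3 multi_deriv_3
        simp del: One_nat_def\<close>)
  moreover have "\<bar>multi_deriv S (0, 2) f P - multi_deriv S (0, 2) f P0\<bar> \<le> N * (\<bar>X - x0\<bar> + \<bar>Y - y0\<bar>)"
    unfolding multi_deriv_2 by (rule lip[OF f2(3)]) (use B3 in \<open>auto simp: multi_indices_3 multi_deriv_3 simp
        del: One_nat_def\<close>)
  ultimately show ?thesis using \<alpha> by (auto simp: multi_indices_2 e simp del: One_nat_def)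
qed

subsection \<open>The error of the quasi-interpolants\<close>

text \<open>\<open>e\<^sub>1, e\<^sub>2\<close> bound the second-order Taylor remainder and \<open>d\<^sub>1, d\<^sub>2, d\<^sub>3\<close> the oscillation of the second
    derivatives,
  for increments of growing size; the two parts of the theorem only differ in these values.\<close>

locale taylor_control =
  fixes a b c d h e1 e2 d1 d2 d3 :: real and S :: "(real \<times> real) set" and f :: "real \<times> real \<Rightarrow> real"
  assumes S: "S = {a..b} \<times> {c..d}"
    and f: "C_k_on 2 S f"
    and T1: "\<And>P Q. \<lbrakk>P \<in> S; Q \<in> S; \<bar>fst Q - fst P\<bar> + \<bar>snd Q - snd P\<bar> \<le> h\<rbrakk> \<Longrightarrow> \<bar>f Q - taylor_poly S f P Q\<bar> \<le> e1"
    and T2: "\<And>P Q. \<lbrakk>P \<in> S; Q \<in> S; \<bar>fst Q - fst P\<bar> \<le> h; \<bar>snd Q - snd P\<bar> \<le> h\<rbrakk> \<Longrightarrow> \<bar>f Q - taylor_poly S f P Q\<bar> \<le> e2"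
    and O1: "\<And>\<alpha> P Q. \<lbrakk>\<alpha> \<in> multi_indices 2; P \<in> S; Q \<in> S; \<bar>fst Q - fst P\<bar> + \<bar>snd Q - snd P\<bar> \<le> h\<rbrakk>
      \<Longrightarrow> \<bar>multi_deriv S \<alpha> f Q - multi_deriv S \<alpha> f P\<bar> \<le> d1"
    and O2: "\<And>\<alpha> P Q. \<lbrakk>\<alpha> \<in> multi_indices 2; P \<in> S; Q \<in> S; \<bar>fst Q - fst P\<bar> \<le> h; \<bar>snd Q - snd P\<bar> \<le> h\<rbrakk>
      \<Longrightarrow> \<bar>multi_deriv S \<alpha> f Q - multi_deriv S \<alpha> f P\<bar> \<le> d2"
    and O3: "\<And>\<alpha> P Q. \<lbrakk>\<alpha> \<in> multi_indices 2; P \<in> S; Q \<in> S;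
        \<bar>fst Q - fst P\<bar> \<le> 2 * h \<and> \<bar>snd Q - snd P\<bar> \<le> h \<or> \<bar>fst Q - fst P\<bar> \<le> h \<and> \<bar>snd Q - snd P\<bar> \<le> 2 * h\<rbrakk>
      \<Longrightarrow> \<bar>multi_deriv S \<alpha> f Q - multi_deriv S \<alpha> f P\<bar> \<le> d3"
    and mono: "e1 \<le> e2" "d1 \<le> d2"

lemma partition_midpt_range:
  assumes "partition_of a b m x" "i \<in> {0..m + 1}"
  shows "midpt x i \<in> {a..b}"
  using partition_of_range[OF assms(1), of "i - 1"] partition_of_range[OF assms(1), of i] assms(2)
  by (auto simp: midpt_def)

lemma partition_midpt_dist:
  assumes x: "partition_of a b m x" and h: "\<And>i. i \<in> {0..m + 1} \<Longrightarrow> step x i \<le> h"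
    and k: "k \<in> {1..m}" and r: "r \<in> stencil"
  shows "\<bar>midpt x (k + r) - midpt x k\<bar> \<le> h"
proof -
  have "0 \<le> step x i" if "i \<in> {0..m + 1}" for i using partition_of_le[OF x that] by (simp add: step_def)
  from this[of "k - 1"] this[of k] this[of "k + 1"] h[of "k - 1"] h[of k] h[of "k + 1"] k
  have "\<bar>midpt x (k - 1) - midpt x k\<bar> \<le> h" "\<bar>midpt x (k + 1) - midpt x k\<bar> \<le> h" "0 \<le> h"
    by (auto simp: midpt_def step_def field_simps)
  then show ?thesis using r by auto
qed

text \<open>The special values of \<open>sigma\<close> at the indices 1 and \<open>m + 1\<close> are
  what the general formula gives for repeated end knots, so the functionals and the B-splines share
  the same ratios.\<close>

lemma sigma_ratio:
  assumes x: "partition_of a b m x" and i: "i \<in> {1..m}"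
  shows "sigma m x i = ratio_left x i" "sigma' m x (i + 1) = ratio_right x i" (is ?P1)
proof -
  have lt: "x (i - 1) < x i" by (rule partition_of_strict[OF x i])
  have le: "x (i - 2) \<le> x (i - 1)" "x i \<le> x (i + 1)"
    using partition_of_mono[OF x, of "i - 2" "i - 1"] partition_of_mono[OF x, of i "i + 1"] i by auto
  have e: "x (- 1) = x 0" "x (m + 1) = x m" using x by (auto simp: partition_of_def)
  show "sigma m x i = ratio_left x i"
    using lt le i e by (auto simp: sigma_def ratio_left_def step_def)
  show ?P1
    using lt le i e by (auto simp: sigma'_def sigma_def ratio_right_def step_def field_simps)
qed

text \<open>The weights of \<open>\<mu>\<^sub>i\<^sub>j\<close> in one direction form a second difference, normalised to be exact
  on quadratic polynomials.\<close>

lemma S2_second_difference: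
  fixes g g' g'' :: "real \<Rightarrow> real"
  assumes x: "partition_of a b m x" and h: "\<And>i. i \<in> {0..m + 1} \<Longrightarrow> step x i \<le> h" and i: "i \<in> {0..m + 1}"
    and D: "\<And>t. t \<in> {a..b} \<Longrightarrow> (g has_real_derivative g' t) (at t within {a..b})"
    and D': "\<And>t. t \<in> {a..b} \<Longrightarrow> (g' has_real_derivative g'' t) (at t within {a..b})"
    and B: "\<And>t. t \<in> {a..b} \<Longrightarrow> \<bar>t - midpt x i\<bar> \<le> h \<Longrightarrow> \<bar>g'' t - A\<bar> \<le> C"
  shows "\<bar>a_coeff m x i * (g (midpt x (i - 1)) - g (midpt x i)) + c_coeff m x i * (g (midpt x (i + 1)) - g
      (midpt x i))
     + (step x i)\<^sup>2 / 8 * A\<bar> \<le> (step x i)\<^sup>2 / 8 * C"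
proof (cases "i \<in> {1..m}")
  case False
  \<comment> \<open>At the two degenerate cells the step and both weights are zero, so the claim
    reads \<open>0 \<le> 0\<close>.\<close>
  then have "i = 0 \<or> i = m + 1" using i by auto
  then have "step x i = 0" using x by (auto simp: step_def partition_of_def)
  then show ?thesis using False by (auto simp: a_coeff_def c_coeff_def)
next
  case True
  have lt: "x (i - 1) < x i" by (rule partition_of_strict[OF x True])
  have le: "x (i - 2) \<le> x (i - 1)" "x i \<le> x (i + 1)"
    using partition_of_mono[OF x, of "i - 2" "i - 1"] partition_of_mono[OF x, of i "i + 1"] True by auto
  define E E' H where "E = (x i - x (i - 2)) / 2" and "E' = (x (i + 1) - x (i - 1)) / 2" and "H = x i - x (i
      - 1)"
  have pos: "E > 0" "E' > 0" "H > 0" using lt le by (auto simp: E_def E'_def H_def)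
  have mid: "midpt x (i - 1) = midpt x i - E" "midpt x (i + 1) = midpt x i + E'" "step x i = H"
    by (simp_all add: midpt_def E_def E'_def H_def step_def field_simps)
  have \<sigma>: "sigma m x i = H / (2 * E)" "sigma' m x (i + 1) = H / (2 * E')"
  proof -
    have "2 * E = x i - x (i - 2)" "2 * E' = x (i + 1) - x (i - 1)" by (simp_all add: E_def E'_def)
    then show "sigma m x i = H / (2 * E)" "sigma' m x (i + 1) = H / (2 * E')"
      unfolding sigma_ratio[OF x True] by (simp_all add: ratio_left_def ratio_right_def H_def)
  qed
  define p q where "p = - a_coeff m x i" and "q = - c_coeff m x i"
  have frac: "H / (2 * E) + H / (2 * E') = H * (E + E') / (2 * E * E')" using pos by (simp add: field_simps)
  have pe: "p = H\<^sup>2 / (4 * E * (E + E'))"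
  proof -
    have "p = (H / (2 * E))\<^sup>2 * (H / (2 * E')) / (H * (E + E') / (2 * E * E'))"
      using True by (simp add: p_def a_coeff_def \<sigma> frac)
    then show ?thesis using pos by (simp add: power2_eq_square divide_simps) (simp add: algebra_simps)?
  qed
  have qe: "q = H\<^sup>2 / (4 * E' * (E + E'))"
  proof -
    have "q = H / (2 * E) * (H / (2 * E'))\<^sup>2 / (H * (E + E') / (2 * E * E'))"
      using True by (simp add: q_def c_coeff_def \<sigma> frac)
    then show ?thesis using pos by (simp add: power2_eq_square divide_simps) (simp add: algebra_simps)?
  qed
  have pq: "0 \<le> p" "0 \<le> q" using pos by (simp_all add: pe qe)
  have EE: "E + E' \<noteq> 0" using pos by simp
  have canc: "z / (4 * w) * w = z / 4" if "w \<noteq> 0" for z w :: real using that by simp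
  \<comment> \<open>The weights \<open>p\<close>, \<open>q\<close> have equal first moments and
    total second moment \<open>H^2 / 4\<close>: the first derivative cancels, and for constant
    second derivative exactly \<open>- H^2 / 8\<close> times it remains.\<close>
  have pE: "p * E = H\<^sup>2 / (4 * (E + E'))" "q * E' = H\<^sup>2 / (4 * (E + E'))" using pos by (simp_all add: pe qe)
  then have mom1: "p * E = q * E'" by simp
  have "p * E\<^sup>2 + q * E'\<^sup>2 = H\<^sup>2 / (4 * (E + E')) * E + H\<^sup>2 / (4 * (E + E')) * E'"
    using pE by (simp add: power2_eq_square mult.assoc[symmetric])
  also have "\<dots> = H\<^sup>2 / 4"
    unfolding distrib_left[symmetric] by (rule canc[OF EE])
  finally have mom2: "p * E\<^sup>2 + q * E'\<^sup>2 = H\<^sup>2 / 4" .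
  have rng: "midpt x (i - 1) \<in> {a..b}" "midpt x i \<in> {a..b}" "midpt x (i + 1) \<in> {a..b}"
    using True by (auto intro!: partition_midpt_range[OF x] simp del: atLeastAtMost_iff) auto
  have dh: "E \<le> h" "E' \<le> h"
    using partition_midpt_dist[OF x h True, of "- 1"] partition_midpt_dist[OF x h True, of 1] pos
    by (simp_all add: mid)
  define m0 where "m0 = midpt x i"
  define R1 where "R1 = g (m0 - E) - g m0 - g' m0 * (- E) - A / 2 * (- E)\<^sup>2"
  define R2 where "R2 = g (m0 + E') - g m0 - g' m0 * E' - A / 2 * E'\<^sup>2"
  have R1: "\<bar>R1\<bar> \<le> C * E\<^sup>2 / 2"
    using taylor_2[OF D D' rng(2,1), of A C] B dh pos unfolding R1_def m0_def mid by auto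
  have R2: "\<bar>R2\<bar> \<le> C * E'\<^sup>2 / 2"
    using taylor_2[OF D D' rng(2,3), of A C] B dh pos unfolding R2_def m0_def mid by auto
  have "a_coeff m x i * (g (midpt x (i - 1)) - g (midpt x i)) + c_coeff m x i * (g (midpt x (i + 1)) - g
      (midpt x i)) + H\<^sup>2 / 8 * A
      = - (p * R1 + q * R2) + g' m0 * (p * E - q * E') + A / 2 * (H\<^sup>2 / 4 - (p * E\<^sup>2 + q * E'\<^sup>2))"
    unfolding mid R1_def R2_def m0_def p_def q_def by (simp add: algebra_simps)
  also have "\<dots> = - (p * R1 + q * R2)" by (simp add: mom1 mom2)
  also have "\<bar>\<dots>\<bar> \<le> p * (C * E\<^sup>2 / 2) + q * (C * E'\<^sup>2 / 2)"
  proof -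
    have "\<bar>p * R1\<bar> \<le> p * (C * E\<^sup>2 / 2)" "\<bar>q * R2\<bar> \<le> q * (C * E'\<^sup>2 / 2)"
      using mult_left_mono[OF R1 pq(1)] mult_left_mono[OF R2 pq(2)] pq by (simp_all add: abs_mult)
    then show ?thesis by linarith
  qed
  also have "\<dots> = C / 2 * (p * E\<^sup>2 + q * E'\<^sup>2)" by (simp add: algebra_simps)
  also have "\<dots> = H\<^sup>2 / 8 * C" by (simp add: mom2)
  finally show ?thesis by (simp add: mid)
qed

locale quasi_interpolation = taylor_control +
  fixes m n :: int and x y u v :: "int \<Rightarrow> real" and \<delta> :: real
  assumes x: "partition_of a b m x" and y: "partition_of c d n y"
    and u: "extended_knots m x u" and v: "extended_knots n y v"
    and hx: "\<And>i. i \<in> {0..m + 1} \<Longrightarrow> step x i \<le> h" and hy: "\<And>j. j \<in> {0..n + 1} \<Longrightarrow> step y j \<le> h"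
    and \<delta>: "0 < \<delta>" "\<And>i. i \<in> {1..m} \<Longrightarrow> \<delta> \<le> step x i" "\<And>j. j \<in> {1..n} \<Longrightarrow> \<delta> \<le> step y j"
begin

abbreviation centre :: "int \<Rightarrow> int \<Rightarrow> real \<times> real" where "centre i j \<equiv> (midpt x i, midpt y j)"

lemma step_nonneg: "i \<in> {0..m + 1} \<Longrightarrow> 0 \<le> step x i" "j \<in> {0..n + 1} \<Longrightarrow> 0 \<le> step y j"
  using partition_of_le[OF x] partition_of_le[OF y] by (simp_all add: step_def)

lemma centre_in: "i \<in> {0..m + 1} \<Longrightarrow> j \<in> {0..n + 1} \<Longrightarrow> centre i j \<in> S"
  using partition_midpt_range[OF x] partition_midpt_range[OF y] by (simp add: S)

lemma step_sq: "i \<in> {0..m + 1} \<Longrightarrow> (step x i)\<^sup>2 \<le> h\<^sup>2" "j \<in> {0..n + 1} \<Longrightarrow> (step y j)\<^sup>2 \<le> h\<^sup>2"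
  using step_nonneg hx hy by (auto intro!: power_mono)

text \<open>The B-spline coefficients of the Taylor polynomial at \<open>P0\<close>; the two
  corrections turn squared midpoint offsets into products of knots
  (\<open>expected_coef_stencil\<close>).\<close>

definition expected_coef :: "real \<times> real \<Rightarrow> int \<Rightarrow> int \<Rightarrow> real" where
  "expected_coef P0 i j = taylor_poly S f P0 (centre i j)
     - (step x i)\<^sup>2 / 8 * multi_deriv S (2, 0) f P0 - (step y j)\<^sup>2 / 8 * multi_deriv S (0, 2) f P0"

text \<open>When the corner values are expanded about the midpoint, odd and mixed terms cancel in
  the mean, which leaves an eighth of the squared step times each pure second derivative: the
  correction in \<open>expected_coef\<close>. Corners are half a step away in each direction, so
  their remainders are at most \<open>e1\<close>.\<close>

lemma mu_star_error:
  assumes i: "i \<in> {0..m + 1}" and j: "j \<in> {0..n + 1}" and dd: "0 \<le> dd"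
    and eT: "\<bar>f (centre i j) - taylor_poly S f P0 (centre i j)\<bar> \<le> eT"
    and osc: "\<bar>multi_deriv S (2, 0) f (centre i j) - multi_deriv S (2, 0) f P0\<bar> \<le> dd"
      "\<bar>multi_deriv S (0, 2) f (centre i j) - multi_deriv S (0, 2) f P0\<bar> \<le> dd"
  shows "\<bar>mu_star x y i j f - expected_coef P0 i j\<bar> \<le> eT + e1 + h\<^sup>2 / 4 * dd"
proof -
  let ?M = "centre i j"
  have comb: "\<bar>z\<bar> \<le> eT + e1 + 2 * K"
    if "z = A - B - C - (r1 + r2 + r3 + r4) / 4" "\<bar>A\<bar> \<le> eT" "\<bar>B\<bar> \<le> K" "\<bar>C\<bar> \<le> K"
      "\<bar>r1\<bar> \<le> e1" "\<bar>r2\<bar> \<le> e1" "\<bar>r3\<bar> \<le> e1" "\<bar>r4\<bar> \<le> e1" for z A B C K r1 r2 r3 r4 :: real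
  proof -
    have "\<bar>r1 + r2 + r3 + r4\<bar> \<le> 4 * e1" using that(5-8) by linarith
    moreover have "z * 4 = 4 * A - 4 * B - 4 * C - (r1 + r2 + r3 + r4)" using that(1) by (simp add: field_simps)
    ultimately show ?thesis using that(2-4) by linarith
  qed
  define R where "R = (\<lambda>p q. f (x p, y q) - taylor_poly S f ?M (x p, y q))"
  have co: "x (i - 1) - midpt x i = - (step x i / 2)" "x i - midpt x i = step x i / 2"
    "y (j - 1) - midpt y j = - (step y j / 2)" "y j - midpt y j = step y j / 2"
    by (simp_all add: midpt_def step_def field_simps)
  have R: "\<bar>R p q\<bar> \<le> e1" if p: "p \<in> {i - 1, i}" and q: "q \<in> {j - 1, j}" for p q
  proof -
    have "x p \<in> {a..b}" "y q \<in> {c..d}"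
      using p q i j by (auto intro!: partition_of_range[OF x] partition_of_range[OF y] simp del:
          atLeastAtMost_iff) auto
    moreover have "\<bar>x p - midpt x i\<bar> = step x i / 2" "\<bar>y q - midpt y j\<bar> = step y j / 2"
      using p q step_nonneg(1)[OF i] step_nonneg(2)[OF j] co by auto
    ultimately show ?thesis unfolding R_def using centre_in[OF i j] hx[OF i] hy[OF j]
      by (intro T1) (auto simp: S)
  qed
  have "mu_star x y i j f - expected_coef P0 i j
    = (f ?M - taylor_poly S f P0 ?M)
      - (step x i)\<^sup>2 / 8 * (multi_deriv S (2, 0) f ?M - multi_deriv S (2, 0) f P0)
      - (step y j)\<^sup>2 / 8 * (multi_deriv S (0, 2) f ?M - multi_deriv S (0, 2) f P0)
      - (R (i - 1) (j - 1) + R (i - 1) j + R i (j - 1) + R i j) / 4"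
    unfolding mu_star_def expected_coef_def R_def taylor_poly_def[of S f ?M] fst_conv snd_conv co
    by (simp add: power2_eq_square field_simps)
  moreover have "\<bar>(step x i)\<^sup>2 / 8 * (multi_deriv S (2, 0) f ?M - multi_deriv S (2, 0) f P0)\<bar> \<le> h\<^sup>2 / 8 * dd"
    unfolding abs_mult using osc(1) step_sq(1)[OF i] by (intro mult_mono) auto
  moreover have "\<bar>(step y j)\<^sup>2 / 8 * (multi_deriv S (0, 2) f ?M - multi_deriv S (0, 2) f P0)\<bar> \<le> h\<^sup>2 / 8 * dd"
    unfolding abs_mult using osc(2) step_sq(2)[OF j] by (intro mult_mono) auto
  moreover have "\<bar>R (i - 1) (j - 1)\<bar> \<le> e1" "\<bar>R (i - 1) j\<bar> \<le> e1" "\<bar>R i (j - 1)\<bar> \<le> e1" "\<bar>R i j\<bar> \<le> e1"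
    by (auto intro!: R)
  ultimately have "\<bar>mu_star x y i j f - expected_coef P0 i j\<bar> \<le> eT + e1 + 2 * (h\<^sup>2 / 8 * dd)"
    using comb[OF _ eT] by blast
  then show ?thesis by (simp add: mult.commute)
qed

text \<open>The functional is the midpoint value plus one second difference per direction. These see
  second derivatives up to distance \<open>h\<close> along an axis from the midpoint, so the
  oscillation is assumed on whole segments.\<close>

lemma mu_error:
  assumes i: "i \<in> {0..m + 1}" and j: "j \<in> {0..n + 1}" and dd: "0 \<le> dd"
    and eT: "\<bar>f (centre i j) - taylor_poly S f P0 (centre i j)\<bar> \<le> eT"
    and oscx: "\<And>t. t \<in> {a..b} \<Longrightarrow> \<bar>t - midpt x i\<bar> \<le> h \<Longrightarrow> \<bar>multi_deriv S (2, 0) f (t, midpt y j) - multi_deriv S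
        (2, 0) f P0\<bar> \<le> dd"
    and oscy: "\<And>t. t \<in> {c..d} \<Longrightarrow> \<bar>t - midpt y j\<bar> \<le> h \<Longrightarrow> \<bar>multi_deriv S (0, 2) f (midpt x i, t) - multi_deriv S
        (0, 2) f P0\<bar> \<le> dd"
  shows "\<bar>mu m n x y i j f - expected_coef P0 i j\<bar> \<le> eT + h\<^sup>2 / 4 * dd"
proof -
  let ?M = "centre i j"
  have Mx: "midpt x i \<in> {a..b}" and My: "midpt y j \<in> {c..d}" using centre_in[OF i j] by (auto simp: S)
  have f0: "C_k_on (Suc 1) ({a..b} \<times> {c..d}) f" using f by (simp add: numeral_2_eq_2 S)
  have f1: "C_k_on (Suc 0) ({a..b} \<times> {c..d}) (pderiv_x S f)" "C_k_on (Suc 0) ({a..b} \<times> {c..d}) (pderiv_y S f)"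
    using f by (auto simp: numeral_2_eq_2 S)
  define X where "X = a_coeff m x i * (f (midpt x (i - 1), midpt y j) - f ?M) + c_coeff m x i * (f (midpt x (i
      + 1), midpt y j) - f ?M)
      + (step x i)\<^sup>2 / 8 * multi_deriv S (2, 0) f P0"
  define Y where "Y = a_coeff n y j * (f (midpt x i, midpt y (j - 1)) - f ?M) + c_coeff n y j * (f
      (midpt x i, midpt y (j + 1)) - f ?M)
      + (step y j)\<^sup>2 / 8 * multi_deriv S (0, 2) f P0"
  have "\<bar>X\<bar> \<le> (step x i)\<^sup>2 / 8 * dd" unfolding X_def
    by (rule S2_second_difference[OF x hx i C_k_on_pderiv_x[OF f0 My, folded S] C_k_on_pderiv_x[OF f1(1) My,
        folded S]
          oscx[unfolded multi_deriv_2(1)], folded multi_deriv_2(1)])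
  also have "\<dots> \<le> h\<^sup>2 / 8 * dd" using step_sq(1)[OF i] dd by (intro mult_right_mono) auto
  finally have X: "\<bar>X\<bar> \<le> h\<^sup>2 / 8 * dd" .
  have "\<bar>Y\<bar> \<le> (step y j)\<^sup>2 / 8 * dd" unfolding Y_def
    by (rule S2_second_difference[OF y hy j C_k_on_pderiv_y[OF f0 Mx, folded S] C_k_on_pderiv_y[OF f1(2) Mx,
        folded S]
          oscy[unfolded multi_deriv_2(3)], folded multi_deriv_2(3)])
  also have "\<dots> \<le> h\<^sup>2 / 8 * dd" using step_sq(2)[OF j] dd by (intro mult_right_mono) auto
  finally have Y: "\<bar>Y\<bar> \<le> h\<^sup>2 / 8 * dd" .
  have "mu m n x y i j f - expected_coef P0 i j = (f ?M - taylor_poly S f P0 ?M) + X + Y"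
    unfolding mu_def b_coeff_def expected_coef_def X_def Y_def by (simp add: algebra_simps)
  then show ?thesis using eT X Y by linarith
qed

lemma expected_coef_stencil:
  "expected_coef (centre k l) (k + r) (l + r') =
     quadratic_coef (mesh_offset x k) (mesh_square x k) (mesh_offset y l) (mesh_square y l)
       (f (centre k l)) (pderiv_x S f (centre k l)) (pderiv_y S f (centre k l))
       (multi_deriv S (2, 0) f (centre k l)) (multi_deriv S (1, 1) f (centre k l)) (multi_deriv S (0, 2) f
           (centre k l)) r r'"
  unfolding expected_coef_def quadratic_coef_def taylor_poly_def by (simp add: field_simps)

text \<open>Inside a cell the offsets from the centre are at most half steps and add up to at most
  \<open>h\<close>; replacing \<open>P\<close> by the centre costs \<open>d1\<close>. The rest is
  \<open>spline_deriv_error\<close> with the Taylor data of the centre.\<close>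

lemma cell_error:
  assumes T: "T \<in> criss_cross {1..m} {1..n} x y" and P: "P \<in> interior T" and \<alpha>: "\<alpha> \<in> multi_indices 2"
    and E: "E1 \<le> E2"
    and E1: "\<And>k l r r'. \<lbrakk>k \<in> {1..m}; l \<in> {1..n}; r \<in> stencil; r' \<in> stencil; r = 0 \<or> r' = 0\<rbrakk> \<Longrightarrow>
        \<bar>M (k + r) (l + r') - expected_coef (centre k l) (k + r) (l + r')\<bar> \<le> E1"
    and E2: "\<And>k l r r'. \<lbrakk>k \<in> {1..m}; l \<in> {1..n}; r \<in> stencil; r' \<in> stencil\<rbrakk> \<Longrightarrow>
        \<bar>M (k + r) (l + r') - expected_coef (centre k l) (k + r) (l + r')\<bar> \<le> E2"
  shows "\<bar>multi_deriv S \<alpha> f P - multi_deriv S \<alpha> (\<lambda>P. \<Sum>i=0..m + 1. \<Sum>j=0..n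
      + 1. M i j * bspline m n x y u v i j P) P\<bar>
     \<le> d1 + (12 * E1 + 4 * E2) / \<delta>\<^sup>2"
proof -
  obtain k l where k: "k \<in> {1..m}" and l: "l \<in> {1..n}" and T': "T \<in> rect_triangles (x (k - 1)) (x k) (y (l
      - 1)) (y l)"
    using T unfolding criss_cross_def by blast
  have lt: "x (k - 1) < x k" "y (l - 1) < y l" using partition_of_strict x y k l by auto
  have kl: "k \<in> {0..m + 1}" "l \<in> {0..n + 1}" using k l by auto
  have Pc: "P \<in> {x (k - 1)..x k} \<times> {y (l - 1)..y l}"
    using triangle_signs(1)[of x k y l, OF lt T'] P interior_subset by blast
  moreover have "x (k - 1) \<in> {a..b}" "x k \<in> {a..b}" "y (l - 1) \<in> {c..d}" "y l \<in> {c..d}"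
    using k l by (auto intro!: partition_of_range[OF x] partition_of_range[OF y] simp del: atLeastAtMost_iff)
        auto
  ultimately have PS: "P \<in> S" by (auto simp: S mem_Times_iff)
  have "\<bar>fst P - midpt x k\<bar> \<le> step x k / 2" "\<bar>snd P - midpt y l\<bar> \<le> step y l / 2"
    using Pc by (auto simp: mem_Times_iff midpt_def step_def abs_le_iff field_simps)
  then have "\<bar>fst P - fst (centre k l)\<bar> + \<bar>snd P - snd (centre k l)\<bar> \<le> h"
    using hx[OF kl(1)] hy[OF kl(2)] by simp
  from O1[OF \<alpha> centre_in[OF kl] PS this]
  have 1: "\<bar>multi_deriv S \<alpha> f P - multi_deriv S \<alpha> f (centre k l)\<bar> \<le> d1" .
  note err = spline_deriv_error[OF x y u v k l T' P \<delta>(1) \<delta>(2)[OF k] \<delta>(3)[OF l]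
      E1[OF k l, unfolded expected_coef_stencil] E2[OF k l, unfolded expected_coef_stencil] E, folded S]
  have 2: "\<bar>multi_deriv S \<alpha> f (centre k l) - multi_deriv S \<alpha> (\<lambda>P. \<Sum>i=0..m + 1. \<Sum>j=0..n
      + 1. M i j * bspline m n x y u v i j P) P\<bar>
     \<le> (12 * E1 + 4 * E2) / \<delta>\<^sup>2"
    using \<alpha> err unfolding multi_indices_2 by (elim insertE emptyE) (simp_all only:)
  from 1 2 show ?thesis by linarith
qed

lemma index_shift: "k \<in> {1..m} \<Longrightarrow> r \<in> stencil \<Longrightarrow> k + r \<in> {0..m + 1}" "l \<in> {1..n} \<Longrightarrow> r \<in> stencil \<Longrightarrow> l + r \<in> {0..n
    + 1}"
  by auto

lemma h_nonneg: "0 \<le> h"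
proof -
  have "1 \<in> {0..m + 1}" using x by (simp add: partition_of_def)
  from step_nonneg(1)[OF this] hx[OF this] show ?thesis by linarith
qed

text \<open>An offset along one axis keeps the sum of the increments within \<open>h\<close>, hence
  \<open>e1\<close> and \<open>d1\<close>; a corner offset only keeps each coordinate within
  \<open>h\<close>, hence \<open>e2\<close> and \<open>d2\<close>. A further move by
  \<open>h\<close> along one axis leads to the oblong box of \<open>d3\<close>.\<close>

lemma taylor_bounds:
  assumes k: "k \<in> {1..m}" and l: "l \<in> {1..n}" and r: "r \<in> stencil" "r' \<in> stencil"
  shows "\<bar>f (centre (k + r) (l + r')) - taylor_poly S f (centre k l) (centre (k + r) (l + r'))\<bar> \<le> (if r = 0
      \<or> r' = 0 then e1 else e2)" (is ?P1)
    and "\<alpha> \<in> multi_indices 2 \<Longrightarrow> \<bar>multi_deriv S \<alpha> f (centre (k + r) (l + r')) - multi_deriv S \<alpha> f (centre k l)\<bar> \<le>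
        (if r = 0 \<or> r' = 0 then d1 else d2)"
    and "t \<in> {a..b} \<Longrightarrow> \<bar>t - midpt x (k + r)\<bar> \<le> h \<Longrightarrow> \<alpha> \<in> multi_indices 2 \<Longrightarrow>
       \<bar>multi_deriv S \<alpha> f (t, midpt y (l + r')) - multi_deriv S \<alpha> f (centre k l)\<bar> \<le> d3"
    and "t \<in> {c..d} \<Longrightarrow> \<bar>t - midpt y (l + r')\<bar> \<le> h \<Longrightarrow> \<alpha> \<in> multi_indices 2 \<Longrightarrow>
       \<bar>multi_deriv S \<alpha> f (midpt x (k + r), t) - multi_deriv S \<alpha> f (centre k l)\<bar> \<le> d3"
proof -
  have C0: "centre k l \<in> S" using k l by (intro centre_in) auto
  have C: "centre (k + r) (l + r') \<in> S" by (rule centre_in[OF index_shift(1)[OF k r(1)] index_shift(2)[OF l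
      r(2)]])
  have dx: "\<bar>midpt x (k + r) - midpt x k\<bar> \<le> h" by (rule partition_midpt_dist[OF x hx k r(1)])
  have dy: "\<bar>midpt y (l + r') - midpt y l\<bar> \<le> h" by (rule partition_midpt_dist[OF y hy l r(2)])
  have s: "\<bar>midpt x (k + r) - midpt x k\<bar> + \<bar>midpt y (l + r') - midpt y l\<bar> \<le> h" if "r = 0 \<or> r' = 0"
    using that dx dy by auto
  show ?P1
    using T1[OF C0 C] T2[OF C0 C] s dx dy by auto
  show "\<alpha> \<in> multi_indices 2 \<Longrightarrow> \<bar>multi_deriv S \<alpha> f (centre (k + r) (l + r')) - multi_deriv S \<alpha> f (centre k l)\<bar> \<le>
      (if r = 0 \<or> r' = 0 then d1 else d2)"
    using O1[OF _ C0 C] O2[OF _ C0 C] s dx dy by auto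
  show "\<bar>multi_deriv S \<alpha> f (t, midpt y (l + r')) - multi_deriv S \<alpha> f (centre k l)\<bar> \<le> d3"
    if "t \<in> {a..b}" "\<bar>t - midpt x (k + r)\<bar> \<le> h" "\<alpha> \<in> multi_indices 2"
  proof (rule O3[OF that(3) C0])
    show "(t, midpt y (l + r')) \<in> S" using that(1) C by (auto simp: S)
    have "\<bar>t - midpt x k\<bar> \<le> 2 * h" using that(2) dx by linarith
    then show "\<bar>fst (t, midpt y (l + r')) - fst (centre k l)\<bar> \<le> 2 * h \<and> \<bar>snd (t, midpt y (l + r')) - snd
        (centre k l)\<bar> \<le> h \<or>
       \<bar>fst (t, midpt y (l + r')) - fst (centre k l)\<bar> \<le> h \<and> \<bar>snd (t, midpt y (l + r')) - snd (centre k l)\<bar>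
           \<le> 2 * h"
      using dy by simp
  qed
  show "\<bar>multi_deriv S \<alpha> f (midpt x (k + r), t) - multi_deriv S \<alpha> f (centre k l)\<bar> \<le> d3"
    if "t \<in> {c..d}" "\<bar>t - midpt y (l + r')\<bar> \<le> h" "\<alpha> \<in> multi_indices 2"
  proof (rule O3[OF that(3) C0])
    show "(midpt x (k + r), t) \<in> S" using that(1) C by (auto simp: S)
    have "\<bar>t - midpt y l\<bar> \<le> 2 * h" using that(2) dy by linarith
    then show "\<bar>fst (midpt x (k + r), t) - fst (centre k l)\<bar> \<le> 2 * h \<and> \<bar>snd (midpt x (k + r), t) - snd
        (centre k l)\<bar> \<le> h \<or>
       \<bar>fst (midpt x (k + r), t) - fst (centre k l)\<bar> \<le> h \<and> \<bar>snd (midpt x (k + r), t) - snd (centre k l)\<bar>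
           \<le> 2 * h"
      using dx by simp
  qed
qed

lemma d_nonneg: "0 \<le> d1" "0 \<le> d2" "0 \<le> d3"
proof -
  have m: "1 \<in> {1..m}" "1 \<in> {1..n}" using x y by (simp_all add: partition_of_def)
  have C: "centre 1 1 \<in> S" using m by (intro centre_in) auto
  have i: "(2, 0) \<in> multi_indices 2" by (simp add: multi_indices_2)
  show "0 \<le> d1" "0 \<le> d2" "0 \<le> d3"
    using O1[OF i C C] O2[OF i C C] O3[OF i C C] h_nonneg by auto
qed

lemma S2_error:
  assumes "T \<in> criss_cross {1..m} {1..n} x y" "P \<in> interior T" and \<alpha>: "\<alpha> \<in> multi_indices 2"
  shows "\<bar>multi_deriv S \<alpha> f P - multi_deriv S \<alpha> (S2 m n x y u v f) P\<bar>
     \<le> d1 + (12 * (e1 + h\<^sup>2 / 4 * d3) + 4 * (e2 + h\<^sup>2 / 4 * d3)) / \<delta>\<^sup>2"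
proof -
  have S2: "S2 m n x y u v f = (\<lambda>P. \<Sum>i=0..m + 1. \<Sum>j=0..n + 1. mu m n x y i j f * bspline m n x y u v i j P)"
    by (rule ext) (simp add: S2_def)
  have mi: "(2, 0) \<in> multi_indices 2" "(0, 2) \<in> multi_indices 2" by (simp_all add: multi_indices_2)
  have err: "\<bar>mu m n x y (k + r) (l + r') f - expected_coef (centre k l) (k + r) (l + r')\<bar>
      \<le> (if r = 0 \<or> r' = 0 then e1 else e2) + h\<^sup>2 / 4 * d3"
    if "k \<in> {1..m}" "l \<in> {1..n}" "r \<in> stencil" "r' \<in> stencil" for k l r r'
    by (rule mu_error[OF index_shift(1)[OF that(1,3)] index_shift(2)[OF that(2,4)] d_nonneg(3)
        taylor_bounds(1)[OF that]
          taylor_bounds(3)[OF that _ _ mi(1)] taylor_bounds(4)[OF that _ _ mi(2)]])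
  show ?thesis unfolding S2
  proof (rule cell_error[OF assms])
    show "e1 + h\<^sup>2 / 4 * d3 \<le> e2 + h\<^sup>2 / 4 * d3" using mono by simp
  next
    fix k l r r' assume A: "k \<in> {1..m}" "l \<in> {1..n}" "r \<in> stencil" "r' \<in> stencil"
    show "\<bar>mu m n x y (k + r) (l + r') f - expected_coef (centre k l) (k + r) (l + r')\<bar> \<le> e1 + h\<^sup>2 / 4 * d3"
      if "r = 0 \<or> r' = 0" using err[OF A] that by (simp only: if_True)
    show "\<bar>mu m n x y (k + r) (l + r') f - expected_coef (centre k l) (k + r) (l + r')\<bar> \<le> e2 + h\<^sup>2 / 4 * d3"
      using err[OF A] mono by (auto split: if_splits)
  qed
qed

text \<open>The error of this functional involves second derivatives at midpoints alone, so
  \<open>d1\<close> and \<open>d2\<close> take the place of \<open>d3\<close>; the additional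
  \<open>e1\<close> comes from the corner values.\<close>

lemma W2_star_error:
  assumes "T \<in> criss_cross {1..m} {1..n} x y" "P \<in> interior T" and \<alpha>: "\<alpha> \<in> multi_indices 2"
  shows "\<bar>multi_deriv S \<alpha> f P - multi_deriv S \<alpha> (W2_star m n x y u v f) P\<bar>
     \<le> d1 + (12 * (e1 + e1 + h\<^sup>2 / 4 * d1) + 4 * (e2 + e1 + h\<^sup>2 / 4 * d2)) / \<delta>\<^sup>2"
proof -
  have W2: "W2_star m n x y u v f = (\<lambda>P. \<Sum>i=0..m + 1. \<Sum>j=0..n + 1. mu_star x y i j f * bspline m n x y u v i j
      P)"
    by (rule ext) (simp add: W2_star_def)
  have mi: "(2, 0) \<in> multi_indices 2" "(0, 2) \<in> multi_indices 2" by (simp_all add: multi_indices_2)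
  have err: "\<bar>mu_star x y (k + r) (l + r') f - expected_coef (centre k l) (k + r) (l + r')\<bar>
      \<le> (if r = 0 \<or> r' = 0 then e1 else e2) + e1 + h\<^sup>2 / 4 * (if r = 0 \<or> r' = 0 then d1 else d2)"
    if "k \<in> {1..m}" "l \<in> {1..n}" "r \<in> stencil" "r' \<in> stencil" for k l r r'
    by (rule mu_star_error[OF index_shift(1)[OF that(1,3)] index_shift(2)[OF that(2,4)] _ taylor_bounds(1)[OF
        that]
          taylor_bounds(2)[OF that mi(1)] taylor_bounds(2)[OF that mi(2)]]) (use d_nonneg in auto)
  have le: "e1 + e1 + h\<^sup>2 / 4 * d1 \<le> e2 + e1 + h\<^sup>2 / 4 * d2"
    using mono by (intro add_mono mult_left_mono) auto
  show ?thesis unfolding W2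
  proof (rule cell_error[OF assms le])
    fix k l r r' assume A: "k \<in> {1..m}" "l \<in> {1..n}" "r \<in> stencil" "r' \<in> stencil"
    show 1: "\<bar>mu_star x y (k + r) (l + r') f - expected_coef (centre k l) (k + r) (l + r')\<bar> \<le> e1 + e1
        + h\<^sup>2 / 4 * d1"
      if "r = 0 \<or> r' = 0" using err[OF A] that by (simp only: if_True)
    show "\<bar>mu_star x y (k + r) (l + r') f - expected_coef (centre k l) (k + r) (l + r')\<bar> \<le> e2 + e1
        + h\<^sup>2 / 4 * d2"
    proof (cases "r = 0 \<or> r' = 0")
      case True from order_trans[OF 1[OF True] le] show ?thesis .
    next
      case False then show ?thesis using err[OF A] by (simp only: if_False)
    qed
  qed
qed

end

section \<open>Mesh sizes, moduli and the values of the constants\<close>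

lemma step_le_mesh_max:
  assumes x: "partition_of a b m x" and y: "partition_of c d n y"
  shows "i \<in> {0..m + 1} \<Longrightarrow> step x i \<le> mesh_max m n x y" "j \<in> {0..n + 1} \<Longrightarrow> step y j \<le> mesh_max m n x y"
proof -
  have mx: "step x i \<le> mesh_max m n x y" if "i \<in> {1..m}" for i
    unfolding mesh_max_def by (rule Max_ge) (use that in auto)
  have my: "step y j \<le> mesh_max m n x y" if "j \<in> {1..n}" for j
    unfolding mesh_max_def by (rule Max_ge) (use that in auto)
  have m: "1 \<in> {1..m}" using x by (simp add: partition_of_def)
  have pos: "0 \<le> mesh_max m n x y"
    using mx[OF m] partition_of_strict[OF x m] by (simp add: step_def)
  have z: "step x 0 = 0" "step x (m + 1) = 0" "step y 0 = 0" "step y (n + 1) = 0"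
    using x y by (simp_all add: step_def partition_of_def)
  show "step x i \<le> mesh_max m n x y" if i: "i \<in> {0..m + 1}"
  proof -
    have "i \<in> {1..m} \<or> i = 0 \<or> i = m + 1" using i by auto
    then show ?thesis using mx z pos by auto
  qed
  show "step y j \<le> mesh_max m n x y" if j: "j \<in> {0..n + 1}"
  proof -
    have "j \<in> {1..n} \<or> j = 0 \<or> j = n + 1" using j by auto
    then show ?thesis using my z pos by auto
  qed
qed

lemma mesh_min_bounds:
  assumes x: "partition_of a b m x" and y: "partition_of c d n y"
  shows "0 < mesh_min m n x y" "i \<in> {1..m} \<Longrightarrow> mesh_min m n x y \<le> step x i" "j \<in> {1..n} \<Longrightarrow> mesh_min m n x y
      \<le> step y j"
proof -
  have m: "1 \<in> {1..m}" using x by (simp add: partition_of_def)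
  have "step x ` {1..m} \<union> step y ` {1..n} \<noteq> {}" using m by blast
  then show "0 < mesh_min m n x y" unfolding mesh_min_def
    using partition_of_strict[OF x] partition_of_strict[OF y] by (subst Min_gr_iff) (auto simp: step_def)
  show "i \<in> {1..m} \<Longrightarrow> mesh_min m n x y \<le> step x i" "j \<in> {1..n} \<Longrightarrow> mesh_min m n x y \<le> step y j"
    unfolding mesh_min_def by (rule Min_le; simp)+
qed

lemma dist_le_abs_sum: "dist P Q \<le> \<bar>fst Q - fst P\<bar> + \<bar>snd Q - snd P\<bar>" for P Q :: "real \<times> real"
proof -
  have "dist P Q = sqrt ((fst Q - fst P)\<^sup>2 + (snd Q - snd P)\<^sup>2)"
    by (cases P; cases Q) (simp add: dist_prod_def dist_real_def power2_commute)
  then show ?thesis using sqrt_sum_squares_le_sum_abs by metis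
qed

lemma dist_le_box:
  fixes P Q :: "real \<times> real"
  assumes "\<bar>fst Q - fst P\<bar> \<le> p" "\<bar>snd Q - snd P\<bar> \<le> q" "p\<^sup>2 + q\<^sup>2 \<le> r\<^sup>2" "0 \<le> r"
  shows "dist P Q \<le> r"
proof -
  have "dist P Q = sqrt ((fst Q - fst P)\<^sup>2 + (snd Q - snd P)\<^sup>2)"
    by (cases P; cases Q) (simp add: dist_prod_def dist_real_def power2_commute)
  moreover have "(fst Q - fst P)\<^sup>2 + (snd Q - snd P)\<^sup>2 \<le> p\<^sup>2 + q\<^sup>2"
    using assms(1,2) by (intro add_mono) (auto intro: abs_le_square_iff[THEN iffD1])
  ultimately show ?thesis using assms(3,4) by (auto intro: real_le_lsqrt)
qed

text \<open>Subdividing a segment gives \<open>\<omega>(\<psi>, k t) \<le> k \<omega>(\<psi>, t)\<close> on a convex set.\<close>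

lemma modulus_chain:
  fixes \<psi> :: "real \<times> real \<Rightarrow> real"
  assumes S: "convex S" and W: "\<And>P Q. \<lbrakk>P \<in> S; Q \<in> S; dist P Q \<le> t\<rbrakk> \<Longrightarrow> \<bar>\<psi> Q - \<psi> P\<bar> \<le> W"
  shows "\<lbrakk>P \<in> S; Q \<in> S; dist P Q \<le> real k * t\<rbrakk> \<Longrightarrow> \<bar>\<psi> Q - \<psi> P\<bar> \<le> real k * W"
proof (induction k arbitrary: Q)
  case 0
  then show ?case by simp
next
  case (Suc k)
  define R where "R = P + (real k / real (Suc k)) *\<^sub>R (Q - P)"
  have "R = (1 - real k / real (Suc k)) *\<^sub>R P + (real k / real (Suc k)) *\<^sub>R Q"
    by (simp add: R_def algebra_simps)
  then have R: "R \<in> S"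
    using convexD[OF S Suc.prems(1,2), of "1 - real k / real (Suc k)" "real k / real (Suc k)"] by simp
  have "dist P R = real k / real (Suc k) * dist P Q"
    by (simp add: R_def dist_norm norm_minus_commute del: of_nat_Suc)
  also have "\<dots> \<le> real k / real (Suc k) * (real (Suc k) * t)"
    by (rule mult_left_mono[OF Suc.prems(3)]) simp
  finally have 1: "\<bar>\<psi> R - \<psi> P\<bar> \<le> real k * W" using Suc.IH[OF Suc.prems(1) R] by (simp del: of_nat_Suc)
  have "Q - R = (1 - real k / real (Suc k)) *\<^sub>R (Q - P)" by (simp add: R_def algebra_simps)
  moreover have "1 - real k / real (Suc k) = 1 / real (Suc k)" by (simp add: field_simps)
  ultimately have "dist R Q = 1 / real (Suc k) * dist P Q"
    by (simp add: dist_norm norm_minus_commute[of R] norm_minus_commute[of P] del: of_nat_Suc)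
  also have "\<dots> \<le> 1 / real (Suc k) * (real (Suc k) * t)"
    by (rule mult_left_mono[OF Suc.prems(3)]) simp
  finally have "\<bar>\<psi> Q - \<psi> R\<bar> \<le> W" using W[OF R Suc.prems(2)] by (simp del: of_nat_Suc)
  with 1 show ?case by (simp add: algebra_simps)
qed

lemma modulus_D_bound:
  assumes W: "modulus_D S 2 f t = ereal W" and \<alpha>: "\<alpha> \<in> multi_indices 2" and P: "P \<in> S" "Q \<in> S" "dist P Q \<le> t"
  shows "\<bar>multi_deriv S \<alpha> f Q - multi_deriv S \<alpha> f P\<bar> \<le> W"
proof -
  have "ereal \<bar>multi_deriv S \<alpha> f P - multi_deriv S \<alpha> f Q\<bar> \<le> modulus S (multi_deriv S \<alpha> f) t"
    unfolding modulus_def by (rule SUP_upper2[of "(P, Q)"]) (use P in auto)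
  also have "\<dots> \<le> modulus_D S 2 f t"
    unfolding modulus_D_def by (rule Max_ge) (use \<alpha> in \<open>auto simp: multi_indices_2\<close>)
  finally show ?thesis by (simp add: W abs_minus_commute)
qed

lemma sup_norm_D_bound:
  assumes N: "sup_norm_D S 3 f = ereal N" and \<alpha>: "\<alpha> \<in> multi_indices 3" and P: "P \<in> S"
  shows "\<bar>multi_deriv S \<alpha> f P\<bar> \<le> N"
proof -
  have "ereal \<bar>multi_deriv S \<alpha> f P\<bar> \<le> sup_norm S (multi_deriv S \<alpha> f)"
    unfolding sup_norm_def by (rule SUP_upper[OF P])
  also have "\<dots> \<le> sup_norm_D S 3 f"
    unfolding sup_norm_D_def by (rule Max_ge) (use \<alpha> in \<open>auto simp: multi_indices_3\<close>)
  finally show ?thesis by (simp add: N)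
qed

lemma modulus_D_nonneg:
  assumes "P \<in> S" "0 \<le> t"
  shows "0 \<le> modulus_D S 2 f t"
proof -
  have "0 \<le> modulus S (multi_deriv S (2, 0) f) t"
    unfolding modulus_def by (rule SUP_upper2[of "(P, P)"]) (use assms in auto)
  also have "\<dots> \<le> modulus_D S 2 f t"
    unfolding modulus_D_def by (rule Max_ge) (auto simp: multi_indices_2)
  finally show ?thesis .
qed

lemma sup_norm_D_nonneg:
  assumes "P \<in> S"
  shows "0 \<le> sup_norm_D S 3 f"
proof -
  have "0 \<le> sup_norm S (multi_deriv S (3, 0) f)"
    unfolding sup_norm_def by (rule SUP_upper2[OF assms]) simp
  also have "\<dots> \<le> sup_norm_D S 3 f"
    unfolding sup_norm_D_def by (rule Max_ge) (auto simp: multi_indices_3)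
  finally show ?thesis .
qed

text \<open>If \<open>X\<close> is infinite, the positive factor makes the right-hand side infinite.
  So pointwise real estimates suffice, and finiteness of the modulus or norm need not be
  shown.\<close>

lemma sup_norm_le_ereal_mult:
  assumes X: "0 \<le> X" and c: "0 < c" and B: "\<And>W p. X = ereal W \<Longrightarrow> p \<in> U \<Longrightarrow> \<bar>g p\<bar> \<le> c * W"
  shows "sup_norm U g \<le> ereal c * X"
proof (cases X)
  case (real W)
  then show ?thesis unfolding sup_norm_def using B by (intro SUP_least) simp
next
  case PInf
  then show ?thesis using c by simp
qed (use X in simp)

text \<open>In units of \<open>h / 2\<close> the increments have length at most 2,
  \<open>2 * sqrt 2 < 3\<close> and \<open>2 * sqrt 5 < 5\<close>, hence oscillations
  \<open>2 * W\<close>, \<open>3 * W\<close>, \<open>5 * W\<close> by \<open>modulus_chain\<close>.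
  Increment sums \<open>h\<close> and \<open>2 * h\<close> in the quadratic remainder give
  \<open>2 * W / 2 * h^2\<close> and \<open>3 * W / 2 * (2 * h)^2\<close>.\<close>

lemma taylor_control_modulus:
  assumes S: "S = {a..b} \<times> {c..d}" and f: "C_k_on 2 S f" and h: "0 \<le> h" and W: "modulus_D S 2 f (h / 2)
      = ereal W" and W0: "0 \<le> W"
  shows "taylor_control a b c d h (h\<^sup>2 * W) (6 * h\<^sup>2 * W) (2 * W) (3 * W) (5 * W) S f"
proof -
  have cv: "convex S" unfolding S by (intro convex_Times convex_real_interval)
  have osc: "\<bar>multi_deriv S \<alpha> f Q - multi_deriv S \<alpha> f P\<bar> \<le> real k * W"
    if "\<alpha> \<in> multi_indices 2" "P \<in> S" "Q \<in> S" "dist P Q \<le> real k * (h / 2)" for \<alpha> P Q k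
    by (rule modulus_chain[OF cv modulus_D_bound[OF W that(1)] that(2-4)])
  have O1: "\<bar>multi_deriv S \<alpha> f Q - multi_deriv S \<alpha> f P\<bar> \<le> 2 * W"
    if "\<alpha> \<in> multi_indices 2" "P \<in> S" "Q \<in> S" "\<bar>fst Q - fst P\<bar> + \<bar>snd Q - snd P\<bar> \<le> h" for \<alpha> P Q
    using osc[OF that(1-3), of 2] dist_le_abs_sum[of P Q] that(4) by simp
  have O2: "\<bar>multi_deriv S \<alpha> f Q - multi_deriv S \<alpha> f P\<bar> \<le> 3 * W"
    if "\<alpha> \<in> multi_indices 2" "P \<in> S" "Q \<in> S" "\<bar>fst Q - fst P\<bar> \<le> h" "\<bar>snd Q - snd P\<bar> \<le> h" for \<alpha> P Q
  proof -
    have "dist P Q \<le> 3 * (h / 2)" using h by (intro dist_le_box[OF that(4,5)]) (auto simp: power2_eq_square)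
    then show ?thesis using osc[OF that(1-3), of 3] by simp
  qed
  have O3: "\<bar>multi_deriv S \<alpha> f Q - multi_deriv S \<alpha> f P\<bar> \<le> 5 * W"
    if "\<alpha> \<in> multi_indices 2" "P \<in> S" "Q \<in> S" and
      d: "\<bar>fst Q - fst P\<bar> \<le> 2 * h \<and> \<bar>snd Q - snd P\<bar> \<le> h \<or> \<bar>fst Q - fst P\<bar> \<le> h \<and> \<bar>snd Q - snd P\<bar>
          \<le> 2 * h" for \<alpha> P Q
  proof -
    have "dist P Q \<le> 5 * (h / 2)"
      using d h dist_le_box[of Q P "2 * h" h "5 * (h / 2)"] dist_le_box[of Q P h "2 * h" "5 * (h / 2)"]
      by (auto simp: power2_eq_square)
    then show ?thesis using osc[OF that(1-3), of 5] by simp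
  qed
  note taylor = taylor_C2[where a = a and b = b and c = c and d = d, folded S]
  show ?thesis
  proof
    fix P Q assume PQ: "P \<in> S" "Q \<in> S" and d: "\<bar>fst Q - fst P\<bar> + \<bar>snd Q - snd P\<bar> \<le> h"
    have "\<bar>f Q - taylor_poly S f P Q\<bar> \<le> 2 * W / 2 * (\<bar>fst Q - fst P\<bar> + \<bar>snd Q - snd P\<bar>)\<^sup>2"
    proof (rule taylor[OF f PQ])
      fix \<alpha> R assume "\<alpha> \<in> multi_indices 2" "R \<in> S" "\<bar>fst R - fst P\<bar> \<le> \<bar>fst Q - fst P\<bar>" "\<bar>snd R - snd P\<bar>
          \<le> \<bar>snd Q - snd P\<bar>"
      then show "\<bar>multi_deriv S \<alpha> f R - multi_deriv S \<alpha> f P\<bar> \<le> 2 * W" using O1[OF _ PQ(1), of \<alpha> R] d by auto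
    qed
    also have "\<dots> \<le> 2 * W / 2 * h\<^sup>2" using W0 d by (intro mult_left_mono power_mono) auto
    finally show "\<bar>f Q - taylor_poly S f P Q\<bar> \<le> h\<^sup>2 * W" by (simp add: mult.commute)
  next
    fix P Q assume PQ: "P \<in> S" "Q \<in> S" and d: "\<bar>fst Q - fst P\<bar> \<le> h" "\<bar>snd Q - snd P\<bar> \<le> h"
    have "\<bar>f Q - taylor_poly S f P Q\<bar> \<le> 3 * W / 2 * (\<bar>fst Q - fst P\<bar> + \<bar>snd Q - snd P\<bar>)\<^sup>2"
    proof (rule taylor[OF f PQ])
      fix \<alpha> R assume "\<alpha> \<in> multi_indices 2" "R \<in> S" "\<bar>fst R - fst P\<bar> \<le> \<bar>fst Q - fst P\<bar>" "\<bar>snd R - snd P\<bar>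
          \<le> \<bar>snd Q - snd P\<bar>"
      then show "\<bar>multi_deriv S \<alpha> f R - multi_deriv S \<alpha> f P\<bar> \<le> 3 * W" using O2[OF _ PQ(1), of \<alpha> R] d by auto
    qed
    also have "\<dots> \<le> 3 * W / 2 * (2 * h)\<^sup>2" using W0 d by (intro mult_left_mono power_mono) auto
    finally show "\<bar>f Q - taylor_poly S f P Q\<bar> \<le> 6 * h\<^sup>2 * W" by (simp add: power2_eq_square algebra_simps)
  next
    show "h\<^sup>2 * W \<le> 6 * h\<^sup>2 * W" using W0 by (simp add: mult_right_mono)
  qed (use S f O1 O2 O3 W0 in \<open>auto simp del: atLeastAtMost_iff\<close>)
qed

text \<open>The increment sums are at most \<open>h\<close>, \<open>2 * h\<close>,
  \<open>3 * h\<close>; they enter linearly in the oscillations, and the first two enter cubed in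
  the Taylor remainders, whence the 8.\<close>

lemma taylor_control_C3:
  assumes S: "S = {a..b} \<times> {c..d}" and ab: "a < b" and cd: "c < d" and f: "C_k_on 3 S f" and h: "0
      \<le> h" and N: "sup_norm_D S 3 f = ereal N" and N0: "0 \<le> N"
  shows "taylor_control a b c d h (h ^ 3 * N / 6) (8 * h ^ 3 * N / 6) (h * N) (2 * h * N) (3 * h * N) S f"
proof -
  have B: "\<bar>multi_deriv S \<beta> f Q\<bar> \<le> N" if "\<beta> \<in> multi_indices 3" "Q \<in> S" for \<beta> Q
    by (rule sup_norm_D_bound[OF N that])
  have T: "\<bar>f Q - taylor_poly S f P Q\<bar> \<le> N / 6 * r ^ 3"
    if "P \<in> S" "Q \<in> S" "\<bar>fst Q - fst P\<bar> + \<bar>snd Q - snd P\<bar> \<le> r" for P Q r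
  proof -
    have "\<bar>f Q - taylor_poly S f P Q\<bar> \<le> N / 6 * (\<bar>fst Q - fst P\<bar> + \<bar>snd Q - snd P\<bar>) ^ 3"
      by (rule taylor_C3[where a = a and b = b and c = c and d = d, folded S, OF f that(1,2) B])
    also have "\<dots> \<le> N / 6 * r ^ 3" using N0 that(3) by (intro mult_left_mono power_mono) auto
    finally show ?thesis .
  qed
  have L: "\<bar>multi_deriv S \<alpha> f Q - multi_deriv S \<alpha> f P\<bar> \<le> r * N"
    if "\<alpha> \<in> multi_indices 2" "P \<in> S" "Q \<in> S" "\<bar>fst Q - fst P\<bar> + \<bar>snd Q - snd P\<bar> \<le> r" for \<alpha> P Q r
  proof -
    have "\<bar>multi_deriv S \<alpha> f Q - multi_deriv S \<alpha> f P\<bar> \<le> N * (\<bar>fst Q - fst P\<bar> + \<bar>snd Q - snd P\<bar>)"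
      by (rule second_deriv_lipschitz[where a = a and b = b and c = c and d
          = d, folded S, OF f ab cd that(2,3,1) B])
    also have "\<dots> \<le> N * r" using N0 that(4) by (rule mult_left_mono[rotated])
    finally show ?thesis by (simp add: mult.commute)
  qed
  have f2: "C_k_on 2 S f" using f by (auto simp: numeral_3_eq_3 numeral_2_eq_2)
  have hN: "0 \<le> h * N" "0 \<le> h ^ 3 * N" using h N0 by simp_all
  show ?thesis
  proof
    fix P Q assume "P \<in> S" "Q \<in> S" "\<bar>fst Q - fst P\<bar> + \<bar>snd Q - snd P\<bar> \<le> h"
    from T[OF this] show "\<bar>f Q - taylor_poly S f P Q\<bar> \<le> h ^ 3 * N / 6" by (simp add: mult.commute)
  next
    fix P Q assume PQ: "P \<in> S" "Q \<in> S" and d: "\<bar>fst Q - fst P\<bar> \<le> h" "\<bar>snd Q - snd P\<bar> \<le> h"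
    have "\<bar>fst Q - fst P\<bar> + \<bar>snd Q - snd P\<bar> \<le> 2 * h" using d by linarith
    from T[OF PQ this] show "\<bar>f Q - taylor_poly S f P Q\<bar> \<le> 8 * h ^ 3 * N / 6" by
        (simp add: power_mult_distrib mult_ac)
  next
    fix \<alpha> P Q assume A: "\<alpha> \<in> multi_indices 2" "P \<in> S" "Q \<in> S"
    show "\<bar>multi_deriv S \<alpha> f Q - multi_deriv S \<alpha> f P\<bar> \<le> h * N" if "\<bar>fst Q - fst P\<bar> + \<bar>snd Q - snd P\<bar> \<le> h"
      using L[OF A that] .
    show "\<bar>multi_deriv S \<alpha> f Q - multi_deriv S \<alpha> f P\<bar> \<le> 2 * h * N" if "\<bar>fst Q - fst P\<bar> \<le> h" "\<bar>snd Q - snd P\<bar>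
        \<le> h"
      using L[OF A, of "2 * h"] that by simp
    show "\<bar>multi_deriv S \<alpha> f Q - multi_deriv S \<alpha> f P\<bar> \<le> 3 * h * N"
      if "\<bar>fst Q - fst P\<bar> \<le> 2 * h \<and> \<bar>snd Q - snd P\<bar> \<le> h \<or> \<bar>fst Q - fst P\<bar> \<le> h \<and> \<bar>snd Q - snd P\<bar> \<le> 2 * h"
      using L[OF A, of "3 * h"] that by auto
  qed (use S f2 hN in \<open>auto simp: mult_ac\<close>)
qed

theorem theorem6:
  fixes a b c d :: real and m n :: int and x y u v :: "int \<Rightarrow> real"
    and Q :: "(real \<times> real \<Rightarrow> real) \<Rightarrow> real \<times> real \<Rightarrow> real" and K2 K3 :: real
    and \<Omega> :: "(real \<times> real) set" and h \<delta> :: real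
  assumes "partition_of a b m x" and "partition_of c d n y"
    and "extended_knots m x u" and "extended_knots n y v"
    and "\<Omega> = {a..b} \<times> {c..d}"
    and "h = mesh_max m n x y" and "\<delta> = mesh_min m n x y"
    and "(Q = S2 m n x y u v \<and> K2 = 183 \<and> K3 = 269 / 8) \<or>
         (Q = W2_star m n x y u v \<and> K2 = 195 / 2 \<and> K3 = 65 / 4)"
  shows
    "(\<exists>D2>0. D2 \<le> K2 \<and>
        (\<forall>f. C_k_on 2 \<Omega> f \<longrightarrow>
          (\<forall>\<alpha>\<in>multi_indices 2. \<forall>T\<in>criss_cross {1..m} {1..n} x y.
             sup_norm (interior T) (\<lambda>p. multi_deriv \<Omega> \<alpha> f p - multi_deriv \<Omega> \<alpha> (Q f) p)
               \<le> ereal (1 + D2 * (h / \<delta>)\<^sup>2) * modulus_D \<Omega> 2 f (h / 2)))) \<and>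
     (\<exists>D3>0. D3 \<le> K3 \<and>
        (\<forall>f. C_k_on 3 \<Omega> f \<longrightarrow>
          (\<forall>\<alpha>\<in>multi_indices 2. \<forall>T\<in>criss_cross {1..m} {1..n} x y.
             sup_norm (interior T) (\<lambda>p. multi_deriv \<Omega> \<alpha> f p - multi_deriv \<Omega> \<alpha> (Q f) p)
               \<le> ereal ((1 + D3 * (h / \<delta>)\<^sup>2) * h) * sup_norm_D \<Omega> 3 f)))"
proof -
  note x = assms(1) and y = assms(2) and u = assms(3) and v = assms(4) and \<Omega> = assms(5) and Q = assms(8)
  note hx = step_le_mesh_max[OF x y, folded assms(6)] and \<delta> = mesh_min_bounds[OF x y, folded assms(7)]
  have m: "1 \<in> {1..m}" "1 \<in> {1..n}" using x y by (simp_all add: partition_of_def)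
  have \<delta>h: "\<delta> \<le> h" using \<delta>(2)[OF m(1)] hx(1)[of 1] m by auto
  then have h: "0 < h" using \<delta>(1) by simp
  have r1: "1 \<le> (h / \<delta>)\<^sup>2" using \<delta>h \<delta>(1) by (simp add: power_divide power_mono)
  have ab: "a < b" "c < d"
    using partition_of_strict[OF x m(1)] partition_of_mono[OF x, of 1 m] partition_of_strict[OF y m(2)]
        partition_of_mono[OF y, of 1 n] m x y
    by (auto simp: partition_of_def)
  have ac: "(a, c) \<in> \<Omega>" using ab by (simp add: \<Omega>)
  have qi: "quasi_interpolation a b c d h e1 e2 d1 d2 d3 \<Omega> f m n x y u v \<delta>"
    if "taylor_control a b c d h e1 e2 d1 d2 d3 \<Omega> f" for e1 e2 d1 d2 d3 f
    using that x y u v hx \<delta> by (intro quasi_interpolation.intro quasi_interpolation_axioms.intro)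
  \<comment> \<open>The stencil gives \<open>12 * 9/4 + 4 * 29/4 = 56\<close> for \<open>S2\<close>
    and \<open>12 * 5/2 + 4 * 31/4 = 61\<close> for \<open>W2_star\<close>. The oscillation in the
    cell is \<open>2 * W\<close>; one \<open>W\<close> is absorbed by
    \<open>(h / \<delta>)^2 \<ge> 1\<close>, so 62 serves both.\<close>
  have part1: "\<bar>multi_deriv \<Omega> \<alpha> f P - multi_deriv \<Omega> \<alpha> (Q f) P\<bar> \<le> (1 + 62 * (h / \<delta>)\<^sup>2) * W"
    if f: "C_k_on 2 \<Omega> f" and \<alpha>: "\<alpha> \<in> multi_indices 2" and T: "T \<in> criss_cross {1..m} {1..n} x y" and P: "P \<in>
        interior T"
      and W: "modulus_D \<Omega> 2 f (h / 2) = ereal W" for f \<alpha> T P W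
  proof -
    have W0: "0 \<le> W" using modulus_D_nonneg[OF ac, of "h / 2" f] h W by simp
    interpret quasi_interpolation a b c d h "h\<^sup>2 * W" "6 * h\<^sup>2 * W" "2 * W" "3 * W" "5 * W" \<Omega> f m n x y u v \<delta>
      by (rule qi[OF taylor_control_modulus[OF \<Omega> f _ W W0]]) (use h in simp)
    have "(12 * (h\<^sup>2 * W + h\<^sup>2 / 4 * (5 * W)) + 4 * (6 * h\<^sup>2 * W + h\<^sup>2 / 4 * (5 * W))) / \<delta>\<^sup>2 = 56 *
        ((h / \<delta>)\<^sup>2 * W)"
      by (simp add: power_divide field_simps)
    note s = S2_error[OF T P \<alpha>, unfolded this]
    have "(12 * (h\<^sup>2 * W + h\<^sup>2 * W + h\<^sup>2 / 4 * (2 * W)) + 4 * (6 * h\<^sup>2 * W + h\<^sup>2 * W + h\<^sup>2 / 4 *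
        (3 * W))) / \<delta>\<^sup>2 = 61 * ((h / \<delta>)\<^sup>2 * W)"
      by (simp add: power_divide field_simps)
    note w = W2_star_error[OF T P \<alpha>, unfolded this]
    have W1: "W \<le> (h / \<delta>)\<^sup>2 * W" using mult_right_mono[OF r1 W0] by simp
    have "\<bar>multi_deriv \<Omega> \<alpha> f P - multi_deriv \<Omega> \<alpha> (Q f) P\<bar> \<le> W + 62 * ((h / \<delta>)\<^sup>2 * W)"
      using Q
    proof (elim disjE conjE)
      assume "Q = S2 m n x y u v" then show ?thesis using s W0 W1 by simp
    next
      assume "Q = W2_star m n x y u v" then show ?thesis using w W1 by simp
    qed
    then show ?thesis by (simp add: algebra_simps)
  qed
  \<comment> \<open>\<open>S2\<close> gives \<open>12 * 11/12 + 4 * 25/12 = 58/3\<close> and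
    \<open>W2_star\<close> gives \<open>12 * 7/12 + 4 * 2 = 15\<close>. The first exceeds the limit
    \<open>65/4\<close> for \<open>W2_star\<close>, so the constant depends on
    \<open>Q\<close>.\<close>
  define D3 :: real where "D3 = (if Q = W2_star m n x y u v then 15 else 58 / 3)"
  have part2: "\<bar>multi_deriv \<Omega> \<alpha> f P - multi_deriv \<Omega> \<alpha> (Q f) P\<bar> \<le> ((1 + D3 * (h / \<delta>)\<^sup>2) * h) * N"
    if f: "C_k_on 3 \<Omega> f" and \<alpha>: "\<alpha> \<in> multi_indices 2" and T: "T \<in> criss_cross {1..m} {1..n} x y" and P: "P \<in>
        interior T"
      and N: "sup_norm_D \<Omega> 3 f = ereal N" for f \<alpha> T P N
  proof -
    have N0: "0 \<le> N" using sup_norm_D_nonneg[OF ac, of f] N by simp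
    interpret quasi_interpolation a b c d h "h ^ 3 * N / 6" "8 * h ^ 3 * N / 6" "h * N" "2 * h * N"
        "3 * h * N" \<Omega> f m n x y u v \<delta>
      by (rule qi[OF taylor_control_C3[OF \<Omega> ab f _ N N0]]) (use h in simp)
    have "(12 * (h ^ 3 * N / 6 + h\<^sup>2 / 4 * (3 * h * N)) + 4 * (8 * h ^ 3 * N / 6 + h\<^sup>2 / 4 * (3 * h * N))) / \<delta>\<^sup>2
        = 58 / 3 * (h / \<delta>)\<^sup>2 * h * N"
      by (simp add: power_divide power3_eq_cube power2_eq_square field_simps)
    note s = S2_error[OF T P \<alpha>, unfolded this]
    have "(12 * (h ^ 3 * N / 6 + h ^ 3 * N / 6 + h\<^sup>2 / 4 * (h * N)) + 4 * (8 * h ^ 3 * N / 6 + h ^ 3 * N / 6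
        + h\<^sup>2 / 4 * (2 * h * N))) / \<delta>\<^sup>2
        = 15 * (h / \<delta>)\<^sup>2 * h * N"
      by (simp add: power_divide power3_eq_cube power2_eq_square field_simps)
    note w = W2_star_error[OF T P \<alpha>, unfolded this]
    have "\<bar>multi_deriv \<Omega> \<alpha> f P - multi_deriv \<Omega> \<alpha> (Q f) P\<bar> \<le> h * N + D3 * (h / \<delta>)\<^sup>2 * h * N"
    proof (cases "Q = W2_star m n x y u v")
      case True then show ?thesis using w by (simp add: D3_def)
    next
      case False
      then have "Q = S2 m n x y u v" using Q by simp
      with False show ?thesis using s by (simp add: D3_def)
    qed
    then show ?thesis by (simp add: algebra_simps)
  qed
  have D3: "0 < D3" "D3 \<le> K3" using Q by (auto simp: D3_def)
  have D2: "0 < (62 :: real)" "62 \<le> K2" using Q by auto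
  show ?thesis
  proof (rule conjI[OF exI[of _ 62] exI[of _ D3]]; intro conjI allI impI ballI D2 D3)
    fix f \<alpha> T assume f: "C_k_on 2 \<Omega> f" and A: "\<alpha> \<in> multi_indices 2" "T \<in> criss_cross {1..m} {1..n} x y"
    show "sup_norm (interior T) (\<lambda>p. multi_deriv \<Omega> \<alpha> f p - multi_deriv \<Omega> \<alpha> (Q f) p)
               \<le> ereal (1 + 62 * (h / \<delta>)\<^sup>2) * modulus_D \<Omega> 2 f (h / 2)"
    proof (rule sup_norm_le_ereal_mult)
      show "0 \<le> modulus_D \<Omega> 2 f (h / 2)" using modulus_D_nonneg[OF ac] h by simp
      show "0 < 1 + 62 * (h / \<delta>)\<^sup>2" using r1 by linarith
    qed (rule part1[OF f A])
  next
    fix f \<alpha> T assume f: "C_k_on 3 \<Omega> f" and A: "\<alpha> \<in> multi_indices 2" "T \<in> criss_cross {1..m} {1..n} x y"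
    show "sup_norm (interior T) (\<lambda>p. multi_deriv \<Omega> \<alpha> f p - multi_deriv \<Omega> \<alpha> (Q f) p)
               \<le> ereal ((1 + D3 * (h / \<delta>)\<^sup>2) * h) * sup_norm_D \<Omega> 3 f"
    proof (rule sup_norm_le_ereal_mult)
      show "0 \<le> sup_norm_D \<Omega> 3 f" by (rule sup_norm_D_nonneg[OF ac])
      have "0 < 1 + D3 * (h / \<delta>)\<^sup>2" using D3(1) by (intro add_pos_nonneg) auto
      then show "0 < (1 + D3 * (h / \<delta>)\<^sup>2) * h" using h by simp
    qed (rule part2[OF f A])
  qed
qed

end
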